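(* Let $(M,\langle\,,\rangle)$ be a smooth, connected, non-compact, complete Riemannian manifold of dimension $m\ge 2$, fix $o\in M$, and let $r(x)=\mathrm{dist}(x,o)$ and $B_t=\{x\in M: r(x)<t\}$. Let $\varphi\in C^1((0,+\infty))\cap C^0([0,+\infty))$ be real valued with $\varphi(0)=0$, $\varphi(t)>0$ for all $t>0$, and $\varphi(t)\le A t^{\delta}$ for all $t\ge 0$, for some positive constants $A$ and $\delta$. Let $b$ be a continuous function on $M$ satisfying $$b(x)\ge \frac{1}{Q(r(x))}\quad\text{on } M,$$ where $Q(t)$ is positive, non-decreasing and satisfies $Q(t)=o(t^{1+\delta})$ as $t\to+\infty$. Let $f\in C^0(\mathbb{R})$, and assume that $u\in C^1(M)$ satisfies $u^*=\sup_M u<+\infty$ and $$\mathrm{div}\big(|\nabla u|^{-1}\varphi(|\nabla u|)\nabla u\big)\ge b(x)f(u)$$ on the set $\Omega_\gamma=\{x\in M: u(x)>\gamma\}$, for some $\gamma<u^*$. If $$\liminf_{r\to+\infty}\frac{Q(r)\log \mathrm{vol}\,B_r}{r^{1+\delta}}<+\infty,$$ then $f(u^* )\le 0$.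
   Context: The vector field $|\nabla u|^{-1}\varphi(|\nabla u|)\nabla u$ is understood to be $0$ where $\nabla u=0$. If this vector field is not $C^1$, the divergence, and hence the differential inequality, is interpreted in the sense of distributions. $\mathrm{vol}\,B_r$ is the Riemannian volume of the geodesic ball $B_r$ centered at $o$. *)

theory Defs
  imports "HOL-Analysis.Analysis"
begin

text \<open>
  Calculus of class \<open>C\<^sup>k\<close> on open subsets of normed spaces, by iterating directional derivatives
  (for open \<open>S\<close> and finite-dimensional domains this is the usual notion).
\<close>

primrec higher_differentiable_on ::
    "'a::real_normed_vector set \<Rightarrow> ('a \<Rightarrow> 'b::real_normed_vector) \<Rightarrow> nat \<Rightarrow> bool" where
  "higher_differentiable_on S f 0 \<longleftrightarrow> continuous_on S f"
| "higher_differentiable_on S f (Suc k) \<longleftrightarrow>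
     (\<forall>x\<in>S. f differentiable (at x)) \<and>
     (\<forall>v. higher_differentiable_on S (\<lambda>x. frechet_derivative f (at x) v) k)"

definition smooth_on :: "'a::real_normed_vector set \<Rightarrow> ('a \<Rightarrow> 'b::real_normed_vector) \<Rightarrow> bool" where
  "smooth_on S f \<longleftrightarrow> (\<forall>k. higher_differentiable_on S f k)"

definition partial_deriv :: "'n::finite \<Rightarrow> (real^'n \<Rightarrow> real) \<Rightarrow> real^'n \<Rightarrow> real" where
  "partial_deriv i f x = frechet_derivative f (at x) (axis i 1)"

text \<open>
  A chart is a pair of its domain and its coordinate map; the values of the coordinate map
  outside the domain are irrelevant.
\<close>

type_synonym ('a, 'n) chart = "'a set \<times> ('a \<Rightarrow> real^'n)"

definition chart_image :: "('a, 'n::finite) chart \<Rightarrow> (real^'n) set" where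
  "chart_image c = snd c ` fst c"

definition chart_inv :: "('a, 'n::finite) chart \<Rightarrow> real^'n \<Rightarrow> 'a" where
  "chart_inv c = inv_into (fst c) (snd c)"

definition chart_at :: "('a, 'n::finite) chart set \<Rightarrow> 'a \<Rightarrow> ('a, 'n) chart" where
  "chart_at A p = (SOME c. c \<in> A \<and> p \<in> fst c)"

text \<open>
  Tensor fields are given by their components in each chart of the atlas: \<open>G c p\<close> is the matrix
  \<open>(g\<^sub>i\<^sub>j)\<close> of the metric at \<open>p\<close> in the chart \<open>c\<close>, and \<open>metric_change\<close> is its transformation rule.
  The atlas \<open>A\<close> need not be maximal.
\<close>

locale riemannian_manifold =
  fixes A :: "('a::{t2_space, second_countable_topology}, 'n::finite) chart set"
    and G :: "('a, 'n) chart \<Rightarrow> 'a \<Rightarrow> real^'n^'n"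
  assumes atlas_cover: "(\<Union>c\<in>A. fst c) = UNIV"
    and chart_open: "c \<in> A \<Longrightarrow> open (fst c)" "c \<in> A \<Longrightarrow> open (chart_image c)"
    and chart_homeo: "c \<in> A \<Longrightarrow> homeomorphism (fst c) (chart_image c) (snd c) (chart_inv c)"
    and chart_compat: "c \<in> A \<Longrightarrow> c' \<in> A \<Longrightarrow>
          smooth_on (snd c ` (fst c \<inter> fst c')) (snd c' \<circ> chart_inv c)"
    and metric_smooth: "c \<in> A \<Longrightarrow> smooth_on (chart_image c) (G c \<circ> chart_inv c)"
    and metric_sym: "c \<in> A \<Longrightarrow> p \<in> fst c \<Longrightarrow> transpose (G c p) = G c p"
    and metric_pos: "c \<in> A \<Longrightarrow> p \<in> fst c \<Longrightarrow> v \<noteq> 0 \<Longrightarrow> v \<bullet> (G c p *v v) > 0"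
    and metric_change: "c \<in> A \<Longrightarrow> c' \<in> A \<Longrightarrow> p \<in> fst c \<inter> fst c' \<Longrightarrow>
          J = jacobian (snd c' \<circ> chart_inv c) (at (snd c p)) \<Longrightarrow>
          G c p = transpose J ** G c' p ** J"

context
  fixes A :: "('a::{t2_space, second_countable_topology}, 'n::finite) chart set"
    and G :: "('a, 'n) chart \<Rightarrow> 'a \<Rightarrow> real^'n^'n"
begin

definition C1_function :: "('a \<Rightarrow> real) \<Rightarrow> bool" where
  "C1_function u \<longleftrightarrow> (\<forall>c\<in>A. higher_differentiable_on (chart_image c) (u \<circ> chart_inv c) 1)"

definition smooth_function :: "('a \<Rightarrow> real) \<Rightarrow> bool" where
  "smooth_function u \<longleftrightarrow> (\<forall>c\<in>A. smooth_on (chart_image c) (u \<circ> chart_inv c))"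

definition metric_inner :: "('a, 'n) chart \<Rightarrow> 'a \<Rightarrow> real^'n \<Rightarrow> real^'n \<Rightarrow> real" where
  "metric_inner c p v w = v \<bullet> (G c p *v w)"

definition metric_norm :: "('a, 'n) chart \<Rightarrow> 'a \<Rightarrow> real^'n \<Rightarrow> real" where
  "metric_norm c p v = sqrt (metric_inner c p v v)"

text \<open>Distance: infimum of the lengths of piecewise \<open>C\<^sup>1\<close> curves on \<open>[0, 1]\<close>.\<close>

definition C1_curve_on :: "real \<Rightarrow> real \<Rightarrow> (real \<Rightarrow> 'a) \<Rightarrow> bool" where
  "C1_curve_on a b \<gamma> \<longleftrightarrow> continuous_on {a..b} \<gamma> \<and>
     (\<forall>c\<in>A. \<exists>D. continuous_on {t\<in>{a..b}. \<gamma> t \<in> fst c} D \<and>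
        (\<forall>t\<in>{a..b}. \<gamma> t \<in> fst c \<longrightarrow>
           (snd c \<circ> \<gamma> has_vector_derivative D t) (at t within {a..b})))"

definition piecewise_C1_curve :: "(real \<Rightarrow> 'a) \<Rightarrow> bool" where
  "piecewise_C1_curve \<gamma> \<longleftrightarrow> continuous_on {0..1} \<gamma> \<and>
     (\<exists>S. finite S \<and>
        (\<forall>a b. 0 \<le> a \<and> a < b \<and> b \<le> 1 \<and> {a<..<b} \<inter> S = {} \<longrightarrow> C1_curve_on a b \<gamma>))"

definition curve_speed :: "(real \<Rightarrow> 'a) \<Rightarrow> real \<Rightarrow> real" where
  "curve_speed \<gamma> t = (let c = chart_at A (\<gamma> t)
     in metric_norm c (\<gamma> t) (vector_derivative (snd c \<circ> \<gamma>) (at t)))"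

definition curve_length :: "(real \<Rightarrow> 'a) \<Rightarrow> real" where
  "curve_length \<gamma> = integral {0..1} (curve_speed \<gamma>)"

definition riem_dist :: "'a \<Rightarrow> 'a \<Rightarrow> real" where
  "riem_dist x y = Inf {curve_length \<gamma> |\<gamma>. piecewise_C1_curve \<gamma> \<and> \<gamma> 0 = x \<and> \<gamma> 1 = y}"

definition riem_ball :: "'a \<Rightarrow> real \<Rightarrow> 'a set" where
  "riem_ball p t = {x. riem_dist x p < t}"

definition complete_manifold :: bool where
  "complete_manifold \<longleftrightarrow> Metric_space.mcomplete UNIV riem_dist"

definition volume_density :: "('a, 'n) chart \<Rightarrow> 'a \<Rightarrow> real" where
  "volume_density c p = sqrt (det (G c p))"

text \<open>The Borel measure given by \<open>\<surd>(det g) dx\<close> in every chart.\<close>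

definition riem_volume :: "'a measure" where
  "riem_volume = (THE \<mu>. sets \<mu> = sets borel \<and>
     (\<forall>c\<in>A. \<forall>E\<in>sets borel. E \<subseteq> fst c \<longrightarrow>
        emeasure \<mu> E = (\<integral>\<^sup>+x\<in>snd c ` E. ennreal (volume_density c (chart_inv c x)) \<partial>lborel)))"

text \<open>Components \<open>g\<^sup>i\<^sup>j \<partial>\<^sub>j u\<close> of the gradient of \<open>u\<close>.\<close>

definition gradient :: "('a \<Rightarrow> real) \<Rightarrow> ('a, 'n) chart \<Rightarrow> 'a \<Rightarrow> real^'n" where
  "gradient u c p =
     matrix_inv (G c p) *v (\<chi> j. partial_deriv j (u \<circ> chart_inv c) (snd c p))"

text \<open>Components of \<open>|\<nabla>u|\<^sup>-\<^sup>1 \<phi>(|\<nabla>u|) \<nabla>u\<close>, set to \<open>0\<close> where \<open>\<nabla>u = 0\<close>.\<close>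

definition phi_gradient ::
    "(real \<Rightarrow> real) \<Rightarrow> ('a \<Rightarrow> real) \<Rightarrow> ('a, 'n) chart \<Rightarrow> 'a \<Rightarrow> real^'n" where
  "phi_gradient \<phi> u c p = (let v = gradient u c p; s = metric_norm c p v
     in if v = 0 then 0 else (\<phi> s / s) *\<^sub>R v)"

definition C1_vector_field_on :: "'a set \<Rightarrow> (('a, 'n) chart \<Rightarrow> 'a \<Rightarrow> real^'n) \<Rightarrow> bool" where
  "C1_vector_field_on W X \<longleftrightarrow>
     (\<forall>c\<in>A. higher_differentiable_on (snd c ` (fst c \<inter> W)) (X c \<circ> chart_inv c) 1)"

definition divergence ::
    "(('a, 'n) chart \<Rightarrow> 'a \<Rightarrow> real^'n) \<Rightarrow> ('a, 'n) chart \<Rightarrow> 'a \<Rightarrow> real" where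
  "divergence X c p = (1 / volume_density c p) *
     (\<Sum>i\<in>UNIV. partial_deriv i
        (\<lambda>x. volume_density c (chart_inv c x) * (X c (chart_inv c x) $ i)) (snd c p))"

definition test_function_on :: "'a set \<Rightarrow> ('a \<Rightarrow> real) \<Rightarrow> bool" where
  "test_function_on W \<psi> \<longleftrightarrow> smooth_function \<psi> \<and>
     compact (closure {x. \<psi> x \<noteq> 0}) \<and> closure {x. \<psi> x \<noteq> 0} \<subseteq> W"

definition pairing_gradient ::
    "(('a, 'n) chart \<Rightarrow> 'a \<Rightarrow> real^'n) \<Rightarrow> ('a \<Rightarrow> real) \<Rightarrow> 'a \<Rightarrow> real" where
  "pairing_gradient X \<psi> p =
     (let c = chart_at A p in metric_inner c p (X c p) (gradient \<psi> c p))"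

definition classical_div_ge ::
    "'a set \<Rightarrow> (('a, 'n) chart \<Rightarrow> 'a \<Rightarrow> real^'n) \<Rightarrow> ('a \<Rightarrow> real) \<Rightarrow> bool" where
  "classical_div_ge W X h \<longleftrightarrow> (\<forall>c\<in>A. \<forall>p\<in>fst c \<inter> W. divergence X c p \<ge> h p)"

definition distributional_div_ge ::
    "'a set \<Rightarrow> (('a, 'n) chart \<Rightarrow> 'a \<Rightarrow> real^'n) \<Rightarrow> ('a \<Rightarrow> real) \<Rightarrow> bool" where
  "distributional_div_ge W X h \<longleftrightarrow>
     (\<forall>\<psi>. test_function_on W \<psi> \<and> (\<forall>x. \<psi> x \<ge> 0) \<longrightarrow>
        - (LINT x|riem_volume. pairing_gradient X \<psi> x) \<ge> (LINT x|riem_volume. h x * \<psi> x))"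

definition div_ge_on ::
    "'a set \<Rightarrow> (('a, 'n) chart \<Rightarrow> 'a \<Rightarrow> real^'n) \<Rightarrow> ('a \<Rightarrow> real) \<Rightarrow> bool" where
  "div_ge_on W X h \<longleftrightarrow>
     (if C1_vector_field_on W X then classical_div_ge W X h else distributional_div_ge W X h)"

end

end

theory Submission
  imports Defs "HOL-Real_Asymp.Real_Asymp"
begin

text \<open>
  Suppose \<open>f(u\<^sup>*) > 0\<close> and write \<open>r\<close> for the distance to the base point. For small \<open>\<eta> > 0\<close> and large \<open>R\<close>
  one tests the differential inequality with \<open>w\<^sub>+\<^sup>N\<close>, where \<open>w = u - (u\<^sup>* - \<eta>) - (\<eta>/R) \<rho>\<close> and \<open>\<rho>\<close> is a
  \<open>C\<^sup>1\<close> function with \<open>r \<le> \<rho> \<le> r + 1\<close> and \<open>|\<nabla>\<rho>| \<le> 5\<close>. This function is supported in \<open>B\<^sub>R\<close>, where \<open>b \<ge> 1/Q(R)\<close>, and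
  \<open>\<phi>(s) s - l \<phi>(s) \<ge> - K l\<^bsup>1+\<delta>\<^esup>\<close> bounds the flux term from below. Hence \<open>\<integral> w\<^sub>+\<^sup>N \<le> \<theta> \<integral> w\<^sub>+\<^bsup>N-1\<^esup>\<close> up to
  a factor 2, with \<open>\<theta>\<close> proportional to \<open>N Q(R) (\<eta>/R)\<^bsup>1+\<delta>\<^esup>\<close>, and so \<open>\<integral> w\<^sub>+\<^sup>N \<le> \<theta>\<^sup>N vol B\<^sub>R\<close>. Since \<open>w \<ge> \<eta>/2\<close> on
  a fixed open set, choosing \<open>N\<close> such that \<open>\<theta>\<close> is about \<open>\<eta>/(2e)\<close> gives \<open>log vol B\<^sub>R \<ge> N - O(1)\<close>, that is,
  \<open>Q(R) log vol B\<^sub>R / R\<^bsup>1+\<delta>\<^esup> \<ge> c \<eta>\<^bsup>-\<delta>\<^esup> - o(1)\<close>. Letting \<open>\<eta>\<close> tend to 0 contradicts the volume growth.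
\<close>

section \<open>Functions of class \<open>C\<^sup>k\<close>\<close>

text \<open>Two regularity gaps shape the proof. The function \<open>u\<close> is only C^1, so the
  test function is only C^1, while distributional test functions are smooth: the inequality is
  therefore first extended to nonnegative compactly supported C^1 functions, by mollification in
  charts, or by the divergence theorem when the flux is C^1. And r need not be differentiable, hence
  \<rho>, whose slope bound must not depend on R. Completeness enters through the compactness of
  closed balls, which gives the test function compact support. The slope \<eta>/R is chosen because
  u - (u* - \<eta>) is at most \<eta>, so w can be positive only where \<rho> < R. The factor 2
  comes from the pointwise bound \<theta> w^(N-1) \<le> w^N + \<theta>^N on the ball, whose first
  term is absorbed. The admissible N is of order \<eta>^(-\<delta>) R^(1+\<delta>) / Q(R): it tends
  to infinity because Q(R) = o(R^(1+\<delta>)), and the power of \<eta> remaining after \<eta> /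
  \<eta>^(1+\<delta>) is what makes the bound blow up.\<close>

lemma frechet_derivative_cong_open:
  assumes "open S" "x \<in> S" "\<And>y. y \<in> S \<Longrightarrow> f y = g y"
  shows "frechet_derivative f (at x) = frechet_derivative g (at x)"
proof -
  \<comment> \<open>Differentiability is not assumed: both functions have the same derivatives at
    \<open>x\<close>, so the choice inside \<open>frechet_derivative\<close> returns the same
    map.\<close>
  have "(f has_derivative D) (at x) \<longleftrightarrow> (g has_derivative D) (at x)" for D
    using assms has_derivative_transform_within_open[of f D x UNIV S g]
      has_derivative_transform_within_open[of g D x UNIV S f] by auto
  then show ?thesis by (simp add: frechet_derivative_def)
qed

lemma differentiable_cong_open:
  assumes "open S" "x \<in> S" "\<And>y. y \<in> S \<Longrightarrow> f y = g y" "f differentiable (at x)"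
  shows "g differentiable (at x)"
  using assms unfolding differentiable_def
  by (metis has_derivative_transform_within_open)

lemma higher_differentiable_on_cong:
  assumes "open S" "\<And>x. x \<in> S \<Longrightarrow> f x = g x" "higher_differentiable_on S f k"
  shows "higher_differentiable_on S g k"
  using assms(2,3)
proof (induction k arbitrary: f g)
  case 0
  then show ?case by (simp cong: continuous_on_cong)
next
  case (Suc k)
  have "higher_differentiable_on S (\<lambda>x. frechet_derivative g (at x) v) k" for v
  proof (rule Suc.IH)
    show "higher_differentiable_on S (\<lambda>x. frechet_derivative f (at x) v) k"
      using Suc.prems by simp
    show "frechet_derivative f (at x) v = frechet_derivative g (at x) v" if "x \<in> S" for x
      using frechet_derivative_cong_open[OF assms(1) that, of f g] Suc.prems by simp
  qed
  moreover have "g differentiable (at x)" if "x \<in> S" for x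
    using differentiable_cong_open[OF assms(1) that, of f g] Suc.prems that by simp
  ultimately show ?case by simp
qed

lemma higher_differentiable_on_Suc_deriv:
  "higher_differentiable_on S f (Suc k) \<Longrightarrow>
    higher_differentiable_on S (\<lambda>x. frechet_derivative f (at x) v) k"
  by simp

lemma higher_differentiable_on_subset:
  "higher_differentiable_on S f k \<Longrightarrow> T \<subseteq> S \<Longrightarrow> higher_differentiable_on T f k"
  by (induction k arbitrary: f) (auto intro: continuous_on_subset)

text \<open>All derivatives are taken in full neighbourhoods, so the class depends only on germs;
  the local hypothesis passes to each directional derivative, which drives the induction.\<close>

lemma higher_differentiable_on_local:
  assumes "\<And>x. x \<in> S \<Longrightarrow> \<exists>T. open T \<and> x \<in> T \<and> higher_differentiable_on T f k"
  shows "higher_differentiable_on S f k"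
  using assms
proof (induction k arbitrary: f)
  case 0
  have "isCont f x" if "x \<in> S" for x
    using 0[OF that] continuous_on_eq_continuous_at by auto
  then show ?case by (simp add: continuous_at_imp_continuous_on)
next
  case (Suc k)
  have "f differentiable (at x)" if "x \<in> S" for x using Suc.prems[OF that] by auto
  moreover have "higher_differentiable_on S (\<lambda>x. frechet_derivative f (at x) v) k" for v
    by (rule Suc.IH) (use Suc.prems in fastforce)
  ultimately show ?case by simp
qed

lemma higher_differentiable_on_Suc_imp_continuous:
  "higher_differentiable_on S f k \<Longrightarrow> continuous_on S f"
  by (cases k) (auto intro!: continuous_at_imp_continuous_on differentiable_imp_continuous_within)

lemma higher_differentiable_on_SucD:
  "higher_differentiable_on S f (Suc k) \<Longrightarrow> higher_differentiable_on S f k"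
proof (induction k arbitrary: f)
  case 0
  then show ?case using higher_differentiable_on_Suc_imp_continuous[of S f "Suc 0"] by simp
next
  case (Suc k)
  then show ?case by (metis higher_differentiable_on.simps(2))
qed

lemma higher_differentiable_on_le:
  "higher_differentiable_on S f k \<Longrightarrow> j \<le> k \<Longrightarrow> higher_differentiable_on S f j"
  by (induction k) (auto simp: le_Suc_eq dest: higher_differentiable_on_SucD
      simp del: higher_differentiable_on.simps)

lemma frechet_derivative_eqI:
  "(f has_derivative D) (at x) \<Longrightarrow> frechet_derivative f (at x) = D"
  using frechet_derivative_at by metis

lemma higher_differentiable_on_const: "higher_differentiable_on S (\<lambda>x. c) k"
  by (induction k arbitrary: c) auto

lemma higher_differentiable_on_compose_linear:
  assumes L: "bounded_linear L" and S: "open S" and f: "higher_differentiable_on S f k"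
  shows "higher_differentiable_on S (\<lambda>x. L (f x)) k"
  using f
proof (induction k arbitrary: f)
  case 0
  then show ?case using L by (simp add: bounded_linear.continuous_on)
next
  case (Suc k)
  have D: "((\<lambda>x. L (f x)) has_derivative (\<lambda>v. L (frechet_derivative f (at x) v))) (at x)" if "x \<in> S" for x
    using Suc.prems that bounded_linear.has_derivative[OF L, of f _ "at x"] frechet_derivative_works[of f "at x"] by auto
  have "higher_differentiable_on S (\<lambda>x. frechet_derivative (\<lambda>x. L (f x)) (at x) v) k" for v
    by (rule higher_differentiable_on_cong[OF S _ Suc.IH[of "\<lambda>x. frechet_derivative f (at x) v"]])
      (use D frechet_derivative_eqI Suc.prems in fastforce)+
  then show ?case using D by (auto simp: differentiable_def)
qed

lemma higher_differentiable_on_linear: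
  assumes "bounded_linear L" "open S"
  shows "higher_differentiable_on S L k"
proof (cases k)
  case 0
  then show ?thesis using assms by (simp add: linear_continuous_on)
next
  case (Suc j)
  have "frechet_derivative L (at x) = L" for x
    using assms bounded_linear_imp_has_derivative frechet_derivative_eqI by blast
  then show ?thesis using Suc assms
    by (simp add: higher_differentiable_on_const bounded_linear_imp_differentiable)
qed

lemma higher_differentiable_on_add:
  assumes S: "open S" and "higher_differentiable_on S f k" "higher_differentiable_on S g k"
  shows "higher_differentiable_on S (\<lambda>x. f x + g x) k"
  using assms(2,3)
proof (induction k arbitrary: f g)
  case 0
  then show ?case by (simp add: continuous_on_add)
next
  case (Suc k)
  have D: "((\<lambda>x. f x + g x) has_derivative
      (\<lambda>v. frechet_derivative f (at x) v + frechet_derivative g (at x) v)) (at x)" if "x \<in> S" for x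
    using Suc.prems that by (intro has_derivative_add) (auto simp: frechet_derivative_works[symmetric])
  have "higher_differentiable_on S (\<lambda>x. frechet_derivative (\<lambda>x. f x + g x) (at x) v) k" for v
    by (rule higher_differentiable_on_cong[OF S _ Suc.IH[of "\<lambda>x. frechet_derivative f (at x) v" "\<lambda>x. frechet_derivative g (at x) v"]])
      (use D frechet_derivative_eqI Suc.prems in fastforce)+
  then show ?case using D by (auto simp: differentiable_def)
qed

lemma higher_differentiable_on_mult:
  fixes f g :: "'a::real_normed_vector \<Rightarrow> real"
  assumes S: "open S" and "higher_differentiable_on S f k" "higher_differentiable_on S g k"
  shows "higher_differentiable_on S (\<lambda>x. f x * g x) k"
  using assms(2,3)
proof (induction k arbitrary: f g)
  case 0
  then show ?case by (simp add: continuous_on_mult)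
next
  case (Suc k)
  have D: "((\<lambda>x. f x * g x) has_derivative
      (\<lambda>v. f x * frechet_derivative g (at x) v + frechet_derivative f (at x) v * g x)) (at x)" if "x \<in> S" for x
    using Suc.prems that by (intro has_derivative_mult) (auto simp: frechet_derivative_works[symmetric])
  have "higher_differentiable_on S (\<lambda>x. f x * frechet_derivative g (at x) v + frechet_derivative f (at x) v * g x) k" for v
    using Suc.prems
    by (intro higher_differentiable_on_add[OF S] Suc.IH)
      (blast intro: higher_differentiable_on_SucD higher_differentiable_on_Suc_deriv)+
  then have "higher_differentiable_on S (\<lambda>x. frechet_derivative (\<lambda>x. f x * g x) (at x) v) k" for v
    by (rule higher_differentiable_on_cong[OF S, rotated]) (use D frechet_derivative_eqI in fastforce)
  then show ?case using D by (auto simp: differentiable_def)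
qed

lemma higher_differentiable_on_minus:
  "open S \<Longrightarrow> higher_differentiable_on S f k \<Longrightarrow> higher_differentiable_on S (\<lambda>x. - f x) k"
  by (rule higher_differentiable_on_compose_linear[OF bounded_linear_minus[OF bounded_linear_ident]])

lemma higher_differentiable_on_diff:
  "open S \<Longrightarrow> higher_differentiable_on S f k \<Longrightarrow> higher_differentiable_on S g k \<Longrightarrow>
    higher_differentiable_on S (\<lambda>x. f x - g x) k"
  using higher_differentiable_on_add[OF _ _ higher_differentiable_on_minus, of S f k g] by simp

lemma higher_differentiable_on_sum:
  assumes "open S" "\<And>i. i \<in> I \<Longrightarrow> higher_differentiable_on S (f i) k"
  shows "higher_differentiable_on S (\<lambda>x. \<Sum>i\<in>I. f i x) k"
  using assms(2)
  by (induction I rule: infinite_finite_induct)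
    (auto intro!: higher_differentiable_on_const higher_differentiable_on_add assms(1))

lemma higher_differentiable_on_prod:
  fixes f :: "'i \<Rightarrow> 'a::real_normed_vector \<Rightarrow> real"
  assumes "open S" "\<And>i. i \<in> I \<Longrightarrow> higher_differentiable_on S (f i) k"
  shows "higher_differentiable_on S (\<lambda>x. \<Prod>i\<in>I. f i x) k"
  using assms(2)
  by (induction I rule: infinite_finite_induct)
    (auto intro!: higher_differentiable_on_const higher_differentiable_on_mult assms(1))

lemma frechet_derivative_compose_at:
  assumes "f differentiable (at x)" "g differentiable (at (f x))"
  shows "(g \<circ> f has_derivative (\<lambda>v. frechet_derivative g (at (f x)) (frechet_derivative f (at x) v))) (at x)"
  using diff_chain_at[of f "frechet_derivative f (at x)" x g "frechet_derivative g (at (f x))"] assms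
  by (simp add: frechet_derivative_works[symmetric] comp_def)

text \<open>Expanding the inner derivative in a basis of the intermediate space turns the chain rule
  into a finite sum of products of scalar functions, so the product rule and the induction
  hypothesis for the partial derivatives of \<open>g\<close> apply.\<close>

lemma higher_differentiable_on_compose:
  fixes f :: "'a::real_normed_vector \<Rightarrow> 'b::euclidean_space" and g :: "'b \<Rightarrow> real"
  assumes S: "open S" and f: "higher_differentiable_on S f k" and g: "higher_differentiable_on T g k"
    and fS: "f ` S \<subseteq> T"
  shows "higher_differentiable_on S (g \<circ> f) k"
  using f g
proof (induction k arbitrary: g)
  case 0
  then show ?case using fS by (simp add: comp_def continuous_on_compose2)
next
  case (Suc k)
  let ?Dg = "\<lambda>b y. frechet_derivative g (at y) b"
  have D: "(g \<circ> f has_derivative (\<lambda>v. frechet_derivative g (at (f x)) (frechet_derivative f (at x) v))) (at x)" if "x \<in> S" for x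
    using Suc.prems that fS by (intro frechet_derivative_compose_at) auto
  have eq: "(\<Sum>b\<in>Basis. (?Dg b \<circ> f) x * (frechet_derivative f (at x) v \<bullet> b))
     = frechet_derivative (g \<circ> f) (at x) v" if "x \<in> S" for x v
  proof -
    have lin: "linear (frechet_derivative g (at (f x)))"
      using Suc.prems(2) fS that by (intro linear_frechet_derivative) auto
    have "frechet_derivative g (at (f x)) (frechet_derivative f (at x) v)
       = frechet_derivative g (at (f x)) (\<Sum>b\<in>Basis. (frechet_derivative f (at x) v \<bullet> b) *\<^sub>R b)"
      by (simp add: euclidean_representation)
    also have "\<dots> = (\<Sum>b\<in>Basis. (?Dg b \<circ> f) x * (frechet_derivative f (at x) v \<bullet> b))"
      by (simp add: linear_sum[OF lin] linear_cmul[OF lin] mult.commute)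
    finally show ?thesis using frechet_derivative_eqI[OF D[OF that]] by simp
  qed
  have "higher_differentiable_on S (\<lambda>x. \<Sum>b\<in>Basis. (?Dg b \<circ> f) x * (frechet_derivative f (at x) v \<bullet> b)) k" for v
  proof (intro higher_differentiable_on_sum higher_differentiable_on_mult S)
    fix b :: 'b
    show "higher_differentiable_on S (?Dg b \<circ> f) k"
      using Suc.prems
      by (blast intro: Suc.IH higher_differentiable_on_SucD higher_differentiable_on_Suc_deriv)
    show "higher_differentiable_on S (\<lambda>x. frechet_derivative f (at x) v \<bullet> b) k"
      using Suc.prems by (intro higher_differentiable_on_compose_linear[OF bounded_linear_inner_left S]) simp
  qed
  then have "higher_differentiable_on S (\<lambda>x. frechet_derivative (g \<circ> f) (at x) v) k" for v
    by (rule higher_differentiable_on_cong[OF S, rotated]) (use eq in auto)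
  then show ?case unfolding higher_differentiable_on.simps differentiable_def using D by blast
qed

lemma higher_differentiable_on_1:
  "higher_differentiable_on S f 1 \<longleftrightarrow> (\<forall>x\<in>S. f differentiable (at x)) \<and>
     (\<forall>v. continuous_on S (\<lambda>x. frechet_derivative f (at x) v))"
  by (simp add: One_nat_def del: One_nat_def[symmetric])

text \<open>The class C^1 gives continuity for each fixed direction only; linearity over a finite
  basis upgrades this to a direction that varies with the point.\<close>

lemma continuous_on_frechet_derivative_apply:
  fixes f :: "'a::euclidean_space \<Rightarrow> 'b::real_normed_vector"
  assumes f: "higher_differentiable_on S f 1" and h: "continuous_on T h" "h ` T \<subseteq> S" and w: "continuous_on T w"
  shows "continuous_on T (\<lambda>x. frechet_derivative f (at (h x)) (w x))"
proof -
  have eq: "frechet_derivative f (at (h x)) (w x) = (\<Sum>b\<in>Basis. (w x \<bullet> b) *\<^sub>R frechet_derivative f (at (h x)) b)"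
    if "x \<in> T" for x
  proof -
    have lin: "linear (frechet_derivative f (at (h x)))"
      using f h that by (intro linear_frechet_derivative) (auto simp: higher_differentiable_on_1)
    have "frechet_derivative f (at (h x)) (w x) = frechet_derivative f (at (h x)) (\<Sum>b\<in>Basis. (w x \<bullet> b) *\<^sub>R b)"
      by (simp add: euclidean_representation)
    then show ?thesis by (simp add: linear_sum[OF lin] linear_cmul[OF lin])
  qed
  have "continuous_on T (\<lambda>x. frechet_derivative f (at (h x)) b)" for b
    using f h continuous_on_compose2[of S "\<lambda>x. frechet_derivative f (at x) b" T h]
    by (simp add: higher_differentiable_on_1)
  then show ?thesis
    by (subst continuous_on_cong[OF refl eq]) (auto intro!: continuous_intros w)
qed

lemma C1_on_realI:
  fixes f f' :: "real \<Rightarrow> real"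
  assumes "open S" "\<And>x. x \<in> S \<Longrightarrow> (f has_real_derivative f' x) (at x)" "continuous_on S f'"
  shows "higher_differentiable_on S f 1"
proof -
  have D: "(f has_derivative (\<lambda>v. f' x * v)) (at x)" if "x \<in> S" for x
    using assms(2)[OF that] by (simp add: has_field_derivative_def)
  have "continuous_on S (\<lambda>x. frechet_derivative f (at x) v)" for v
    by (subst continuous_on_cong[OF refl, of _ _ "\<lambda>x. f' x * v"])
      (use frechet_derivative_eqI[OF D] in \<open>auto intro!: continuous_intros assms(3)\<close>)
  then show ?thesis using D by (auto simp: higher_differentiable_on_1 differentiable_def)
qed

lemma higher_differentiable_on_Suc_realI:
  fixes f f' :: "real \<Rightarrow> real"
  assumes "open S" "\<And>x. x \<in> S \<Longrightarrow> (f has_real_derivative f' x) (at x)" "higher_differentiable_on S f' k"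
  shows "higher_differentiable_on S f (Suc k)"
proof -
  have D: "(f has_derivative (\<lambda>v. f' x * v)) (at x)" if "x \<in> S" for x
    using assms(2)[OF that] by (simp add: has_field_derivative_def)
  have "higher_differentiable_on S (\<lambda>x. frechet_derivative f (at x) v) k" for v
    by (rule higher_differentiable_on_cong[OF assms(1), of "\<lambda>x. f' x * v"])
      (use frechet_derivative_eqI[OF D] in \<open>auto intro!: higher_differentiable_on_mult higher_differentiable_on_const assms(1,3)\<close>)
  then show ?thesis using D by (auto simp: differentiable_def)
qed

section \<open>Mollification\<close>

text \<open>The powers of t in the denominator make the family closed under differentiation, up to
  linear combinations, so smoothness of exp(-1/t) follows by one induction over all
  \<open>k\<close>.\<close>

definition flat_exp :: "nat \<Rightarrow> real \<Rightarrow> real" where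
  "flat_exp k t = (if t > 0 then exp (- 1 / t) / t ^ k else 0)"

lemma flat_exp_tendsto_0: "(flat_exp k \<longlongrightarrow> 0) (at 0)"
proof -
  have "((\<lambda>t::real. inverse t ^ k / exp (inverse t)) \<longlongrightarrow> 0) (at_right 0)"
    using filterlim_compose[OF tendsto_power_div_exp_0 filterlim_inverse_at_top_right] by simp
  then have "(flat_exp k \<longlongrightarrow> 0) (at_right 0)"
    by (rule filterlim_cong[THEN iffD1, OF refl refl, rotated])
      (auto simp: eventually_at_filter flat_exp_def exp_minus divide_simps)
  moreover have "(flat_exp k \<longlongrightarrow> 0) (at_left 0)"
    by (rule tendsto_eventually) (auto simp: eventually_at_filter flat_exp_def)
  ultimately show ?thesis by (simp add: filterlim_split_at)
qed

lemma flat_exp_deriv: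
  "(flat_exp k has_real_derivative flat_exp (k + 2) t - real k * flat_exp (Suc k) t) (at t)"
proof -
  consider "t > 0" | "t < 0" | "t = 0" by linarith
  then show ?thesis
  proof cases
    case 1
    have "((\<lambda>t. exp (- 1 / t) / t ^ k) has_real_derivative
        (exp (- 1 / t) * (1 / t\<^sup>2) * t ^ k - exp (- 1 / t) * (real k * t ^ (k - 1))) / (t ^ k * t ^ k)) (at t)"
      using 1 by (auto intro!: derivative_eq_intros simp: power2_eq_square)
    moreover have "(exp (- 1 / t) * (1 / t\<^sup>2) * t ^ k - exp (- 1 / t) * (real k * t ^ (k - 1))) / (t ^ k * t ^ k)
        = exp (- 1 / t) / t ^ (k + 2) - real k * (exp (- 1 / t) / t ^ Suc k)"
      using 1 by (cases k) (simp_all add: field_simps power2_eq_square)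
    ultimately have "((\<lambda>t. exp (- 1 / t) / t ^ k) has_real_derivative flat_exp (k + 2) t - real k * flat_exp (Suc k) t) (at t)"
      using 1 by (simp add: flat_exp_def)
    then show ?thesis
      by (rule has_field_derivative_transform_within_open[of _ _ _ "{0<..}"]) (use 1 in \<open>auto simp: flat_exp_def\<close>)
  next
    case 2
    have "((\<lambda>t. 0) has_real_derivative 0) (at t)" by simp
    then have "(flat_exp k has_real_derivative 0) (at t)"
      by (rule has_field_derivative_transform_within_open[of _ _ _ "{..<0}"]) (use 2 in \<open>auto simp: flat_exp_def\<close>)
    then show ?thesis using 2 by (simp add: flat_exp_def)
  next
    case 3
    \<comment> \<open>At 0 the difference quotient of \<open>flat_exp k\<close> is
      \<open>flat_exp (Suc k)\<close>, which tends to 0.\<close>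
    have "((\<lambda>h. (flat_exp k (0 + h) - flat_exp k 0) / h) \<longlongrightarrow> 0) (at 0)"
      by (rule filterlim_cong[THEN iffD1, OF refl refl _ flat_exp_tendsto_0[of "Suc k"]])
        (auto simp: eventually_at_filter flat_exp_def)
    then show ?thesis using 3 by (simp add: DERIV_def flat_exp_def)
  qed
qed

lemma flat_exp_smooth: "higher_differentiable_on UNIV (flat_exp k) m"
proof (induction m arbitrary: k)
  case 0
  then show ?case
    by (simp add: continuous_at_imp_continuous_on DERIV_isCont[OF flat_exp_deriv])
next
  case (Suc m)
  show ?case
    by (rule higher_differentiable_on_Suc_realI[OF open_UNIV flat_exp_deriv])
      (intro higher_differentiable_on_diff higher_differentiable_on_mult higher_differentiable_on_const Suc open_UNIV)
qed

text \<open>The kernel vanishes already on the sphere of radius \<open>e\<close>, so hypotheses on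
  the averaged function are needed only for \<open>norm y < e\<close>.\<close>

definition mollifier :: "real \<Rightarrow> ('a::euclidean_space \<Rightarrow> real) \<Rightarrow> bool" where
  "mollifier e k \<longleftrightarrow> (\<forall>m. higher_differentiable_on UNIV k m) \<and> (\<forall>x. 0 \<le> k x) \<and>
     (\<forall>x. norm x \<ge> e \<longrightarrow> k x = 0) \<and> (k has_integral 1) UNIV"

abbreviation sym_box :: "real \<Rightarrow> 'a::euclidean_space set" where
  "sym_box e \<equiv> cbox (- (e *\<^sub>R One)) (e *\<^sub>R One)"

lemma not_in_sym_box: "x \<notin> sym_box e \<Longrightarrow> norm x \<ge> e"
  using Basis_le_norm[of _ x] by (fastforce simp: mem_box abs_le_iff)

lemma integral_UNIV_eq_sym_box:
  fixes f :: "'a::euclidean_space \<Rightarrow> real"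
  assumes "\<forall>x. norm x \<ge> e \<longrightarrow> f x = 0"
  shows "integral UNIV f = integral (sym_box e) f"
proof -
  have "f = (\<lambda>x. if x \<in> sym_box e then f x else 0)"
    using assms not_in_sym_box by fastforce
  then show ?thesis by (metis integral_restrict_UNIV)
qed

lemma ex_mollifier:
  assumes "e > 0"
  shows "\<exists>k::'a::euclidean_space \<Rightarrow> real. mollifier e k"
proof -
  define k0 :: "'a \<Rightarrow> real" where "k0 x = flat_exp 0 (e\<^sup>2 - x \<bullet> x)" for x
  have "higher_differentiable_on UNIV (\<lambda>x::'a. e\<^sup>2 - (\<Sum>b\<in>Basis. (x \<bullet> b) * (x \<bullet> b))) m" for m
    by (intro higher_differentiable_on_diff higher_differentiable_on_sum higher_differentiable_on_mult
        higher_differentiable_on_const open_UNIV higher_differentiable_on_linear bounded_linear_inner_left)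
  then have "higher_differentiable_on UNIV (\<lambda>x::'a. e\<^sup>2 - x \<bullet> x) m" for m
    by (simp only: euclidean_inner[symmetric])
  from higher_differentiable_on_compose[OF open_UNIV this flat_exp_smooth]
  have smooth: "higher_differentiable_on UNIV k0 m" for m
    by (simp add: k0_def[abs_def] comp_def)
  have nn: "k0 x \<ge> 0" for x by (simp add: k0_def flat_exp_def)
  have supp: "\<forall>x. norm x \<ge> e \<longrightarrow> k0 x = 0"
    using assms by (auto simp: k0_def flat_exp_def norm_le_square not_less[symmetric])
      (metis less_eq_real_def linorder_not_le norm_lt_square)
  have cont: "continuous_on UNIV k0" using smooth[of 0] by simp
  define I where "I = integral UNIV k0"
  have int: "(k0 has_integral I) (sym_box e)"
    unfolding I_def using integral_UNIV_eq_sym_box[OF supp] cont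
    by (auto intro!: integrable_integral integrable_continuous continuous_on_subset[OF cont])
  have intU: "(k0 has_integral I) UNIV"
    by (rule has_integral_on_superset[OF int]) (use supp not_in_sym_box in auto)
  \<comment> \<open>A continuous nonnegative function with integral 0 over a box vanishes on it, but
    the value at the origin is exp(-1/e^2).\<close>
  have "I \<noteq> 0"
  proof
    assume "I = 0"
    have "0 \<in> sym_box e" using assms by (auto simp: mem_box)
    then have "k0 0 = 0"
      using has_integral_0_cbox_imp_0[OF continuous_on_subset[OF cont subset_UNIV] _ int[unfolded \<open>I = 0\<close>]] nn assms
      by (auto simp: box_ne_empty)
    then show False using assms by (simp add: k0_def flat_exp_def)
  qed
  then have "I > 0" using has_integral_nonneg[OF intU] nn by fastforce
  then have "mollifier e (\<lambda>x. k0 x * (1 / I))"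
    unfolding mollifier_def
    using nn supp has_integral_mult_left[OF intU, of "1 / I"]
    by (intro conjI allI higher_differentiable_on_mult smooth higher_differentiable_on_const) auto
  then show ?thesis by blast
qed

text \<open>The derivatives are repackaged as a map into bounded linear functions; in finite
  dimension its continuity reduces to that in each fixed direction, and the Leibniz rule for
  parametrised integrals applies.\<close>

lemma leibniz_C1:
  fixes F :: "'a::euclidean_space \<Rightarrow> 'b::euclidean_space \<Rightarrow> real"
  assumes D: "\<And>x t. x \<in> U \<Longrightarrow> t \<in> cbox a b \<Longrightarrow> ((\<lambda>x. F x t) has_derivative F' x t) (at x)"
    and cF: "\<And>x. x \<in> U \<Longrightarrow> continuous_on (cbox a b) (F x)"
    and cF': "\<And>v. continuous_on (U \<times> cbox a b) (\<lambda>(x, t). F' x t v)"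
    and U: "open U" "convex U" "x0 \<in> U"
  shows "((\<lambda>x. integral (cbox a b) (F x)) has_derivative (\<lambda>v. integral (cbox a b) (\<lambda>t. F' x0 t v))) (at x0)"
proof -
  define B where "B x t = Blinfun (F' x t)" for x t
  have B: "blinfun_apply (B x t) = F' x t" if "x \<in> U" "t \<in> cbox a b" for x t
    unfolding B_def using D[OF that] by (intro bounded_linear_Blinfun_apply) (rule has_derivative_bounded_linear)
  have cB: "continuous_on (U \<times> cbox a b) (\<lambda>(x, t). B x t)"
  proof (rule continuous_on_blinfun_componentwise)
    fix i :: 'a
    show "continuous_on (U \<times> cbox a b) (\<lambda>p. blinfun_apply (case p of (x, t) \<Rightarrow> B x t) i)"
      by (subst continuous_on_cong[OF refl, of _ _ "\<lambda>(x, t). F' x t i"]) (auto simp: B cF')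
  qed
  have "((\<lambda>x. integral (cbox a b) (F x)) has_derivative blinfun_apply (integral (cbox a b) (B x0))) (at x0 within U)"
    by (rule leibniz_rule[OF _ _ cB U(3,2)])
      (use D B in \<open>auto intro!: integrable_continuous cF intro: has_derivative_at_withinI\<close>)
  moreover have "blinfun_apply (integral (cbox a b) (B x0)) = (\<lambda>v. integral (cbox a b) (\<lambda>t. F' x0 t v))"
  proof (rule ext)
    fix v
    have "continuous_on (cbox a b) (\<lambda>t. (\<lambda>(x, t). B x t) (x0, t))"
      by (rule continuous_on_compose2[OF cB]) (use U in \<open>auto intro!: continuous_on_Pair\<close>)
    then have "B x0 integrable_on cbox a b" by (auto intro: integrable_continuous)
    then have "blinfun_apply (integral (cbox a b) (B x0)) v = integral (cbox a b) (\<lambda>t. B x0 t v)"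
      by (rule blinfun_apply_integral)
    also have "\<dots> = integral (cbox a b) (\<lambda>t. F' x0 t v)"
      by (rule integral_cong) (simp add: B U)
    finally show "blinfun_apply (integral (cbox a b) (B x0)) v = integral (cbox a b) (\<lambda>t. F' x0 t v)" .
  qed
  ultimately show ?thesis by (simp only: at_within_open[OF U(3,1)])
qed

section \<open>Convolution with a compactly supported kernel\<close>

definition convolve :: "('a::euclidean_space \<Rightarrow> real) \<Rightarrow> ('a \<Rightarrow> real) \<Rightarrow> 'a \<Rightarrow> real" where
  "convolve h k x = integral UNIV (\<lambda>y. h (x - y) * k y)"

lemma convolve_eq_sym_box:
  assumes "\<forall>x. norm x \<ge> e \<longrightarrow> k x = 0"
  shows "convolve h k x = integral (sym_box e) (\<lambda>y. h (x - y) * k y)"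
  unfolding convolve_def by (rule integral_UNIV_eq_sym_box) (simp add: assms)

text \<open>Substituting x - y for y moves the translation onto the kernel, where it can be
  differentiated, at the price of a box that must contain the ball about \<open>x\<close>.\<close>

lemma convolve_eq_box:
  fixes h k :: "'a::euclidean_space \<Rightarrow> real"
  assumes k: "\<forall>x. norm x \<ge> e \<longrightarrow> k x = 0" and ch: "continuous_on UNIV h" and ck: "continuous_on UNIV k"
    and box: "cball x e \<subseteq> cbox a b"
  shows "convolve h k x = integral (cbox a b) (\<lambda>y. h y * k (x - y))"
proof -
  let ?f = "\<lambda>y. h y * k (x - y)"
  have out: "?f y = 0" if "y \<notin> cbox a b" for y
    using that box k[rule_format, of "x - y"] by (force simp: dist_norm norm_minus_commute)
  have "continuous_on (cbox a b) ?f"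
    by (intro continuous_intros continuous_on_subset[OF ch] continuous_on_compose2[OF ck]) auto
  then have "(?f has_integral integral (cbox a b) ?f) (cbox a b)"
    by (intro integrable_integral integrable_continuous)
  from has_integral_affinity[OF this, where m="-1" and c=x]
  have "((\<lambda>y. ?f (x - y)) has_integral integral (cbox a b) ?f) ((\<lambda>y. x - y) ` cbox a b)"
    by (simp add: algebra_simps)
  then have "((\<lambda>y. ?f (x - y)) has_integral integral (cbox a b) ?f) UNIV"
  proof (rule has_integral_on_superset)
    fix y assume "y \<notin> (\<lambda>y. x - y) ` cbox a b"
    then have "x - y \<notin> cbox a b" by (metis diff_diff_eq2 add_diff_cancel_left' image_eqI)
    then show "?f (x - y) = 0" using out by blast
  qed simp
  then show ?thesis by (simp add: convolve_def integral_unique)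
qed

text \<open>The derivative falls on the kernel, so \<open>h\<close> may be merely continuous. The
  second claim restores the support condition for the differentiated kernel, which keeps the
  induction for smoothness running.\<close>

lemma convolve_has_derivative_kernel:
  fixes h k :: "'a::euclidean_space \<Rightarrow> real"
  assumes k: "\<forall>x. norm x \<ge> e \<longrightarrow> k x = 0" and ch: "continuous_on UNIV h"
    and C1: "higher_differentiable_on UNIV k 1"
  shows "(convolve h k has_derivative (\<lambda>v. convolve h (\<lambda>x. frechet_derivative k (at x) v) x0)) (at x0)"
    and "\<forall>x. norm x \<ge> 2 * \<bar>e\<bar> + 1 \<longrightarrow> frechet_derivative k (at x) v = 0"
proof -
  have k': "frechet_derivative k (at x) v = 0" if "norm x \<ge> 2 * \<bar>e\<bar> + 1" for x v
  proof -
    have op: "open {x::'a. norm x > e}" by (intro open_Collect_less continuous_intros)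
    have "frechet_derivative k (at x) = frechet_derivative (\<lambda>x. 0) (at x)"
      by (rule frechet_derivative_cong_open[OF op]) (use that k in auto)
    then show ?thesis by simp
  qed
  then show "\<forall>x. norm x \<ge> 2 * \<bar>e\<bar> + 1 \<longrightarrow> frechet_derivative k (at x) v = 0" by blast
  have ck: "continuous_on UNIV k" using C1 higher_differentiable_on_Suc_imp_continuous by blast
  have ck': "continuous_on UNIV (\<lambda>x. frechet_derivative k (at x) v)" for v
    using C1 by (simp add: higher_differentiable_on_1)
  \<comment> \<open>This radius exceeds \<open>e\<close> whatever the sign of \<open>e\<close>, so
    every point of at least this norm has a neighbourhood on which the kernel is 0.\<close>
  define e' where "e' = 2 * \<bar>e\<bar> + 1"
  \<comment> \<open>One box serves all centres in the unit ball about \<open>x0\<close>: the domain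
    of integration must not move with the parameter.\<close>
  obtain a where a: "cball x0 (1 + e') \<subseteq> cbox (- a) (a::'a)"
    using bounded_subset_cbox_symmetric[OF bounded_cball] by blast
  have sub: "cball x e' \<subseteq> cbox (- a) a" if "x \<in> ball x0 1" for x
  proof -
    have "cball x e' \<subseteq> cball x0 (1 + e')"
    proof
      fix y assume "y \<in> cball x e'"
      then show "y \<in> cball x0 (1 + e')" using that dist_triangle[of x0 y x] by auto
    qed
    then show ?thesis using a by blast
  qed
  have "((\<lambda>x. integral (cbox (-a) a) (\<lambda>y. h y * k (x - y))) has_derivative
      (\<lambda>v. integral (cbox (-a) a) (\<lambda>y. h y * frechet_derivative k (at (x0 - y)) v))) (at x0)"
  proof (rule leibniz_C1)
    fix x y :: 'a
    have kd: "(k has_derivative frechet_derivative k (at (x - y))) (at (x - y))"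
      using C1 by (simp add: higher_differentiable_on_1 frechet_derivative_works[symmetric])
    have "((\<lambda>x. k (x - y)) has_derivative frechet_derivative k (at (x - y))) (at x)"
      by (rule has_derivative_compose[where f="\<lambda>x. x - y" and f'="\<lambda>v. v", OF _ kd])
        (auto intro!: derivative_eq_intros)
    then show "((\<lambda>x. h y * k (x - y)) has_derivative (\<lambda>v. h y * frechet_derivative k (at (x - y)) v)) (at x)"
      by (rule has_derivative_mult_right)
  next
    fix x :: 'a
    show "continuous_on (cbox (- a) a) (\<lambda>y. h y * k (x - y))"
      by (intro continuous_intros continuous_on_subset[OF ch] continuous_on_compose2[OF ck]) auto
  next
    fix v :: 'a
    show "continuous_on (ball x0 1 \<times> cbox (- a) a) (\<lambda>(x, y). h y * frechet_derivative k (at (x - y)) v)"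
      unfolding case_prod_beta
      by (intro continuous_intros continuous_on_compose2[OF ch] continuous_on_compose2[OF ck']) auto
  qed auto
  moreover have "convolve h k x = integral (cbox (-a) a) (\<lambda>y. h y * k (x - y))" if "x \<in> ball x0 1" for x
    by (rule convolve_eq_box[OF _ ch ck sub[OF that]]) (use k in \<open>auto simp: e'_def\<close>)
  moreover have "convolve h (\<lambda>x. frechet_derivative k (at x) v) x0 =
      integral (cbox (-a) a) (\<lambda>y. h y * frechet_derivative k (at (x0 - y)) v)" for v
    by (rule convolve_eq_box[OF _ ch ck' sub]) (use k' in \<open>auto simp: e'_def\<close>)
  ultimately show "(convolve h k has_derivative (\<lambda>v. convolve h (\<lambda>x. frechet_derivative k (at x) v) x0)) (at x0)"
    using has_derivative_transform_within_open[of _ _ x0 UNIV "ball x0 1" "convolve h k"] by simp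
qed

lemma convolve_smooth:
  fixes h k :: "'a::euclidean_space \<Rightarrow> real"
  assumes "\<forall>x. norm x \<ge> e \<longrightarrow> k x = 0" and "continuous_on UNIV h"
    and "\<And>m. higher_differentiable_on UNIV k m"
  shows "higher_differentiable_on UNIV (convolve h k) m"
  using assms(1,3)
proof (induction m arbitrary: k e)
  case 0
  have "convolve h k differentiable (at x)" for x
    using convolve_has_derivative_kernel(1)[OF 0(1) assms(2) 0(2)] unfolding differentiable_def by blast
  then show ?case
    by (simp add: continuous_at_imp_continuous_on differentiable_imp_continuous_within)
next
  case (Suc m)
  note D = convolve_has_derivative_kernel[OF Suc.prems(1) assms(2) Suc.prems(2)]
  have "higher_differentiable_on UNIV (convolve h (\<lambda>x. frechet_derivative k (at x) v)) m" for v
    by (rule Suc.IH[OF D(2)]) (use Suc.prems(2) higher_differentiable_on_Suc_deriv in blast)+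
  moreover have "frechet_derivative (convolve h k) (at x) v = convolve h (\<lambda>x. frechet_derivative k (at x) v) x" for x v
    using frechet_derivative_eqI[OF D(1)] by metis
  ultimately show ?case
    unfolding higher_differentiable_on.simps differentiable_def using D(1) by (metis (no_types, lifting) ext)
qed

text \<open>Here the derivative falls on the C^1 function: the differential of a mollification is
  the mollification of the differential. This is what makes gradients of mollified test functions
  converge.\<close>

lemma convolve_has_derivative_function:
  fixes h k :: "'a::euclidean_space \<Rightarrow> real"
  assumes k: "\<forall>x. norm x \<ge> e \<longrightarrow> k x = 0" and ck: "continuous_on UNIV k"
    and C1: "higher_differentiable_on UNIV h 1"
  shows "(convolve h k has_derivative (\<lambda>v. convolve (\<lambda>x. frechet_derivative h (at x) v) k x0)) (at x0)"
proof -
  have ch: "continuous_on UNIV h" using C1 higher_differentiable_on_Suc_imp_continuous by blast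
  have ch': "continuous_on UNIV (\<lambda>x. frechet_derivative h (at x) v)" for v
    using C1 by (simp add: higher_differentiable_on_1)
  have "((\<lambda>x. integral (sym_box e) (\<lambda>y. h (x - y) * k y)) has_derivative
      (\<lambda>v. integral (sym_box e) (\<lambda>y. frechet_derivative h (at (x0 - y)) v * k y))) (at x0)"
  proof (rule leibniz_C1)
    fix x y :: 'a
    have hd: "(h has_derivative frechet_derivative h (at (x - y))) (at (x - y))"
      using C1 by (simp add: higher_differentiable_on_1 frechet_derivative_works[symmetric])
    have "((\<lambda>x. h (x - y)) has_derivative frechet_derivative h (at (x - y))) (at x)"
      by (rule has_derivative_compose[where f="\<lambda>x. x - y" and f'="\<lambda>v. v", OF _ hd])
        (auto intro!: derivative_eq_intros)
    then show "((\<lambda>x. h (x - y) * k y) has_derivative (\<lambda>v. frechet_derivative h (at (x - y)) v * k y)) (at x)"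
      by (rule has_derivative_mult_left)
  next
    fix x :: 'a
    show "continuous_on (sym_box e) (\<lambda>y. h (x - y) * k y)"
      by (intro continuous_intros continuous_on_subset[OF ck] continuous_on_compose2[OF ch]) auto
  next
    fix v :: 'a
    show "continuous_on (UNIV \<times> sym_box e) (\<lambda>(x, y). frechet_derivative h (at (x - y)) v * k y)"
      unfolding case_prod_beta
      by (intro continuous_intros continuous_on_compose2[OF ch'] continuous_on_compose2[OF ck]) auto
  qed auto
  moreover have "convolve f k = (\<lambda>x. integral (sym_box e) (\<lambda>y. f (x - y) * k y))" for f
    by (rule ext) (rule convolve_eq_sym_box[OF k])
  ultimately show ?thesis by simp
qed

lemma mollifier_average_bound:
  fixes g k :: "'a::euclidean_space \<Rightarrow> real"
  assumes k: "mollifier e k" and cg: "continuous_on UNIV g" and b: "\<And>y. norm y < e \<Longrightarrow> \<bar>g y\<bar> \<le> d"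
  shows "\<bar>integral UNIV (\<lambda>y. g y * k y)\<bar> \<le> d"
proof -
  have k0: "\<forall>x. norm x \<ge> e \<longrightarrow> k x = 0" and kn: "\<And>x. k x \<ge> 0" and ck: "continuous_on UNIV k"
    and kI: "(k has_integral 1) UNIV"
    using k[unfolded mollifier_def] higher_differentiable_on_Suc_imp_continuous by blast+
  have "integral (sym_box e) k = 1" using integral_UNIV_eq_sym_box[OF k0] kI by (simp add: integral_unique)
  then have "integral (sym_box e) (\<lambda>y. d * k y) = d" by simp
  moreover have "\<bar>g y * k y\<bar> \<le> d * k y" for y
    using b[of y] k0[rule_format, of y] kn[of y] by (cases "norm y < e") (auto simp: abs_mult intro: mult_right_mono)
  then have "norm (integral (sym_box e) (\<lambda>y. g y * k y)) \<le> integral (sym_box e) (\<lambda>y. d * k y)"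
    by (intro integral_norm_bound_integral integrable_continuous continuous_intros
        continuous_on_subset[OF cg] continuous_on_subset[OF ck]) auto
  ultimately show ?thesis using \<open>integral (sym_box e) k = 1\<close> integral_UNIV_eq_sym_box[where e=e and f="\<lambda>y. g y * k y"] k0 by simp
qed

lemma convolve_near:
  fixes h k :: "'a::euclidean_space \<Rightarrow> real"
  assumes k: "mollifier e k" and ch: "continuous_on UNIV h" and b: "\<And>y. norm y < e \<Longrightarrow> \<bar>h (x - y) - c\<bar> \<le> d"
  shows "\<bar>convolve h k x - c\<bar> \<le> d"
proof -
  have k0: "\<forall>x. norm x \<ge> e \<longrightarrow> k x = 0" and ck: "continuous_on UNIV k" and kI: "(k has_integral 1) UNIV"
    using k[unfolded mollifier_def] higher_differentiable_on_Suc_imp_continuous by blast+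
  have chx: "continuous_on UNIV (\<lambda>y. h (x - y))"
    by (intro continuous_on_compose2[OF ch] continuous_intros) auto
  have "(\<lambda>y. h (x - y) * k y) integrable_on sym_box e"
    by (intro integrable_continuous continuous_intros continuous_on_subset[OF ck] continuous_on_subset[OF chx]) auto
  then have "((\<lambda>y. h (x - y) * k y) has_integral convolve h k x) (sym_box e)"
    using convolve_eq_sym_box[OF k0, of h x] integrable_integral by metis
  then have "((\<lambda>y. h (x - y) * k y) has_integral convolve h k x) UNIV"
    by (rule has_integral_on_superset) (use k0 not_in_sym_box in auto)
  from has_integral_diff[OF this has_integral_mult_right[OF kI, of c]]
  have "integral UNIV (\<lambda>y. (h (x - y) - c) * k y) = convolve h k x - c"
    by (simp add: integral_unique algebra_simps)
  moreover have "\<bar>integral UNIV (\<lambda>y. (h (x - y) - c) * k y)\<bar> \<le> d"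
    by (rule mollifier_average_bound[OF k]) (auto intro!: continuous_intros chx b)
  ultimately show ?thesis by simp
qed

text \<open>Averaging with weights of total mass 1 preserves any bound on differences of translates;
  this carries a Lipschitz bound of the distance over to its mollification.\<close>

lemma convolve_diff_bound:
  fixes h k :: "'a::euclidean_space \<Rightarrow> real"
  assumes k: "mollifier e k" and ch: "continuous_on UNIV h"
    and b: "\<And>y. norm y < e \<Longrightarrow> \<bar>h (x - y) - h (x' - y)\<bar> \<le> d"
  shows "\<bar>convolve h k x - convolve h k x'\<bar> \<le> d"
proof -
  have k0: "\<forall>x. norm x \<ge> e \<longrightarrow> k x = 0" and ck: "continuous_on UNIV k"
    using k[unfolded mollifier_def] higher_differentiable_on_Suc_imp_continuous by blast+
  have chx: "continuous_on UNIV (\<lambda>y. h (x - y))" for x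
    by (intro continuous_on_compose2[OF ch] continuous_intros) auto
  have int: "(\<lambda>y. h (x - y) * k y) integrable_on sym_box e" for x
    by (intro integrable_continuous continuous_intros continuous_on_subset[OF ck] continuous_on_subset[OF chx]) auto
  have "convolve h k x - convolve h k x' = integral (sym_box e) (\<lambda>y. (h (x - y) - h (x' - y)) * k y)"
    using integral_diff[OF int int] by (simp add: convolve_eq_sym_box[OF k0] algebra_simps)
  also have "\<dots> = integral UNIV (\<lambda>y. (h (x - y) - h (x' - y)) * k y)"
    by (rule integral_UNIV_eq_sym_box[symmetric]) (simp add: k0)
  finally show ?thesis using mollifier_average_bound[OF k, of "\<lambda>y. h (x - y) - h (x' - y)" d] b
    by (simp add: continuous_on_diff chx)
qed

lemma convolve_nonneg:
  assumes "mollifier e k" "\<And>x. h x \<ge> 0"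
  shows "convolve h k x \<ge> 0"
  using assms by (cases "(\<lambda>y. h (x - y) * k y) integrable_on UNIV")
    (auto simp: convolve_def mollifier_def not_integrable_integral intro!: integral_nonneg)

section \<open>Change of variables for the Lebesgue measure\<close>

text \<open>
  The library proves the change of variables theorem only for well-ordered index types.
  A copy of the index type carrying an arbitrary well-order removes this restriction.
\<close>

typedef 'n ordered_index = "UNIV :: 'n set" by auto

instance ordered_index :: (finite) finite
proof
  have "UNIV = range (Abs_ordered_index :: 'a \<Rightarrow> _)"
    by (metis Abs_ordered_index_cases UNIV_eq_I rangeI)
  then show "finite (UNIV :: 'a ordered_index set)" by (metis finite_imageI finite)
qed

definition index_rank :: "'n::finite ordered_index \<Rightarrow> nat" where
  "index_rank = (SOME f. inj f)"

lemma inj_index_rank: "inj (index_rank :: 'n::finite ordered_index \<Rightarrow> nat)"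
  unfolding index_rank_def using finite_imp_inj_to_nat_seg[OF finite[of UNIV]] by (metis someI_ex)

instantiation ordered_index :: (finite) wellorder
begin

definition "i \<le> j \<longleftrightarrow> index_rank i \<le> index_rank j"
definition "i < j \<longleftrightarrow> index_rank i < index_rank j"

instance
proof
  fix P :: "'a ordered_index \<Rightarrow> bool" and i
  assume step: "\<And>x. (\<And>y. y < x \<Longrightarrow> P y) \<Longrightarrow> P x"
  show "P i"
    by (induction i rule: measure_induct_rule[of index_rank]) (rule step, simp add: less_ordered_index_def)
qed (use inj_index_rank in \<open>auto simp: less_eq_ordered_index_def less_ordered_index_def inj_def\<close>)

end

definition to_ordered :: "real^'n \<Rightarrow> real^'n::finite ordered_index" where
  "to_ordered v = (\<chi> j. v $ Rep_ordered_index j)"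

definition of_ordered :: "real^'n::finite ordered_index \<Rightarrow> real^'n" where
  "of_ordered w = (\<chi> i. w $ Abs_ordered_index i)"

lemma to_ordered_of_ordered [simp]: "to_ordered (of_ordered w) = w"
  by (simp add: to_ordered_def of_ordered_def vec_eq_iff Rep_ordered_index_inverse)

lemma of_ordered_to_ordered [simp]: "of_ordered (to_ordered v) = v"
  by (simp add: to_ordered_def of_ordered_def vec_eq_iff Abs_ordered_index_inverse)

lemma bij_Abs_ordered_index: "bij Abs_ordered_index"
  by (rule bijI') (auto simp: Abs_ordered_index_inject intro: Abs_ordered_index_cases)

lemma bounded_linear_to_ordered: "bounded_linear (to_ordered :: real^'n::finite \<Rightarrow> _)"
  by (rule linear_conv_bounded_linear[THEN iffD1]) (auto intro!: linearI simp: to_ordered_def vec_eq_iff)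

lemma bounded_linear_of_ordered: "bounded_linear (of_ordered :: _ \<Rightarrow> real^'n::finite)"
  by (rule linear_conv_bounded_linear[THEN iffD1]) (auto intro!: linearI simp: of_ordered_def vec_eq_iff)

lemma prod_Basis_cart: "(\<Prod>b\<in>Basis. f (v \<bullet> b)) = (\<Prod>i\<in>UNIV. f (v $ i))" for v :: "real^'n::finite"
proof -
  have B: "Basis = range (\<lambda>i::'n. axis i (1::real))" by (auto simp: Basis_vec_def)
  have "inj (\<lambda>i::'n. axis i (1::real))" by (auto simp: inj_def axis_eq_axis)
  then show ?thesis unfolding B by (subst prod.reindex) (auto simp: inner_axis)
qed

text \<open>Reindexing coordinates carries boxes to boxes with the same side lengths, and these
  values determine the Lebesgue measure.\<close>

lemma lborel_distr_of_ordered: "(lborel :: (real^'n::finite) measure) = distr lborel borel of_ordered"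
proof (rule lborel_eqI)
  fix l u :: "real^'n" assume le: "\<And>b. b \<in> Basis \<Longrightarrow> l \<bullet> b \<le> u \<bullet> b"
  have meas [measurable]: "of_ordered \<in> borel_measurable (borel :: (real^'n ordered_index) measure)"
    by (intro borel_measurable_continuous_onI linear_continuous_on bounded_linear_of_ordered)
  have lei: "l $ i \<le> u $ i" for i using le[of "axis i 1"] by (simp add: inner_axis axis_in_Basis_iff)
  have mem: "w \<in> of_ordered -` box l u \<longleftrightarrow> w \<in> box (to_ordered l) (to_ordered u)" for w
    unfolding mem_box_cart vimage_eq
    by (auto simp: of_ordered_def to_ordered_def) (metis Abs_ordered_index_inverse Rep_ordered_index_inverse UNIV_I)+
  have "of_ordered -` box l u = box (to_ordered l) (to_ordered u)" using mem by blast
  then have "emeasure (distr lborel borel of_ordered) (box l u) = emeasure lborel (box (to_ordered l) (to_ordered u))"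
    by (subst emeasure_distr) auto
  also have "\<dots> = (\<Prod>b\<in>Basis. (to_ordered u - to_ordered l) \<bullet> b)"
  proof (rule emeasure_lborel_box)
    fix b :: "real^'n ordered_index" assume "b \<in> Basis"
    then show "to_ordered l \<bullet> b \<le> to_ordered u \<bullet> b"
      using lei by (auto simp: Basis_vec_def inner_axis to_ordered_def)
  qed
  also have "(\<Prod>b\<in>Basis. (to_ordered u - to_ordered l) \<bullet> b) = (\<Prod>j\<in>UNIV. (u - l) $ Rep_ordered_index j)"
    using prod_Basis_cart[of "\<lambda>x. x" "to_ordered u - to_ordered l"] by (simp add: to_ordered_def)
  also have "\<dots> = (\<Prod>i\<in>UNIV. (u - l) $ i)"
    by (rule prod.reindex_bij_witness[of _ Abs_ordered_index Rep_ordered_index])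
      (auto simp: Abs_ordered_index_inverse Rep_ordered_index_inverse)
  also have "\<dots> = (\<Prod>b\<in>Basis. (u - l) \<bullet> b)" using prod_Basis_cart[of "\<lambda>x. x" "u - l"] by simp
  finally show "emeasure (distr lborel borel of_ordered) (box l u) = (\<Prod>b\<in>Basis. (u - l) \<bullet> b)" .
qed simp

text \<open>Conjugation by the bijection of the index types matches permutations with permutations
  of the same sign, so the two Leibniz sums agree term by term.\<close>

lemma det_ordered_index:
  fixes M :: "real^'n::finite^'n"
  shows "det (\<chi> i j. M $ Rep_ordered_index i $ Rep_ordered_index j) = det M"
proof -
  let ?A = "Abs_ordered_index :: 'n \<Rightarrow> _" and ?R = "Rep_ordered_index :: _ \<Rightarrow> 'n"
  have inv: "inv ?A = ?R"
    by (metis Abs_ordered_index_inverse UNIV_I bij_Abs_ordered_index bij_inv_eq_iff ext inv_equality Rep_ordered_index_inverse)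
  have map: "map_permutation UNIV ?A p = ?A \<circ> p \<circ> ?R" for p
    by (simp add: map_permutation_def restrict_id_def inv fun_eq_iff bij_is_surj[OF bij_Abs_ordered_index, simplified])
  have sgn: "sign (?A \<circ> p \<circ> ?R) = sign p" and perm: "(?A \<circ> p \<circ> ?R) permutes UNIV" if "p permutes UNIV" for p
  proof -
    show "sign (?A \<circ> p \<circ> ?R) = sign p"
      using sign_map_permutation[OF bij_is_inj[OF bij_Abs_ordered_index] that finite] by (simp add: map)
    have "bij ?R" using bij_Abs_ordered_index inv bij_imp_bij_inv by metis
    then show "(?A \<circ> p \<circ> ?R) permutes UNIV"
      using that bij_Abs_ordered_index by (auto intro!: bij_imp_permutes bij_comp permutes_bij)
  qed
  have "(\<Sum>p | p permutes UNIV. of_int (sign p) * (\<Prod>i\<in>UNIV. M $ i $ p i)) =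
    (\<Sum>q | q permutes UNIV. of_int (sign q) * (\<Prod>i\<in>UNIV. M $ ?R i $ ?R (q i)))"
  proof (rule sum.reindex_bij_witness[of _ "\<lambda>q. ?R \<circ> q \<circ> ?A" "\<lambda>p. ?A \<circ> p \<circ> ?R"])
    fix p :: "'n \<Rightarrow> 'n" assume p: "p \<in> {p. p permutes UNIV}"
    show "?R \<circ> (?A \<circ> p \<circ> ?R) \<circ> ?A = p" by (simp add: fun_eq_iff Abs_ordered_index_inverse)
    show "?A \<circ> p \<circ> ?R \<in> {p. p permutes UNIV}" using perm p by simp
    have "(\<Prod>i\<in>UNIV. M $ ?R i $ ?R ((?A \<circ> p \<circ> ?R) i)) = (\<Prod>i\<in>UNIV. M $ i $ p i)"
      by (rule prod.reindex_bij_witness[of _ ?A ?R]) (auto simp: Abs_ordered_index_inverse Rep_ordered_index_inverse)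
    then show "of_int (sign (?A \<circ> p \<circ> ?R)) * (\<Prod>i\<in>UNIV. M $ ?R i $ ?R ((?A \<circ> p \<circ> ?R) i)) =
        of_int (sign p) * (\<Prod>i\<in>UNIV. M $ i $ p i)" using sgn p by simp
  next
    fix q :: "'n ordered_index \<Rightarrow> 'n ordered_index" assume q: "q \<in> {q. q permutes UNIV}"
    show "?A \<circ> (?R \<circ> q \<circ> ?A) \<circ> ?R = q" by (simp add: fun_eq_iff Rep_ordered_index_inverse)
    have "bij ?R" using bij_Abs_ordered_index inv bij_imp_bij_inv by metis
    then show "?R \<circ> q \<circ> ?A \<in> {p. p permutes UNIV}"
      using q bij_Abs_ordered_index by (auto intro!: bij_imp_permutes bij_comp permutes_bij)
  qed
  then show ?thesis by (simp add: det_def)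
qed

text \<open>Dictionary between the gauge-integral form of the change of variables theorem and the
  nonnegative integral that defines the volume; it speaks of finite values only.\<close>

lemma absolutely_integrable_iff_nn_integral:
  fixes f :: "'a::euclidean_space \<Rightarrow> real"
  assumes S: "\<And>x. x \<in> S \<Longrightarrow> f x \<ge> 0" and meas: "(\<lambda>x. indicator S x * f x) \<in> borel_measurable borel"
  shows "f absolutely_integrable_on S \<and> integral S f = b \<longleftrightarrow>
    0 \<le> b \<and> (\<integral>\<^sup>+x\<in>S. ennreal (f x) \<partial>lborel) = ennreal b"
proof -
  let ?g = "\<lambda>x. indicator S x * f x"
  have g0: "?g x \<ge> 0" for x using S by (simp add: indicator_def)
  have nn: "(\<integral>\<^sup>+x\<in>S. ennreal (f x) \<partial>lborel) = (\<integral>\<^sup>+x. ennreal (?g x) \<partial>lborel)"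
    by (rule nn_integral_cong) (simp add: indicator_def)
  have ai: "f absolutely_integrable_on S \<longleftrightarrow> integrable lborel ?g"
    using integrable_completion[of ?g lborel] meas by (simp add: set_integrable_def)
  have int: "integral S f = integral\<^sup>L lborel ?g" if "integrable lborel ?g"
  proof -
    have "integral S f = (LINT x:S|lebesgue. f x)"
      using set_lebesgue_integral_eq_integral(2)[of S f] ai that by simp
    then show ?thesis using integral_completion[of ?g lborel] meas by (simp add: set_lebesgue_integral_def)
  qed
  show ?thesis
  proof
    assume "f absolutely_integrable_on S \<and> integral S f = b"
    then have "integrable lborel ?g" "integral\<^sup>L lborel ?g = b" using ai int by auto
    then show "0 \<le> b \<and> (\<integral>\<^sup>+x\<in>S. ennreal (f x) \<partial>lborel) = ennreal b"
      unfolding nn using nn_integral_eq_integral[of lborel ?g] g0 Bochner_Integration.integral_nonneg[of lborel ?g] by auto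
  next
    assume b: "0 \<le> b \<and> (\<integral>\<^sup>+x\<in>S. ennreal (f x) \<partial>lborel) = ennreal b"
    then have "integrable lborel ?g"
      unfolding nn integrable_iff_bounded using g0 meas by auto
    moreover from this have "ennreal (integral\<^sup>L lborel ?g) = ennreal b"
      using b nn_integral_eq_integral[of lborel ?g] g0 unfolding nn by auto
    then have "integral\<^sup>L lborel ?g = b" using b g0 by (simp add: Bochner_Integration.integral_nonneg)
    ultimately show "f absolutely_integrable_on S \<and> integral S f = b" using ai int by auto
  qed
qed

text \<open>The change of variables theorem concerns vector-valued integrands, so real ones enter as
  vectors of length 1.\<close>

lemma vec1_absolutely_integrable_iff:
  fixes f :: "'a::euclidean_space \<Rightarrow> real"
  shows "(\<lambda>x. vec (f x) :: real^1) absolutely_integrable_on S \<and> integral S (\<lambda>x. vec (f x) :: real^1) = vec b \<longleftrightarrow>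
     f absolutely_integrable_on S \<and> integral S f = b"
proof -
  have bl1: "bounded_linear (\<lambda>x::real. vec x :: real^1)"
    by (rule linear_conv_bounded_linear[THEN iffD1]) (auto intro!: linearI simp: vec_eq_iff)
  have bl2: "bounded_linear (\<lambda>x::real^1. x $ 1)" by (rule bounded_linear_vec_nth)
  have iff: "(\<lambda>x. vec (f x) :: real^1) absolutely_integrable_on S \<longleftrightarrow> f absolutely_integrable_on S"
    using absolutely_integrable_linear[OF _ bl1, where f=f and s=S]
      absolutely_integrable_linear[OF _ bl2, where f="\<lambda>x. vec (f x)" and s=S] by (auto simp: comp_def)
  moreover have "integral S (\<lambda>x. vec (f x) :: real^1) = vec (integral S f)" if "f absolutely_integrable_on S"
    using integral_linear[OF set_lebesgue_integral_eq_integral(1)[OF that] bl1] by (simp add: comp_def)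
  ultimately show ?thesis by (auto simp: vec_eq_iff)
qed

lemma nn_integral_change_of_variables_wellorder:
  fixes T :: "real^'n::{finite,wellorder} \<Rightarrow> real^'n::_" and d :: "real^'n::_ \<Rightarrow> real"
  assumes E: "E \<in> sets borel" and D: "\<And>x. x \<in> E \<Longrightarrow> (T has_derivative T' x) (at x within E)"
    and inj: "inj_on T E" and d0: "\<And>y. y \<in> T ` E \<Longrightarrow> 0 \<le> d y"
    and m1: "(\<lambda>y. indicator (T ` E) y * d y) \<in> borel_measurable borel"
    and m2: "(\<lambda>x. indicator E x * (\<bar>det (matrix (T' x))\<bar> * d (T x))) \<in> borel_measurable borel"
  shows "(\<integral>\<^sup>+y\<in>T ` E. ennreal (d y) \<partial>lborel) = (\<integral>\<^sup>+x\<in>E. ennreal (\<bar>det (matrix (T' x))\<bar> * d (T x)) \<partial>lborel)"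
    (is "?L = ?R")
proof -
  \<comment> \<open>The theorem yields that one side has the finite value b exactly if the other
    has. An infinite value on one side then forces one on the other.\<close>
  have iff: "?R = ennreal b \<longleftrightarrow> ?L = ennreal b" if "b \<ge> 0" for b
  proof -
    have "?R = ennreal b \<longleftrightarrow> (\<lambda>x. \<bar>det (matrix (T' x))\<bar> * d (T x)) absolutely_integrable_on E \<and>
        integral E (\<lambda>x. \<bar>det (matrix (T' x))\<bar> * d (T x)) = b"
      using absolutely_integrable_iff_nn_integral[OF _ m2, of b] d0 that by auto
    also have "\<dots> \<longleftrightarrow> (\<lambda>x. vec (\<bar>det (matrix (T' x))\<bar> * d (T x)) :: real^1) absolutely_integrable_on E \<and>
        integral E (\<lambda>x. vec (\<bar>det (matrix (T' x))\<bar> * d (T x)) :: real^1) = vec b"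
      by (rule vec1_absolutely_integrable_iff[symmetric])
    also have "(\<lambda>x. vec (\<bar>det (matrix (T' x))\<bar> * d (T x)) :: real^1) = (\<lambda>x. \<bar>det (matrix (T' x))\<bar> *\<^sub>R vec (d (T x)))"
      by (simp add: fun_eq_iff vec_eq_iff)
    also have "(\<lambda>x. \<bar>det (matrix (T' x))\<bar> *\<^sub>R vec (d (T x)) :: real^1) absolutely_integrable_on E \<and>
        integral E (\<lambda>x. \<bar>det (matrix (T' x))\<bar> *\<^sub>R vec (d (T x)) :: real^1) = vec b \<longleftrightarrow>
        (\<lambda>y. vec (d y) :: real^1) absolutely_integrable_on (T ` E) \<and> integral (T ` E) (\<lambda>y. vec (d y) :: real^1) = vec b"
      by (rule has_absolute_integral_change_of_variables[OF _ D inj]) (use E in auto)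
    also have "\<dots> \<longleftrightarrow> d absolutely_integrable_on (T ` E) \<and> integral (T ` E) d = b"
      by (rule vec1_absolutely_integrable_iff)
    also have "\<dots> \<longleftrightarrow> ?L = ennreal b"
      using absolutely_integrable_iff_nn_integral[OF d0 m1, of b] that by auto
    finally show ?thesis .
  qed
  show ?thesis
  proof (cases "?L")
    case (real b)
    then show ?thesis using iff[of b] by metis
  next
    case top
    then show ?thesis using iff by (cases "?R") auto
  qed
qed

text \<open>Conjugating \<open>T\<close> with the reindexing isometry changes neither the integrals
  nor the Jacobian determinant, so the well-ordered case applies.\<close>

theorem nn_integral_change_of_variables:
  fixes T :: "real^'n::finite \<Rightarrow> real^'n" and d :: "real^'n \<Rightarrow> real"
  assumes E: "E \<in> sets borel" and D: "\<And>x. x \<in> E \<Longrightarrow> (T has_derivative T' x) (at x within E)"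
    and inj: "inj_on T E" and d0: "\<And>y. y \<in> T ` E \<Longrightarrow> 0 \<le> d y"
    and m1: "(\<lambda>y. indicator (T ` E) y * d y) \<in> borel_measurable borel"
    and m2: "(\<lambda>x. indicator E x * (\<bar>det (matrix (T' x))\<bar> * d (T x))) \<in> borel_measurable borel"
  shows "(\<integral>\<^sup>+y\<in>T ` E. ennreal (d y) \<partial>lborel) = (\<integral>\<^sup>+x\<in>E. ennreal (\<bar>det (matrix (T' x))\<bar> * d (T x)) \<partial>lborel)"
proof -
  have mo [measurable]: "of_ordered \<in> borel_measurable (borel :: (real^'n ordered_index) measure)"
    by (intro borel_measurable_continuous_onI linear_continuous_on bounded_linear_of_ordered)
  define E2 where "E2 = to_ordered ` E"
  define T2 where "T2 = to_ordered \<circ> T \<circ> of_ordered"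
  define T2' where "T2' w = (\<lambda>v. to_ordered (T' (of_ordered w) (of_ordered v)))" for w
  have ofE: "of_ordered ` E2 = E" unfolding E2_def by (simp add: image_image)
  have memE: "w \<in> E2 \<longleftrightarrow> of_ordered w \<in> E" for w
    unfolding E2_def by (metis image_iff of_ordered_to_ordered to_ordered_of_ordered)
  have memTE: "w \<in> T2 ` E2 \<longleftrightarrow> of_ordered w \<in> T ` E" for w
    unfolding T2_def E2_def image_comp comp_def
    by (auto simp: image_iff) (metis to_ordered_of_ordered)+
  have det: "det (matrix (T2' w)) = det (matrix (T' (of_ordered w)))" if "w \<in> E2" for w
  proof -
    have axis: "of_ordered (axis j 1) = axis (Rep_ordered_index j) 1" for j :: "'n ordered_index"
      by (auto simp: of_ordered_def axis_def vec_eq_iff Abs_ordered_index_inverse Rep_ordered_index_inverse)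
    have "matrix (T2' w) = (\<chi> i j. matrix (T' (of_ordered w)) $ Rep_ordered_index i $ Rep_ordered_index j)"
      by (simp add: T2'_def matrix_def vec_eq_iff to_ordered_def axis)
    then show ?thesis by (simp add: det_ordered_index)
  qed
  have "(\<integral>\<^sup>+y\<in>T2 ` E2. ennreal (d (of_ordered y)) \<partial>lborel) =
      (\<integral>\<^sup>+x\<in>E2. ennreal (\<bar>det (matrix (T2' x))\<bar> * d (of_ordered (T2 x))) \<partial>lborel)"
  proof (rule nn_integral_change_of_variables_wellorder[where d="\<lambda>y. d (of_ordered y)"])
    have "E2 = of_ordered -` E \<inter> space borel" using memE by auto
    then show "E2 \<in> sets borel" using E mo by (metis measurable_sets)
    show "(T2 has_derivative T2' w) (at w within E2)" if "w \<in> E2" for w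
    proof -
      have "(T has_derivative T' (of_ordered w)) (at (of_ordered w) within of_ordered ` E2)"
        unfolding ofE using D memE that by blast
      from diff_chain_within[OF bounded_linear_imp_has_derivative[OF bounded_linear_of_ordered] this]
      have "(T \<circ> of_ordered has_derivative (\<lambda>v. T' (of_ordered w) (of_ordered v))) (at w within E2)"
        by (simp add: comp_def)
      from bounded_linear.has_derivative[OF bounded_linear_to_ordered this] show ?thesis
        by (simp add: T2_def T2'_def comp_def)
    qed
    have "inj_on of_ordered E2" "inj to_ordered"
      by (metis inj_on_inverseI to_ordered_of_ordered, metis inj_on_inverseI of_ordered_to_ordered)
    then show "inj_on T2 E2"
      unfolding T2_def using inj ofE by (metis comp_inj_on inj_on_subset subset_UNIV)
    show "0 \<le> d (of_ordered y)" if "y \<in> T2 ` E2" for y using memTE that d0 by blast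
    have "(\<lambda>y. indicator (T2 ` E2) y * d (of_ordered y)) = (\<lambda>y. (\<lambda>y. indicator (T ` E) y * d y) (of_ordered y))"
      using memTE by (auto simp: indicator_def fun_eq_iff)
    then show "(\<lambda>y. indicator (T2 ` E2) y * d (of_ordered y)) \<in> borel_measurable borel"
      using measurable_compose[OF mo m1] by simp
    have "(\<lambda>x. indicator E2 x * (\<bar>det (matrix (T2' x))\<bar> * d (of_ordered (T2 x)))) =
        (\<lambda>x. (\<lambda>x. indicator E x * (\<bar>det (matrix (T' x))\<bar> * d (T x))) (of_ordered x))"
      using memE det by (auto simp: indicator_def fun_eq_iff T2_def)
    then show "(\<lambda>x. indicator E2 x * (\<bar>det (matrix (T2' x))\<bar> * d (of_ordered (T2 x)))) \<in> borel_measurable borel"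
      using measurable_compose[OF mo m2] by simp
  qed
  moreover have "(\<integral>\<^sup>+y\<in>T ` E. ennreal (d y) \<partial>lborel) = (\<integral>\<^sup>+y\<in>T2 ` E2. ennreal (d (of_ordered y)) \<partial>lborel)"
  proof -
    have "(\<integral>\<^sup>+y\<in>T ` E. ennreal (d y) \<partial>lborel) = (\<integral>\<^sup>+y. ennreal (indicator (T ` E) y * d y) \<partial>lborel)"
      by (rule nn_integral_cong) (simp add: indicator_def)
    also have "\<dots> = (\<integral>\<^sup>+w. ennreal (indicator (T ` E) (of_ordered w) * d (of_ordered w)) \<partial>lborel)"
      by (subst lborel_distr_of_ordered, subst nn_integral_distr) (use m1 in auto)
    also have "\<dots> = (\<integral>\<^sup>+y\<in>T2 ` E2. ennreal (d (of_ordered y)) \<partial>lborel)"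
      by (rule nn_integral_cong) (use memTE in \<open>simp add: indicator_def\<close>)
    finally show ?thesis .
  qed
  moreover have "(\<integral>\<^sup>+x\<in>E. ennreal (\<bar>det (matrix (T' x))\<bar> * d (T x)) \<partial>lborel) =
      (\<integral>\<^sup>+x\<in>E2. ennreal (\<bar>det (matrix (T2' x))\<bar> * d (of_ordered (T2 x))) \<partial>lborel)"
  proof -
    have "(\<integral>\<^sup>+x\<in>E. ennreal (\<bar>det (matrix (T' x))\<bar> * d (T x)) \<partial>lborel)
        = (\<integral>\<^sup>+x. ennreal (indicator E x * (\<bar>det (matrix (T' x))\<bar> * d (T x))) \<partial>lborel)"
      by (rule nn_integral_cong) (simp add: indicator_def)
    also have "\<dots> = (\<integral>\<^sup>+w. ennreal (indicator E (of_ordered w) * (\<bar>det (matrix (T' (of_ordered w)))\<bar> * d (T (of_ordered w)))) \<partial>lborel)"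
      by (subst lborel_distr_of_ordered, subst nn_integral_distr) (use m2 in auto)
    also have "\<dots> = (\<integral>\<^sup>+x\<in>E2. ennreal (\<bar>det (matrix (T2' x))\<bar> * d (of_ordered (T2 x))) \<partial>lborel)"
      by (rule nn_integral_cong) (use memE det in \<open>auto simp: indicator_def T2_def\<close>)
    finally show ?thesis .
  qed
  ultimately show ?thesis by simp
qed

section \<open>Positive definite matrices\<close>

lemma positive_definite_invertible:
  fixes M :: "real^'n^'n"
  assumes "\<And>v. v \<noteq> 0 \<Longrightarrow> v \<bullet> (M *v v) > 0"
  shows "invertible M"
proof -
  have "inj ((*v) M)"
  proof (rule injI, rule ccontr)
    fix v w assume "M *v v = M *v w" "v \<noteq> w"
    then have "M *v (v - w) = 0" by (simp add: matrix_vector_mult_diff_distrib)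
    with assms[of "v - w"] \<open>v \<noteq> w\<close> show False by simp
  qed
  then show ?thesis using matrix_left_invertible_injective invertible_left_inverse by blast
qed

text \<open>The segment from the identity to the matrix stays in the invertible matrices.\<close>

lemma positive_definite_det_pos:
  fixes M :: "real^'n^'n"
  assumes pos: "\<And>v. v \<noteq> 0 \<Longrightarrow> v \<bullet> (M *v v) > 0"
  shows "det M > 0"
proof (rule ccontr)
  assume "\<not> det M > 0"
  define F where "F t = (\<chi> i j. (1 - t) * (mat 1 :: real^'n^'n) $ i $ j + t * M $ i $ j)" for t :: real
  have F: "F t = (1 - t) *\<^sub>R mat 1 + t *\<^sub>R M" for t by (simp add: F_def vec_eq_iff)
  have cont: "continuous_on {0..1} (\<lambda>t. det (F t))"
    unfolding det_def F_def by (auto intro!: continuous_intros)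
  have F0: "det (F 0) = 1" and F1: "det (F 1) = det M" by (simp_all add: F)
  obtain t where t: "0 \<le> t" "t \<le> 1" "det (F t) = 0"
    using IVT2'[of "\<lambda>t. det (F t)" 1 0 0] cont F0 F1 \<open>\<not> det M > 0\<close> by auto
  have "v \<bullet> (F t *v v) > 0" if "v \<noteq> 0" for v
  proof -
    have "v \<bullet> (F t *v v) = (1 - t) * (v \<bullet> v) + t * (v \<bullet> (M *v v))"
      by (simp add: F matrix_vector_mult_add_rdistrib scaleR_matrix_vector_assoc[symmetric] inner_add_right)
    moreover have "(1 - t) * (v \<bullet> v) \<ge> 0" "t * (v \<bullet> (M *v v)) \<ge> 0" "t = 0 \<or> t * (v \<bullet> (M *v v)) > 0"
      using t pos[OF that] by (auto simp: zero_less_mult_iff)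
    ultimately show ?thesis using that by (cases "t = 0") auto
  qed
  then show False using positive_definite_invertible invertible_det_nz t by blast
qed

section \<open>Charts\<close>

context riemannian_manifold
begin

lemma chart_inv_snd: "c \<in> A \<Longrightarrow> p \<in> fst c \<Longrightarrow> chart_inv c (snd c p) = p"
  using chart_homeo homeomorphism_apply1 by metis

lemma snd_chart_inv: "c \<in> A \<Longrightarrow> x \<in> chart_image c \<Longrightarrow> snd c (chart_inv c x) = x"
  using chart_homeo homeomorphism_apply2 by metis

lemma chart_inv_in: "c \<in> A \<Longrightarrow> x \<in> chart_image c \<Longrightarrow> chart_inv c x \<in> fst c"
  using chart_homeo[of c] by (auto simp: homeomorphism_def)

lemma snd_in: "p \<in> fst c \<Longrightarrow> snd c p \<in> chart_image c"
  by (simp add: chart_image_def)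

lemma continuous_on_chart: "c \<in> A \<Longrightarrow> continuous_on (fst c) (snd c)"
  and continuous_on_chart_inv: "c \<in> A \<Longrightarrow> continuous_on (chart_image c) (chart_inv c)"
  using chart_homeo by (auto simp: homeomorphism_def)

lemma chart_image_Int:
  assumes "c \<in> A" shows "snd c ` (fst c \<inter> W) = {x \<in> chart_image c. chart_inv c x \<in> W}"
proof (intro set_eqI iffI)
  fix x assume "x \<in> {x \<in> chart_image c. chart_inv c x \<in> W}"
  then have "x = snd c (chart_inv c x)" "chart_inv c x \<in> fst c \<inter> W"
    using snd_chart_inv chart_inv_in assms by auto
  then show "x \<in> snd c ` (fst c \<inter> W)" by (rule image_eqI)
qed (use chart_inv_snd[OF assms] snd_in[of _ c] in auto)

lemma open_chart_image_Int:
  assumes "c \<in> A" "open W" shows "open (snd c ` (fst c \<inter> W))"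
proof -
  have "{x \<in> chart_image c. chart_inv c x \<in> W} = chart_image c \<inter> chart_inv c -` W" by auto
  then show ?thesis unfolding chart_image_Int[OF assms(1)]
    using continuous_open_preimage[OF continuous_on_chart_inv chart_open(2)] assms by metis
qed

lemma ex_chart: "\<exists>c\<in>A. p \<in> fst c"
  using atlas_cover by blast

lemma chart_at: "chart_at A p \<in> A" "p \<in> fst (chart_at A p)"
  using someI_ex[of "\<lambda>c. c \<in> A \<and> p \<in> fst c"] ex_chart unfolding chart_at_def by blast+

section \<open>Functions of class C^k on the manifold\<close>

definition Ck_on :: "nat \<Rightarrow> 'a set \<Rightarrow> ('a \<Rightarrow> real) \<Rightarrow> bool" where
  "Ck_on k W f \<longleftrightarrow> (\<forall>c\<in>A. higher_differentiable_on (snd c ` (fst c \<inter> W)) (f \<circ> chart_inv c) k)"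

lemma C1_function_iff: "C1_function A f \<longleftrightarrow> Ck_on 1 UNIV f"
  by (simp add: Ck_on_def C1_function_def chart_image_def)

lemma smooth_function_iff: "smooth_function A f \<longleftrightarrow> (\<forall>k. Ck_on k UNIV f)"
  by (auto simp: Ck_on_def smooth_function_def smooth_on_def chart_image_def)

lemma Ck_on_subset: "Ck_on k W f \<Longrightarrow> V \<subseteq> W \<Longrightarrow> Ck_on k V f"
  unfolding Ck_on_def by (meson Int_mono higher_differentiable_on_subset image_mono order_refl)

lemma Ck_on_local:
  assumes "\<And>p. p \<in> W \<Longrightarrow> \<exists>V. open V \<and> p \<in> V \<and> Ck_on k V f"
  shows "Ck_on k W f"
  unfolding Ck_on_def
proof
  fix c assume c: "c \<in> A"
  show "higher_differentiable_on (snd c ` (fst c \<inter> W)) (f \<circ> chart_inv c) k"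
  proof (rule higher_differentiable_on_local)
    fix x assume "x \<in> snd c ` (fst c \<inter> W)"
    then obtain p where p: "p \<in> fst c" "p \<in> W" "x = snd c p" by blast
    then obtain V where V: "open V" "p \<in> V" "Ck_on k V f" using assms by blast
    then show "\<exists>T. open T \<and> x \<in> T \<and> higher_differentiable_on T (f \<circ> chart_inv c) k"
      using p c open_chart_image_Int[OF c V(1)] unfolding Ck_on_def by (intro exI[of _ "snd c ` (fst c \<inter> V)"]) blast
  qed
qed

lemma Ck_on_cong:
  assumes "open W" "\<And>p. p \<in> W \<Longrightarrow> f p = g p" "Ck_on k W f"
  shows "Ck_on k W g"
  unfolding Ck_on_def
proof
  fix c assume c: "c \<in> A"
  show "higher_differentiable_on (snd c ` (fst c \<inter> W)) (g \<circ> chart_inv c) k"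
    by (rule higher_differentiable_on_cong[OF open_chart_image_Int[OF c assms(1)], of "f \<circ> chart_inv c"])
      (use assms c in \<open>auto simp: Ck_on_def chart_image_Int\<close>)
qed

text \<open>Transition maps are smooth, so regularity in one chart containing \<open>W\<close>
  passes to the representatives in all others.\<close>

lemma Ck_on_chartI:
  assumes c: "c \<in> A" and W: "open W" "W \<subseteq> fst c" and f: "higher_differentiable_on (snd c ` W) (f \<circ> chart_inv c) k"
  shows "Ck_on k W f"
  unfolding Ck_on_def
proof
  fix c' assume c': "c' \<in> A"
  let ?S = "snd c' ` (fst c' \<inter> W)"
  have op: "open ?S" using open_chart_image_Int c' W by blast
  have "?S \<subseteq> snd c' ` (fst c' \<inter> fst c)" using W by auto
  then have T: "higher_differentiable_on ?S (snd c \<circ> chart_inv c') k"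
    using chart_compat[OF c' c] higher_differentiable_on_subset unfolding smooth_on_def by blast
  have "(snd c \<circ> chart_inv c') ` ?S \<subseteq> snd c ` W"
    using chart_inv_snd[OF c'] by auto
  from higher_differentiable_on_compose[OF op T f this]
  show "higher_differentiable_on ?S (f \<circ> chart_inv c') k"
  proof (rule higher_differentiable_on_cong[OF op, rotated])
    fix x assume "x \<in> ?S"
    then show "(f \<circ> chart_inv c \<circ> (snd c \<circ> chart_inv c')) x = (f \<circ> chart_inv c') x"
      using chart_inv_snd[OF c'] chart_inv_snd[OF c] W by auto
  qed
qed

lemma Ck_on_const: "Ck_on k W (\<lambda>_. a)"
  by (simp add: Ck_on_def comp_def higher_differentiable_on_const)

lemma Ck_on_add: "open W \<Longrightarrow> Ck_on k W f \<Longrightarrow> Ck_on k W g \<Longrightarrow> Ck_on k W (\<lambda>p. f p + g p)"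
  unfolding Ck_on_def comp_def
  by (intro ballI higher_differentiable_on_add open_chart_image_Int) blast+

lemma Ck_on_diff: "open W \<Longrightarrow> Ck_on k W f \<Longrightarrow> Ck_on k W g \<Longrightarrow> Ck_on k W (\<lambda>p. f p - g p)"
  unfolding Ck_on_def comp_def
  by (intro ballI higher_differentiable_on_diff open_chart_image_Int) blast+

lemma Ck_on_mult: "open W \<Longrightarrow> Ck_on k W f \<Longrightarrow> Ck_on k W g \<Longrightarrow> Ck_on k W (\<lambda>p. f p * g p)"
  unfolding Ck_on_def comp_def
  by (intro ballI higher_differentiable_on_mult open_chart_image_Int) blast+

lemma Ck_on_sum: "open W \<Longrightarrow> (\<And>i. i \<in> I \<Longrightarrow> Ck_on k W (f i)) \<Longrightarrow> Ck_on k W (\<lambda>p. \<Sum>i\<in>I. f i p)"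
  unfolding Ck_on_def comp_def
  by (intro ballI higher_differentiable_on_sum open_chart_image_Int) blast+

lemma Ck_on_compose:
  fixes g :: "real \<Rightarrow> real"
  assumes "open W" "Ck_on k W f" "higher_differentiable_on T g k" "f ` W \<subseteq> T"
  shows "Ck_on k W (\<lambda>p. g (f p))"
  unfolding Ck_on_def
proof
  fix c assume c: "c \<in> A"
  have "higher_differentiable_on (snd c ` (fst c \<inter> W)) (g \<circ> (f \<circ> chart_inv c)) k"
    by (rule higher_differentiable_on_compose[OF open_chart_image_Int[OF c assms(1)] _ assms(3)])
      (use assms c in \<open>auto simp: Ck_on_def chart_image_Int\<close>)
  then show "higher_differentiable_on (snd c ` (fst c \<inter> W)) ((\<lambda>p. g (f p)) \<circ> chart_inv c) k"
    by (simp add: comp_def)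
qed

text \<open>The chart domain and the complement of \<open>S\<close> are open and cover the manifold;
  the function is regular on the first and 0 on the second.\<close>

lemma Ck_on_extend_zero:
  assumes c: "c \<in> A" and S: "closed S" "S \<subseteq> fst c" and f0: "\<And>p. p \<notin> S \<Longrightarrow> f p = 0"
    and f: "higher_differentiable_on (chart_image c) (f \<circ> chart_inv c) k"
  shows "Ck_on k UNIV f"
proof (rule Ck_on_local)
  fix p
  show "\<exists>V. open V \<and> p \<in> V \<and> Ck_on k V f"
  proof (cases "p \<in> S")
    case True
    then show ?thesis using Ck_on_chartI[OF c chart_open(1)[OF c] subset_refl] f S c chart_open
      unfolding chart_image_def by blast
  next
    case False
    moreover have "Ck_on k (- S) f"
      by (rule Ck_on_cong[OF _ _ Ck_on_const[of _ _ 0]]) (use S f0 in auto)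
    ultimately show ?thesis using S by (intro exI[of _ "- S"]) auto
  qed
qed

lemma Ck_on_continuous:
  assumes "Ck_on k W f" "open W" shows "continuous_on W f"
proof (rule continuous_at_imp_continuous_on, rule ballI)
  fix p assume p: "p \<in> W"
  obtain c where c: "c \<in> A" "p \<in> fst c" using ex_chart by blast
  have "continuous_on (snd c ` (fst c \<inter> W)) (f \<circ> chart_inv c)"
    using assms(1) c higher_differentiable_on_le[of _ _ k 0] by (fastforce simp: Ck_on_def)
  then have "continuous_on (fst c \<inter> W) (\<lambda>q. (f \<circ> chart_inv c) (snd c q))"
    by (rule continuous_on_compose2) (auto intro: continuous_on_subset continuous_on_chart c)
  then have "continuous_on (fst c \<inter> W) f"
    by (rule continuous_on_eq) (simp add: chart_inv_snd c)
  then show "isCont f p" using p c chart_open(1)[OF c(1)] assms(2)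
    by (metis IntI continuous_on_eq_continuous_at open_Int)
qed

lemma Ck_on_differentiable:
  assumes "Ck_on 1 W f" "p \<in> W" "c \<in> A" "p \<in> fst c"
  shows "(f \<circ> chart_inv c) differentiable (at (snd c p))"
  using assms unfolding Ck_on_def higher_differentiable_on_1 by blast

section \<open>Differentials, gradients and the metric\<close>

definition dform :: "('a \<Rightarrow> real) \<Rightarrow> ('a, 'n) chart \<Rightarrow> 'a \<Rightarrow> real^'n \<Rightarrow> real" where
  "dform f c p = frechet_derivative (f \<circ> chart_inv c) (at (snd c p))"

text \<open>The differential of the transition map at \<open>p\<close>: it turns the components of a
  tangent vector in \<open>c\<close> into its components in \<open>c'\<close>.\<close>

definition chart_diff :: "('a, 'n) chart \<Rightarrow> ('a, 'n) chart \<Rightarrow> 'a \<Rightarrow> real^'n \<Rightarrow> real^'n" where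
  "chart_diff c c' p = frechet_derivative (snd c' \<circ> chart_inv c) (at (snd c p))"

lemma chart_trans_has_derivative:
  assumes "c \<in> A" "c' \<in> A" "p \<in> fst c" "p \<in> fst c'"
  shows "(snd c' \<circ> chart_inv c has_derivative chart_diff c c' p) (at (snd c p))"
proof -
  have "higher_differentiable_on (snd c ` (fst c \<inter> fst c')) (snd c' \<circ> chart_inv c) 1"
    using chart_compat assms unfolding smooth_on_def by blast
  then have "(snd c' \<circ> chart_inv c) differentiable (at (snd c p))"
    using assms unfolding higher_differentiable_on_1 by blast
  then show ?thesis unfolding chart_diff_def frechet_derivative_works .
qed

lemma linear_chart_diff:
  "c \<in> A \<Longrightarrow> c' \<in> A \<Longrightarrow> p \<in> fst c \<Longrightarrow> p \<in> fst c' \<Longrightarrow> linear (chart_diff c c' p)"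
  using chart_trans_has_derivative has_derivative_linear by blast

lemma chart_diff_inverse:
  assumes "c \<in> A" "c' \<in> A" "p \<in> fst c" "p \<in> fst c'"
  shows "chart_diff c' c p (chart_diff c c' p v) = v"
proof -
  have d: "(snd c \<circ> chart_inv c' has_derivative chart_diff c' c p) (at ((snd c' \<circ> chart_inv c) (snd c p)))"
    using chart_trans_has_derivative[of c' c p] assms by (simp add: chart_inv_snd)
  have "((snd c \<circ> chart_inv c') \<circ> (snd c' \<circ> chart_inv c) has_derivative (chart_diff c' c p \<circ> chart_diff c c' p)) (at (snd c p))"
    by (rule diff_chain_at[OF chart_trans_has_derivative d]) (use assms in auto)
  moreover have "((snd c \<circ> chart_inv c') \<circ> (snd c' \<circ> chart_inv c) has_derivative (\<lambda>v. v)) (at (snd c p))"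
  proof (rule has_derivative_transform_within_open[OF has_derivative_ident])
    show "open (snd c ` (fst c \<inter> fst c'))" using open_chart_image_Int chart_open assms by blast
  qed (use assms in \<open>auto simp: chart_inv_snd\<close>)
  ultimately have "chart_diff c' c p \<circ> chart_diff c c' p = (\<lambda>v. v)" by (rule has_derivative_unique)
  then show ?thesis by (metis comp_apply)
qed

lemma dform_change:
  assumes "c \<in> A" "c' \<in> A" "p \<in> fst c" "p \<in> fst c'" "Ck_on 1 W f" "p \<in> W"
  shows "dform f c' p (chart_diff c c' p v) = dform f c p v"
proof -
  have d: "(f \<circ> chart_inv c' has_derivative dform f c' p) (at ((snd c' \<circ> chart_inv c) (snd c p)))"
    using Ck_on_differentiable[of W f p c'] assms by (simp add: chart_inv_snd dform_def frechet_derivative_works)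
  have "((f \<circ> chart_inv c') \<circ> (snd c' \<circ> chart_inv c) has_derivative (dform f c' p \<circ> chart_diff c c' p)) (at (snd c p))"
    by (rule diff_chain_at[OF chart_trans_has_derivative d]) (use assms in auto)
  then have "(f \<circ> chart_inv c has_derivative (dform f c' p \<circ> chart_diff c c' p)) (at (snd c p))"
  proof (rule has_derivative_transform_within_open)
    show "open (snd c ` (fst c \<inter> fst c'))" using open_chart_image_Int chart_open assms by blast
  qed (use assms in \<open>auto simp: chart_inv_snd\<close>)
  then show ?thesis using frechet_derivative_eqI unfolding dform_def by (metis comp_apply)
qed

lemma dform_has_derivative:
  "Ck_on 1 W f \<Longrightarrow> p \<in> W \<Longrightarrow> c \<in> A \<Longrightarrow> p \<in> fst c \<Longrightarrow>
    (f \<circ> chart_inv c has_derivative dform f c p) (at (snd c p))"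
  using Ck_on_differentiable unfolding dform_def frechet_derivative_works .

lemma linear_dform: "Ck_on 1 W f \<Longrightarrow> p \<in> W \<Longrightarrow> c \<in> A \<Longrightarrow> p \<in> fst c \<Longrightarrow> linear (dform f c p)"
  using dform_has_derivative has_derivative_linear by blast

lemma dform_unique:
  assumes "(f \<circ> chart_inv c has_derivative D) (at (snd c p))" shows "dform f c p = D"
  unfolding dform_def by (rule frechet_derivative_eqI[OF assms])

lemma dform_cong:
  assumes "open W" "p \<in> W" "c \<in> A" "p \<in> fst c" "\<And>q. q \<in> W \<Longrightarrow> f q = g q"
  shows "dform f c p = dform g c p"
  unfolding dform_def
  by (rule frechet_derivative_cong_open[OF open_chart_image_Int[OF assms(3,1)]])
    (use assms in \<open>auto simp: chart_inv_snd\<close>)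

lemma metric_inner_change:
  assumes "c \<in> A" "c' \<in> A" "p \<in> fst c" "p \<in> fst c'"
  shows "metric_inner G c' p (chart_diff c c' p v) (chart_diff c c' p w) = metric_inner G c p v w"
proof -
  let ?J = "matrix (chart_diff c c' p)"
  have J: "chart_diff c c' p v = ?J *v v" for v
    using linear_chart_diff[OF assms] by (simp add: matrix_vector_mul)
  have "G c p = transpose ?J ** G c' p ** ?J"
    using metric_change[of c c' p ?J] assms by (simp add: jacobian_def chart_diff_def)
  then have "v \<bullet> (G c p *v w) = v \<bullet> (transpose ?J *v (G c' p *v (?J *v w)))"
    by (simp add: matrix_vector_mul_assoc matrix_mul_assoc)
  also have "\<dots> = (?J *v v) \<bullet> (G c' p *v (?J *v w))"
    by (metis dot_lmul_matrix vector_transpose_matrix)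
  finally show ?thesis by (simp add: metric_inner_def J)
qed

lemma metric_norm_change:
  "c \<in> A \<Longrightarrow> c' \<in> A \<Longrightarrow> p \<in> fst c \<Longrightarrow> p \<in> fst c' \<Longrightarrow>
    metric_norm G c' p (chart_diff c c' p v) = metric_norm G c p v"
  by (simp add: metric_norm_def metric_inner_change)

lemma metric_inner_nonneg: "c \<in> A \<Longrightarrow> p \<in> fst c \<Longrightarrow> metric_inner G c p v v \<ge> 0"
  unfolding metric_inner_def using metric_pos by (cases "v = 0") (auto simp: less_imp_le)

lemma metric_norm_nonneg: "c \<in> A \<Longrightarrow> p \<in> fst c \<Longrightarrow> metric_norm G c p v \<ge> 0"
  by (simp add: metric_norm_def metric_inner_nonneg)

lemma metric_norm_eq_0: "c \<in> A \<Longrightarrow> p \<in> fst c \<Longrightarrow> metric_norm G c p v = 0 \<longleftrightarrow> v = 0"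
  using metric_pos[of c p v] by (cases "v = 0") (auto simp: metric_norm_def metric_inner_def)

lemma metric_norm_power2: "c \<in> A \<Longrightarrow> p \<in> fst c \<Longrightarrow> (metric_norm G c p v)\<^sup>2 = metric_inner G c p v v"
  by (simp add: metric_norm_def metric_inner_nonneg)

lemma metric_norm_scaleR: "metric_norm G c p (a *\<^sub>R v) = \<bar>a\<bar> * metric_norm G c p v"
proof -
  have "metric_inner G c p (a *\<^sub>R v) (a *\<^sub>R v) = a\<^sup>2 * metric_inner G c p v v"
    by (simp add: metric_inner_def matrix_vector_mult_scaleR power2_eq_square)
  then show ?thesis by (simp add: metric_norm_def real_sqrt_mult)
qed

lemma invertible_metric: "c \<in> A \<Longrightarrow> p \<in> fst c \<Longrightarrow> invertible (G c p)"
  using positive_definite_invertible metric_pos by blast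

lemma det_metric_pos: "c \<in> A \<Longrightarrow> p \<in> fst c \<Longrightarrow> det (G c p) > 0"
  using positive_definite_det_pos metric_pos by blast

lemma metric_gradient:
  "c \<in> A \<Longrightarrow> p \<in> fst c \<Longrightarrow>
    G c p *v gradient G u c p = (\<chi> j. partial_deriv j (u \<circ> chart_inv c) (snd c p))"
  using invertible_metric[of c p] someI_ex[of "\<lambda>B. G c p ** B = mat 1 \<and> B ** G c p = mat 1"]
  by (simp add: gradient_def matrix_vector_mul_assoc matrix_inv_def invertible_def)

text \<open>The characterising property of the gradient. It lets the rest of the development work
  with differentials, which do not involve the metric.\<close>

lemma metric_inner_gradient:
  assumes "c \<in> A" "p \<in> fst c" "Ck_on 1 W u" "p \<in> W"
  shows "metric_inner G c p w (gradient G u c p) = dform u c p w"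
proof -
  have lin: "linear (dform u c p)" using linear_dform assms by blast
  have "dform u c p w = dform u c p (\<Sum>i\<in>UNIV. w $ i *\<^sub>R axis i 1)" by (simp add: basis_expansion scalar_mult_eq_scaleR[symmetric])
  also have "\<dots> = (\<Sum>i\<in>UNIV. w $ i * dform u c p (axis i 1))"
    by (simp add: linear_sum[OF lin] linear_cmul[OF lin])
  also have "\<dots> = metric_inner G c p w (gradient G u c p)"
    using assms by (simp add: metric_inner_def metric_gradient inner_vec_def partial_deriv_def dform_def)
  finally show ?thesis by simp
qed

text \<open>The metric is nondegenerate: both vectors have the same inner product with every
  \<open>w\<close>, so their difference \<open>z\<close> satisfies g(z, z) = 0.\<close>

lemma gradient_change:
  assumes "c \<in> A" "c' \<in> A" "p \<in> fst c" "p \<in> fst c'" "Ck_on 1 W u" "p \<in> W"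
  shows "chart_diff c c' p (gradient G u c p) = gradient G u c' p"
proof -
  define z where "z = chart_diff c c' p (gradient G u c p) - gradient G u c' p"
  have "metric_inner G c' p w (chart_diff c c' p (gradient G u c p)) = metric_inner G c' p w (gradient G u c' p)" for w
  proof -
    define v where "v = chart_diff c' c p w"
    have w: "w = chart_diff c c' p v" unfolding v_def using chart_diff_inverse assms by metis
    show ?thesis unfolding w using assms
      by (simp add: metric_inner_change metric_inner_gradient dform_change)
  qed
  from this[of z] have "metric_inner G c' p z z = 0"
    by (simp add: z_def metric_inner_def matrix_vector_mult_diff_distrib inner_diff_right)
  then show ?thesis using metric_pos[of c' p z] assms by (auto simp: metric_inner_def z_def)
qed

lemma phi_gradient_change:
  assumes "c \<in> A" "c' \<in> A" "p \<in> fst c" "p \<in> fst c'" "Ck_on 1 W u" "p \<in> W"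
  shows "chart_diff c c' p (phi_gradient G \<phi> u c p) = phi_gradient G \<phi> u c' p"
proof -
  have g: "gradient G u c' p = chart_diff c c' p (gradient G u c p)" using gradient_change assms by metis
  have lin: "linear (chart_diff c c' p)" using linear_chart_diff assms by blast
  have "gradient G u c' p = 0 \<longleftrightarrow> gradient G u c p = 0"
    using g chart_diff_inverse[OF assms(1-4)] linear_0[OF lin] linear_0[OF linear_chart_diff, of c' c p] assms by metis
  then show ?thesis
    unfolding phi_gradient_def Let_def g using assms
    by (simp add: metric_norm_change linear_0[OF lin] linear_cmul[OF lin])
qed

text \<open>\<open>pairing_gradient\<close> evaluates in an arbitrarily chosen chart at each point;
  invariance of flux and differential allows any chart in its place.\<close>

lemma pairing_phi_gradient:
  assumes "c \<in> A" "p \<in> fst c" "Ck_on 1 W u" "p \<in> W" "Ck_on 1 V \<psi>" "p \<in> V"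
  shows "pairing_gradient A G (phi_gradient G \<phi> u) \<psi> p = dform \<psi> c p (phi_gradient G \<phi> u c p)"
proof -
  let ?c = "chart_at A p"
  note c' = chart_at[of p]
  have "pairing_gradient A G (phi_gradient G \<phi> u) \<psi> p = dform \<psi> ?c p (phi_gradient G \<phi> u ?c p)"
    unfolding pairing_gradient_def Let_def by (rule metric_inner_gradient[OF c' assms(5,6)])
  also have "\<dots> = dform \<psi> c p (phi_gradient G \<phi> u c p)"
    using phi_gradient_change[OF assms(1) c'(1) assms(2) c'(2) assms(3,4)]
      dform_change[OF assms(1) c'(1) assms(2) c'(2) assms(5,6)] by metis
  finally show ?thesis .
qed

section \<open>Comparison of the metric with the Euclidean norm of a chart\<close>

text \<open>The norm at \<open>p\<close> attains a positive minimum and a maximum on the Euclidean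
  unit sphere, and homogeneity extends the bounds to all vectors.\<close>

lemma metric_norm_euclidean_bounds:
  assumes c: "c \<in> A" "p \<in> fst c"
  obtains m M where "0 < m" "0 < M" "\<And>v. m * norm v \<le> metric_norm G c p v" "\<And>v. metric_norm G c p v \<le> M * norm v"
proof -
  let ?N = "metric_norm G c p"
  have cont: "continuous_on (sphere 0 1) ?N"
    unfolding metric_norm_def metric_inner_def
    by (intro continuous_intros linear_continuous_on matrix_vector_mul_bounded_linear)
  have ne: "sphere (0 :: real^'n) 1 \<noteq> {}" by simp
  obtain a where a: "a \<in> sphere 0 1" "\<And>v. v \<in> sphere 0 1 \<Longrightarrow> ?N a \<le> ?N v"
    using continuous_attains_inf[OF compact_sphere ne cont] by blast
  obtain b where b: "b \<in> sphere 0 1" "\<And>v. v \<in> sphere 0 1 \<Longrightarrow> ?N v \<le> ?N b"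
    using continuous_attains_sup[OF compact_sphere ne cont] by blast
  have pos: "?N v > 0" if "v \<in> sphere 0 1" for v
    using metric_norm_nonneg[OF c, of v] metric_norm_eq_0[OF c, of v] that by force
  have sc: "?N v = norm v * ?N ((1 / norm v) *\<^sub>R v)" if "v \<noteq> 0" for v
    using that by (simp add: metric_norm_scaleR)
  have "?N a * norm v \<le> ?N v" "?N v \<le> ?N b * norm v" for v
  proof -
    have z: "?N 0 = 0" using metric_norm_eq_0[OF c] by simp
    have in1: "(1 / norm v) *\<^sub>R v \<in> sphere 0 1" if "v \<noteq> 0" using that by simp
    show "?N a * norm v \<le> ?N v"
      using sc[of v] a(2)[OF in1] z by (cases "v = 0") (auto simp: mult.commute mult_left_mono)
    show "?N v \<le> ?N b * norm v"
      using sc[of v] b(2)[OF in1] z by (cases "v = 0") (auto simp: mult.commute mult_left_mono)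
  qed
  then show ?thesis using that pos a b by blast
qed

lemma continuous_on_metric: "c \<in> A \<Longrightarrow> continuous_on (chart_image c) (\<lambda>x. G c (chart_inv c x))"
  using metric_smooth[of c] unfolding smooth_on_def
  by (metis (no_types, lifting) comp_apply continuous_on_cong higher_differentiable_on.simps(1))

text \<open>Continuity of the metric matrix keeps the quadratic form at nearby points between 1/4
  and 7/4 of the form at \<open>p\<close>; taking roots gives comparison within a factor 2 in both
  directions.\<close>

lemma metric_pinching:
  assumes c: "c \<in> A" "p \<in> fst c"
  obtains r where "r > 0" "cball (snd c p) r \<subseteq> chart_image c"
    "\<And>x v. x \<in> cball (snd c p) r \<Longrightarrow> metric_norm G c p v \<le> 2 * metric_norm G c (chart_inv c x) v"
    "\<And>x v. x \<in> cball (snd c p) r \<Longrightarrow> metric_norm G c (chart_inv c x) v \<le> 2 * metric_norm G c p v"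
proof -
  obtain m M where m: "0 < m" "\<And>v. m * norm v \<le> metric_norm G c p v"
    using metric_norm_euclidean_bounds[OF c] by metis
  define n where "n = real CARD('n) * real CARD('n)"
  have n: "n > 0" by (simp add: n_def)
  \<comment> \<open>Entries of size at most \<open>d\<close> give operator norm at most
    \<open>n * d\<close>, that is 3/4 m^2, and m^2 |v|^2 is a lower bound for the quadratic form at
    \<open>p\<close>.\<close>
  define d where "d = 3 / 4 * m\<^sup>2 / n"
  have d: "d > 0" using m n by (simp add: d_def)
  have "continuous (at (snd c p)) (\<lambda>x. G c (chart_inv c x))"
    using continuous_on_metric[OF c(1)] chart_open(2)[OF c(1)] snd_in[OF c(2)] continuous_on_eq_continuous_at by blast
  then obtain r1 where r1: "r1 > 0" "\<And>x. dist x (snd c p) < r1 \<Longrightarrow> dist (G c (chart_inv c x)) (G c (chart_inv c (snd c p))) < d"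
    using d unfolding continuous_at_eps_delta by metis
  obtain r2 where r2: "r2 > 0" "cball (snd c p) r2 \<subseteq> chart_image c"
    using chart_open(2)[OF c(1)] snd_in[OF c(2)] open_contains_cball by blast
  define r where "r = min (r1 / 2) r2"
  have close: "\<bar>metric_inner G c (chart_inv c x) v v - metric_inner G c p v v\<bar> \<le> 3 / 4 * metric_inner G c p v v"
    if x: "x \<in> cball (snd c p) r" for x v
  proof -
    define H where "H = G c (chart_inv c x) - G c p"
    have "dist x (snd c p) < r1" using x r1(1) by (auto simp: r_def dist_commute min_def split: if_splits)
    then have "norm H < d" using r1(2)[of x] c by (simp add: H_def dist_norm chart_inv_snd)
    then have "\<bar>H $ i $ j\<bar> \<le> d" for i j
      using Finite_Cartesian_Product.norm_nth_le[where x=H and i=i] Finite_Cartesian_Product.norm_nth_le[where x="H $ i" and i=j] by simp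
    then have "onorm ((*v) H) \<le> n * d" unfolding n_def by (rule onorm_le_matrix_component)
    then have "norm (H *v v) \<le> n * d * norm v"
      using onorm[OF matrix_vector_mul_bounded_linear, of H v] mult_right_mono[of _ _ "norm v"] by fastforce
    then have "\<bar>v \<bullet> (H *v v)\<bar> \<le> norm v * (n * d * norm v)"
      using Cauchy_Schwarz_ineq2[of v "H *v v"] mult_left_mono[of "norm (H *v v)" _ "norm v"] by fastforce
    also have "\<dots> = 3 / 4 * (m * norm v)\<^sup>2" using n by (simp add: d_def power2_eq_square)
    also have "\<dots> \<le> 3 / 4 * (metric_norm G c p v)\<^sup>2"
      using m by (intro mult_left_mono power_mono) auto
    finally show ?thesis
      unfolding metric_norm_power2[OF c] by (simp add: H_def metric_inner_def matrix_vector_mult_diff_rdistrib inner_diff_right)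
  qed
  have sub: "cball (snd c p) r \<subseteq> chart_image c" using r2 by (auto simp: r_def)
  show ?thesis
  proof (rule that)
    show "r > 0" using r1 r2 by (simp add: r_def)
    show "cball (snd c p) r \<subseteq> chart_image c" by (rule sub)
    fix x v assume x: "x \<in> cball (snd c p) r"
    have q: "chart_inv c x \<in> fst c" using chart_inv_in c sub x by blast
    note nn = metric_norm_nonneg[OF c, of v] metric_norm_nonneg[OF c(1) q, of v]
      metric_inner_nonneg[OF c, of v] metric_inner_nonneg[OF c(1) q, of v]
    show "metric_norm G c p v \<le> 2 * metric_norm G c (chart_inv c x) v"
      by (rule power2_le_imp_le) (use close[OF x, of v, unfolded abs_le_iff] nn in \<open>simp_all add: power_mult_distrib metric_norm_power2 c q\<close>)
    show "metric_norm G c (chart_inv c x) v \<le> 2 * metric_norm G c p v"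
      by (rule power2_le_imp_le) (use close[OF x, of v, unfolded abs_le_iff] nn in \<open>simp_all add: power_mult_distrib metric_norm_power2 c q\<close>)
  qed
qed

end

section \<open>The Riemannian measure\<close>

context riemannian_manifold
begin

lemma volume_density_pos: "c \<in> A \<Longrightarrow> p \<in> fst c \<Longrightarrow> volume_density G c p > 0"
  by (simp add: volume_density_def det_metric_pos)

text \<open>Taking determinants in the transformation rule of the metric produces the squared
  Jacobian; this cancels the Jacobian in the change of variables.\<close>

lemma volume_density_change:
  assumes "c \<in> A" "c' \<in> A" "p \<in> fst c" "p \<in> fst c'"
  shows "volume_density G c p = \<bar>det (matrix (chart_diff c c' p))\<bar> * volume_density G c' p"
proof -
  let ?J = "matrix (chart_diff c c' p)"
  have "G c p = transpose ?J ** G c' p ** ?J"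
    using metric_change[of c c' p ?J] assms by (simp add: jacobian_def chart_diff_def)
  then have "det (G c p) = (det ?J)\<^sup>2 * det (G c' p)"
    by (simp add: det_mul power2_eq_square)
  then show ?thesis by (simp add: volume_density_def real_sqrt_mult)
qed

lemma volume_density_C1:
  assumes c: "c \<in> A"
  shows "higher_differentiable_on (chart_image c) (\<lambda>x. volume_density G c (chart_inv c x)) 1"
proof -
  note op = chart_open(2)[OF c]
  have bl: "bounded_linear (\<lambda>M::real^'n^'n. M $ i $ j)" for i j
    by (rule bounded_linear_compose[OF bounded_linear_vec_nth bounded_linear_vec_nth])
  have "higher_differentiable_on (chart_image c) (G c \<circ> chart_inv c) 1"
    using metric_smooth[OF c] unfolding smooth_on_def by blast
  from higher_differentiable_on_compose_linear[OF bl op this]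
  have ent: "higher_differentiable_on (chart_image c) (\<lambda>x. G c (chart_inv c x) $ i $ j) 1" for i j
    by (simp only: comp_apply)
  have "higher_differentiable_on (chart_image c) (\<lambda>x. det (G c (chart_inv c x))) 1"
    unfolding det_def
    by (intro higher_differentiable_on_sum higher_differentiable_on_mult higher_differentiable_on_prod
        higher_differentiable_on_const ent op)
  moreover have "higher_differentiable_on {0<..} sqrt 1"
    by (rule C1_on_realI[where f'="\<lambda>x. inverse (sqrt x) / 2"])
      (auto intro!: continuous_intros DERIV_real_sqrt)
  moreover have "(\<lambda>x. det (G c (chart_inv c x))) ` chart_image c \<subseteq> {0<..}"
    using det_metric_pos[OF c] chart_inv_in[OF c] by auto
  ultimately show ?thesis
    using higher_differentiable_on_compose[OF op] unfolding volume_density_def comp_def by blast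
qed

lemma volume_density_continuous:
  "c \<in> A \<Longrightarrow> continuous_on (chart_image c) (\<lambda>x. volume_density G c (chart_inv c x))"
  using volume_density_C1 higher_differentiable_on_Suc_imp_continuous by blast

section \<open>Measures of single charts and their agreement on overlaps\<close>

lemma chart_image_Int_borel:
  assumes c: "c \<in> A" and E: "E \<in> sets borel" shows "snd c ` (fst c \<inter> E) \<in> sets borel"
proof -
  have "chart_inv c \<in> borel_measurable (restrict_space borel (chart_image c))"
    by (rule borel_measurable_continuous_on_restrict[OF continuous_on_chart_inv[OF c]])
  from measurable_sets[OF this E]
  have "chart_inv c -` E \<inter> chart_image c \<in> sets (restrict_space borel (chart_image c))"
    by (simp add: space_restrict_space)
  then have "chart_inv c -` E \<inter> chart_image c \<in> sets borel"
    using chart_open(2)[OF c] by (subst (asm) sets_restrict_space_iff) auto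
  moreover have "snd c ` (fst c \<inter> E) = chart_inv c -` E \<inter> chart_image c"
    unfolding chart_image_Int[OF c] by auto
  ultimately show ?thesis by simp
qed

text \<open>The constant value off the chart image makes the map Borel on the whole space;
  \<open>chart_dens\<close> vanishes there, so the value carries no mass.\<close>

definition chart_param :: "('a, 'n) chart \<Rightarrow> real^'n \<Rightarrow> 'a" where
  "chart_param c x = (if x \<in> chart_image c then chart_inv c x else undefined)"

definition chart_dens :: "('a, 'n) chart \<Rightarrow> real^'n \<Rightarrow> real" where
  "chart_dens c x = indicator (chart_image c) x * volume_density G c (chart_inv c x)"

definition chart_measure :: "('a, 'n) chart \<Rightarrow> 'a measure" where
  "chart_measure c = distr (density lborel (\<lambda>x. ennreal (chart_dens c x))) borel (chart_param c)"

lemma chart_param_measurable [measurable]: "c \<in> A \<Longrightarrow> chart_param c \<in> borel_measurable borel"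
  unfolding chart_param_def[abs_def]
  by (rule borel_measurable_continuous_on_if)
    (use continuous_on_chart_inv[of c] chart_open(2)[of c] in auto)

lemma chart_dens_measurable [measurable]: "c \<in> A \<Longrightarrow> chart_dens c \<in> borel_measurable borel"
  using borel_measurable_continuous_on_indicator[OF _ volume_density_continuous[of c]] chart_open(2)[of c]
  by (simp add: chart_dens_def[abs_def])

lemma chart_dens_nonneg: "c \<in> A \<Longrightarrow> chart_dens c x \<ge> 0"
  using volume_density_pos[OF _ chart_inv_in, of c x] by (auto simp: chart_dens_def indicator_def)

lemma sets_chart_measure [simp]: "sets (chart_measure c) = sets borel"
  by (simp add: chart_measure_def)

lemma emeasure_chart_measure:
  assumes c: "c \<in> A" and E: "E \<in> sets borel"
  shows "emeasure (chart_measure c) E =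
    (\<integral>\<^sup>+x\<in>snd c ` (fst c \<inter> E). ennreal (volume_density G c (chart_inv c x)) \<partial>lborel)"
proof -
  have m: "chart_param c -` E \<in> sets borel" using measurable_sets[OF chart_param_measurable[OF c] E] by simp
  have "emeasure (chart_measure c) E = (\<integral>\<^sup>+x. ennreal (chart_dens c x) * indicator (chart_param c -` E) x \<partial>lborel)"
    unfolding chart_measure_def using c E m by (simp add: emeasure_distr emeasure_density)
  also have "\<dots> = (\<integral>\<^sup>+x\<in>snd c ` (fst c \<inter> E). ennreal (volume_density G c (chart_inv c x)) \<partial>lborel)"
    unfolding chart_image_Int[OF c]
    by (rule nn_integral_cong) (auto simp: chart_dens_def chart_param_def indicator_def)
  finally show ?thesis .
qed

text \<open>Change of variables along the transition map, whose Jacobian factor is exactly the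
  quotient of the two densities.\<close>

lemma emeasure_chart_measure_change:
  assumes c: "c \<in> A" "c' \<in> A" and E: "E \<in> sets borel" "E \<subseteq> fst c" "E \<subseteq> fst c'"
  shows "emeasure (chart_measure c) E = emeasure (chart_measure c') E"
proof -
  let ?T = "snd c' \<circ> chart_inv c" and ?S = "snd c ` E"
  have eq: "fst c \<inter> E = E" "fst c' \<inter> E = E" using E by auto
  have TS: "?T ` ?S = snd c' ` E"
    unfolding image_image using c E by (intro image_cong) (auto simp: chart_inv_snd subset_iff)
  have bor: "?S \<in> sets borel" "snd c' ` E \<in> sets borel"
    using chart_image_Int_borel[OF c(1) E(1)] chart_image_Int_borel[OF c(2) E(1)] by (simp_all add: eq)
  have sub: "?S \<subseteq> chart_image c" "snd c' ` E \<subseteq> chart_image c'" using E by (auto simp: chart_image_def)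
  have dens: "\<bar>det (matrix (chart_diff c c' (chart_inv c x)))\<bar> * volume_density G c' (chart_inv c' (?T x)) = volume_density G c (chart_inv c x)"
    if "x \<in> ?S" for x
    using that c E volume_density_change[of c c'] by (auto simp: chart_inv_snd subset_iff)
  have "(\<integral>\<^sup>+x\<in>?T ` ?S. ennreal (volume_density G c' (chart_inv c' x)) \<partial>lborel) =
      (\<integral>\<^sup>+x\<in>?S. ennreal (\<bar>det (matrix (chart_diff c c' (chart_inv c x)))\<bar> * volume_density G c' (chart_inv c' (?T x))) \<partial>lborel)"
  proof (rule nn_integral_change_of_variables)
    show "(?T has_derivative chart_diff c c' (chart_inv c x)) (at x within ?S)" if "x \<in> ?S" for x
    proof -
      obtain p where p: "p \<in> E" "x = snd c p" using \<open>x \<in> ?S\<close> by blast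
      then show ?thesis using chart_trans_has_derivative[of c c' p] c E
        by (auto simp: chart_inv_snd subset_iff intro: has_derivative_at_withinI)
    qed
    show "inj_on ?T ?S"
    proof (rule inj_onI)
      fix x y assume "x \<in> ?S" "y \<in> ?S" "?T x = ?T y"
      then show "x = y" using c E by (auto simp: chart_inv_snd subset_iff) (metis chart_inv_snd)
    qed
    show "0 \<le> volume_density G c' (chart_inv c' y)" if "y \<in> ?T ` ?S" for y
      using that volume_density_pos[of c'] chart_inv_in[of c'] c sub unfolding TS by (meson less_imp_le subset_iff)
    show "(\<lambda>y. indicator (?T ` ?S) y * volume_density G c' (chart_inv c' y)) \<in> borel_measurable borel"
      unfolding TS using borel_measurable_continuous_on_indicator[OF bor(2) continuous_on_subset[OF volume_density_continuous sub(2)]] c by simp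
    have "(\<lambda>x. indicator ?S x * volume_density G c (chart_inv c x)) \<in> borel_measurable borel"
      using borel_measurable_continuous_on_indicator[OF bor(1) continuous_on_subset[OF volume_density_continuous sub(1)]] c by simp
    moreover have "(\<lambda>x. indicator ?S x * (\<bar>det (matrix (chart_diff c c' (chart_inv c x)))\<bar> * volume_density G c' (chart_inv c' (?T x))))
        = (\<lambda>x. indicator ?S x * volume_density G c (chart_inv c x))"
      using dens by (auto simp: indicator_def fun_eq_iff simp del: comp_apply)
    ultimately show "(\<lambda>x. indicator ?S x * (\<bar>det (matrix (chart_diff c c' (chart_inv c x)))\<bar> * volume_density G c' (chart_inv c' (?T x))))
        \<in> borel_measurable borel" by simp
  qed (rule bor)
  also have "\<dots> = (\<integral>\<^sup>+x\<in>?S. ennreal (volume_density G c (chart_inv c x)) \<partial>lborel)"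
    by (rule nn_integral_cong) (use dens in \<open>auto simp: indicator_def simp del: comp_apply\<close>)
  finally show ?thesis
    unfolding emeasure_chart_measure[OF c(1) E(1)] emeasure_chart_measure[OF c(2) E(1)] eq TS by simp
qed

text \<open>Second countability provides a countable subcover by chart domains; the enumeration may
  repeat charts.\<close>

lemma countable_atlas:
  obtains C :: "nat \<Rightarrow> ('a, 'n) chart" where "\<And>i. C i \<in> A" "(\<Union>i. fst (C i)) = UNIV"
proof -
  have "\<And>S. S \<in> fst ` A \<Longrightarrow> open S" using chart_open by auto
  then obtain F where F: "F \<subseteq> fst ` A" "countable F" "\<Union>F = UNIV"
    using Lindelof[of "fst ` A"] atlas_cover by metis
  have "F \<noteq> {}" using F(3) by auto
  define C where "C i = (SOME c. c \<in> A \<and> fst c = from_nat_into F i)" for i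
  have C: "C i \<in> A \<and> fst (C i) = from_nat_into F i" for i
  proof -
    have "\<exists>c. c \<in> A \<and> fst c = from_nat_into F i"
      using from_nat_into[OF \<open>F \<noteq> {}\<close>, of i] F(1) by (metis (no_types) imageE subsetD)
    then show ?thesis unfolding C_def by (rule someI_ex)
  qed
  have "(\<Union>i. fst (C i)) = \<Union> (range (from_nat_into F))" using C by auto
  also have "\<dots> = UNIV" using F(2,3) \<open>F \<noteq> {}\<close> by simp
  finally show ?thesis using that C by blast
qed

text \<open>The manifold is cut into countably many disjoint Borel pieces, each inside one chart,
  and the chart measures of the pieces are added. Agreement on overlaps shows that the result is
  right in every chart.\<close>

lemma ex_riem_volume:
  "\<exists>\<mu>. sets \<mu> = sets borel \<and>
     (\<forall>c\<in>A. \<forall>E\<in>sets borel. E \<subseteq> fst c \<longrightarrow>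
        emeasure \<mu> E = (\<integral>\<^sup>+x\<in>snd c ` E. ennreal (volume_density G c (chart_inv c x)) \<partial>lborel))"
proof -
  obtain C :: "nat \<Rightarrow> ('a, 'n) chart" where C: "\<And>i. C i \<in> A" "(\<Union>i. fst (C i)) = UNIV"
    using countable_atlas by blast
  define D where "D = disjointed (\<lambda>i. fst (C i))"
  have UD: "(\<Union>i. D i) = UNIV" unfolding D_def using C(2) by (simp add: UN_disjointed_eq)
  have dD: "disjoint_family D" unfolding D_def by (rule disjoint_family_disjointed)
  have DC: "D i \<subseteq> fst (C i)" for i unfolding D_def by (rule disjointed_subset)
  have bC: "range (\<lambda>i. fst (C i)) \<subseteq> sets borel" using chart_open(1)[OF C(1)] by auto
  have bD [measurable]: "D i \<in> sets borel" for i
    using sets.range_disjointed_sets[OF bC] unfolding D_def by auto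
  \<comment> \<open>Writing the sum as an integral over the counting measure turns countable
    additivity into an interchange of a nonnegative series with an integral.\<close>
  define m where "m B = (\<integral>\<^sup>+i. emeasure (chart_measure (C i)) (B \<inter> D i) \<partial>count_space UNIV)" for B
  define \<mu> where "\<mu> = measure_of UNIV (sets borel) m"
  have sets_\<mu>: "sets \<mu> = sets borel" unfolding \<mu>_def using sets.sets_measure_of_eq[of borel] by simp
  have em: "emeasure \<mu> B = m B" if "B \<in> sets borel" for B
  proof (rule emeasure_measure_of[OF \<mu>_def])
    show "positive (sets \<mu>) m" by (simp add: positive_def m_def)
    show "countably_additive (sets \<mu>) m"
    proof (rule countably_additiveI)
      fix B :: "nat \<Rightarrow> 'a set" assume B: "range B \<subseteq> sets \<mu>" "disjoint_family B"
      have "(\<Sum>k. m (B k)) = (\<integral>\<^sup>+i. (\<Sum>k. emeasure (chart_measure (C i)) (B k \<inter> D i)) \<partial>count_space UNIV)"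
        unfolding m_def by (rule nn_integral_suminf[symmetric]) simp
      also have "\<dots> = (\<integral>\<^sup>+i. emeasure (chart_measure (C i)) ((\<Union>k. B k) \<inter> D i) \<partial>count_space UNIV)"
      proof (rule nn_integral_cong)
        fix i
        have "(\<Sum>k. emeasure (chart_measure (C i)) (B k \<inter> D i)) = emeasure (chart_measure (C i)) (\<Union>k. B k \<inter> D i)"
          by (rule suminf_emeasure) (use B sets_\<mu> in \<open>auto simp: disjoint_family_on_def\<close>)
        then show "(\<Sum>k. emeasure (chart_measure (C i)) (B k \<inter> D i)) = emeasure (chart_measure (C i)) ((\<Union>k. B k) \<inter> D i)"
          by simp
      qed
      finally show "(\<Sum>k. m (B k)) = m (\<Union>k. B k)" by (simp add: m_def)
    qed
  qed (use that sets_\<mu> in auto)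
  have "emeasure \<mu> E = (\<integral>\<^sup>+x\<in>snd c ` E. ennreal (volume_density G c (chart_inv c x)) \<partial>lborel)"
    if c: "c \<in> A" and E: "E \<in> sets borel" "E \<subseteq> fst c" for c E
  proof -
    have "emeasure \<mu> E = (\<integral>\<^sup>+i. emeasure (chart_measure (C i)) (E \<inter> D i) \<partial>count_space UNIV)"
      using em E by (simp add: m_def)
    also have "\<dots> = (\<integral>\<^sup>+i. emeasure (chart_measure c) (E \<inter> D i) \<partial>count_space UNIV)"
      by (rule nn_integral_cong, rule emeasure_chart_measure_change) (use C DC E c in auto)
    also have "\<dots> = (\<Sum>i. emeasure (chart_measure c) (E \<inter> D i))" by (rule nn_integral_count_space_nat)
    also have "\<dots> = emeasure (chart_measure c) (\<Union>i. E \<inter> D i)"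
      by (rule suminf_emeasure) (use E dD in \<open>auto simp: disjoint_family_on_def\<close>)
    also have "(\<Union>i. E \<inter> D i) = E" using UD by auto
    also have "emeasure (chart_measure c) E = (\<integral>\<^sup>+x\<in>snd c ` E. ennreal (volume_density G c (chart_inv c x)) \<partial>lborel)"
      using emeasure_chart_measure[OF c E(1)] E(2) by (simp add: Int_absorb1)
    finally show ?thesis .
  qed
  then show ?thesis using sets_\<mu> by blast
qed

lemma riem_volume_unique:
  assumes "sets \<mu> = sets borel" "sets \<nu> = sets borel"
    and eq: "\<And>c E. c \<in> A \<Longrightarrow> E \<in> sets borel \<Longrightarrow> E \<subseteq> fst c \<Longrightarrow> emeasure \<mu> E = emeasure \<nu> E"
  shows "\<mu> = \<nu>"
proof (rule measure_eqI)
  fix E assume "E \<in> sets \<mu>"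
  then have E: "E \<in> sets borel" using assms by simp
  obtain C :: "nat \<Rightarrow> ('a, 'n) chart" where C: "\<And>i. C i \<in> A" "(\<Union>i. fst (C i)) = UNIV"
    using countable_atlas by blast
  define D where "D = disjointed (\<lambda>i. fst (C i))"
  have UD: "(\<Union>i. D i) = UNIV" unfolding D_def using C(2) by (simp add: UN_disjointed_eq)
  have dD: "disjoint_family D" unfolding D_def by (rule disjoint_family_disjointed)
  have DC: "D i \<subseteq> fst (C i)" for i unfolding D_def by (rule disjointed_subset)
  have bC: "range (\<lambda>i. fst (C i)) \<subseteq> sets borel" using chart_open(1)[OF C(1)] by auto
  have bD [measurable]: "D i \<in> sets borel" for i
    using sets.range_disjointed_sets[OF bC] unfolding D_def by auto
  have "(\<Union>i. E \<inter> D i) = E" using UD by auto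
  moreover have "(\<Sum>i. emeasure \<mu> (E \<inter> D i)) = emeasure \<mu> (\<Union>i. E \<inter> D i)"
    by (rule suminf_emeasure) (use E dD assms in \<open>auto simp: disjoint_family_on_def\<close>)
  moreover have "(\<Sum>i. emeasure \<nu> (E \<inter> D i)) = emeasure \<nu> (\<Union>i. E \<inter> D i)"
    by (rule suminf_emeasure) (use E dD assms in \<open>auto simp: disjoint_family_on_def\<close>)
  moreover have "emeasure \<mu> (E \<inter> D i) = emeasure \<nu> (E \<inter> D i)" for i
    by (rule eq[OF C(1)]) (use E DC in auto)
  ultimately show "emeasure \<mu> E = emeasure \<nu> E" by simp
qed (use assms in simp)

section \<open>Integration against the Riemannian volume\<close>

abbreviation "vol \<equiv> riem_volume A G"

text \<open>\<open>riem_volume\<close> is a definite description, so nothing about it is known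
  before existence and uniqueness have been put together here.\<close>

lemma sets_vol [simp, measurable_cong]: "sets vol = sets borel"
  and emeasure_vol_chart: "c \<in> A \<Longrightarrow> E \<in> sets borel \<Longrightarrow> E \<subseteq> fst c \<Longrightarrow>
    emeasure vol E = (\<integral>\<^sup>+x\<in>snd c ` E. ennreal (volume_density G c (chart_inv c x)) \<partial>lborel)"
proof -
  let ?P = "\<lambda>\<mu>. sets \<mu> = sets borel \<and>
     (\<forall>c\<in>A. \<forall>E\<in>sets borel. E \<subseteq> fst c \<longrightarrow>
        emeasure \<mu> E = (\<integral>\<^sup>+x\<in>snd c ` E. ennreal (volume_density G c (chart_inv c x)) \<partial>lborel))"
  obtain \<nu> where \<nu>: "?P \<nu>" using ex_riem_volume by blast
  have "\<exists>!\<mu>. ?P \<mu>"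
  proof (rule ex1I[of _ \<nu>])
    fix \<mu> assume \<mu>: "?P \<mu>"
    show "\<mu> = \<nu>"
    proof (rule riem_volume_unique)
      fix c E assume "c \<in> A" "E \<in> sets borel" "E \<subseteq> fst c"
      with \<mu>[THEN conjunct2, rule_format] \<nu>[THEN conjunct2, rule_format]
      show "emeasure \<mu> E = emeasure \<nu> E" by simp
    qed (use \<mu> \<nu> in \<open>blast+\<close>)
  qed (rule \<nu>)
  then have "?P vol" unfolding riem_volume_def by (rule theI')
  then show "sets vol = sets borel"
    and "c \<in> A \<Longrightarrow> E \<in> sets borel \<Longrightarrow> E \<subseteq> fst c \<Longrightarrow>
      emeasure vol E = (\<integral>\<^sup>+x\<in>snd c ` E. ennreal (volume_density G c (chart_inv c x)) \<partial>lborel)"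
    by blast+
qed

lemma space_vol [simp]: "space vol = UNIV"
  using sets_eq_imp_space_eq[OF sets_vol] by simp

text \<open>Identifies the volume restricted to a chart domain with a pushforward of a weighted
  Lebesgue measure, so that integrals can be computed in coordinates.\<close>

lemma density_vol_chart:
  assumes c: "c \<in> A"
  shows "density vol (\<lambda>p. ennreal (indicator (fst c) p)) = chart_measure c"
proof (rule measure_eqI)
  fix E assume "E \<in> sets (density vol (\<lambda>p. ennreal (indicator (fst c) p)))"
  then have E: "E \<in> sets borel" by simp
  have o: "fst c \<in> sets borel" using chart_open(1)[OF c] by simp
  have "emeasure (density vol (\<lambda>p. ennreal (indicator (fst c) p))) E =
      (\<integral>\<^sup>+p. ennreal (indicator (fst c) p) * indicator E p \<partial>vol)"
    using E o by (intro emeasure_density) auto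
  also have "\<dots> = (\<integral>\<^sup>+p. indicator (fst c \<inter> E) p \<partial>vol)"
    by (rule nn_integral_cong) (simp add: indicator_def)
  also have "\<dots> = emeasure vol (fst c \<inter> E)" using E o by (intro nn_integral_indicator) auto
  also have "\<dots> = emeasure (chart_measure c) E"
    unfolding emeasure_chart_measure[OF c E] using E o c by (intro emeasure_vol_chart) auto
  finally show "emeasure (density vol (\<lambda>p. ennreal (indicator (fst c) p))) E = emeasure (chart_measure c) E" .
qed simp

lemma integral_vol_chart:
  fixes F :: "'a \<Rightarrow> real"
  assumes c: "c \<in> A" and F: "F \<in> borel_measurable borel" and F0: "\<And>p. p \<notin> fst c \<Longrightarrow> F p = 0"
  shows "(LINT p|vol. F p) = (LINT x|lborel. chart_dens c x * F (chart_inv c x))"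
proof -
  have o: "fst c \<in> sets borel" using chart_open(1)[OF c] by simp
  have "(LINT p|vol. F p) = (LINT p|vol. indicator (fst c) p *\<^sub>R F p)"
    by (rule Bochner_Integration.integral_cong) (auto simp: indicator_def F0)
  also have "\<dots> = (LINT p|chart_measure c. F p)"
    unfolding density_vol_chart[OF c, symmetric] using o F by (subst integral_density) auto
  also have "\<dots> = (LINT x|density lborel (\<lambda>x. ennreal (chart_dens c x)). F (chart_param c x))"
    unfolding chart_measure_def using c F by (subst integral_distr) auto
  also have "\<dots> = (LINT x|lborel. chart_dens c x *\<^sub>R F (chart_param c x))"
    using c F chart_dens_nonneg[OF c] by (subst integral_density) auto
  also have "\<dots> = (LINT x|lborel. chart_dens c x * F (chart_inv c x))"
    by (rule Bochner_Integration.integral_cong) (auto simp: chart_dens_def chart_param_def indicator_def)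
  finally show ?thesis .
qed

lemma emeasure_vol_cball:
  assumes c: "c \<in> A" and K: "compact K" "K \<subseteq> chart_image c"
  shows "emeasure vol (chart_inv c ` K) < \<infinity>"
proof -
  have sub: "chart_inv c ` K \<subseteq> fst c" using chart_inv_in[OF c] K by auto
  have "compact (chart_inv c ` K)"
    by (rule compact_continuous_image[OF continuous_on_subset[OF continuous_on_chart_inv]]) (use c K in auto)
  then have bor: "chart_inv c ` K \<in> sets borel" by (simp add: borel_closed compact_imp_closed)
  have "snd c ` chart_inv c ` K = (\<lambda>x. x) ` K"
    unfolding image_image by (rule image_cong) (use K snd_chart_inv[OF c] in auto)
  then have img: "snd c ` chart_inv c ` K = K" by simp
  have "bounded ((\<lambda>x. volume_density G c (chart_inv c x)) ` K)"
    by (intro compact_imp_bounded compact_continuous_image continuous_on_subset[OF volume_density_continuous])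
      (use c K in auto)
  then obtain B where B: "\<And>x. x \<in> K \<Longrightarrow> \<bar>volume_density G c (chart_inv c x)\<bar> \<le> B"
    by (auto simp: bounded_iff)
  have "emeasure vol (chart_inv c ` K) = (\<integral>\<^sup>+x\<in>K. ennreal (volume_density G c (chart_inv c x)) \<partial>lborel)"
    using emeasure_vol_chart[OF c bor sub] by (simp add: img)
  also have "\<dots> \<le> (\<integral>\<^sup>+x. ennreal B * indicator K x \<partial>lborel)"
    by (rule nn_integral_mono) (use B in \<open>force simp: indicator_def intro: ennreal_leI\<close>)
  also have "\<dots> = ennreal B * emeasure lborel K"
    using K by (intro nn_integral_cmult_indicator) (auto simp: borel_closed compact_imp_closed)
  also have "\<dots> < \<infinity>" using emeasure_compact_finite[OF K(1)] by (simp add: ennreal_mult_less_top)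
  finally show ?thesis .
qed

text \<open>Closed coordinate balls have finite volume because the density is bounded on them, and
  finitely many of their interiors cover \<open>K\<close>.\<close>

lemma emeasure_vol_compact:
  assumes "compact K" shows "emeasure vol K < \<infinity>"
proof -
  let ?U = "{U. open U \<and> emeasure vol U < \<infinity>}"
  have "\<exists>U\<in>?U. p \<in> U" for p
  proof -
    obtain c where c: "c \<in> A" "p \<in> fst c" using ex_chart by blast
    obtain r where r: "r > 0" "cball (snd c p) r \<subseteq> chart_image c"
      using chart_open(2)[OF c(1)] snd_in[OF c(2)] open_contains_cball by blast
    let ?V = "fst c \<inter> snd c -` ball (snd c p) r"
    have V: "open ?V" "p \<in> ?V"
      using continuous_open_preimage[OF continuous_on_chart[OF c(1)] chart_open(1)[OF c(1)]] c r by auto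
    have "compact (chart_inv c ` cball (snd c p) r)"
      by (rule compact_continuous_image[OF continuous_on_subset[OF continuous_on_chart_inv]]) (use c r in auto)
    moreover have "?V \<subseteq> chart_inv c ` cball (snd c p) r"
    proof
      fix q assume "q \<in> ?V"
      then show "q \<in> chart_inv c ` cball (snd c p) r"
        using chart_inv_snd[OF c(1), of q] by (intro image_eqI[of _ _ "snd c q"]) auto
    qed
    ultimately have "emeasure vol ?V \<le> emeasure vol (chart_inv c ` cball (snd c p) r)"
      by (intro emeasure_mono) (auto simp: borel_closed compact_imp_closed)
    also have "\<dots> < \<infinity>" by (rule emeasure_vol_cball) (use c r in auto)
    finally have "?V \<in> ?U" using V(1) by simp
    with V(2) show ?thesis by (rule bexI)
  qed
  then have "K \<subseteq> \<Union>?U" by blast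
  then obtain F where F: "F \<subseteq> ?U" "finite F" "K \<subseteq> \<Union>F"
    using assms compactE[of K ?U] by (metis (no_types, lifting) mem_Collect_eq)
  have "emeasure vol K \<le> emeasure vol (\<Union>F)"
    by (rule emeasure_mono) (use F in \<open>auto intro!: borel_open\<close>)
  also have "\<dots> \<le> (\<Sum>U\<in>F. emeasure vol U)"
  proof -
    have "F \<subseteq> sets vol" using F(1) by (auto simp: borel_open)
    then show ?thesis using emeasure_subadditive_finite[of F id vol] F(2) by simp
  qed
  also have "\<dots> < \<infinity>" using F by (auto simp: less_top[symmetric])
  finally show ?thesis .
qed

text \<open>On a closed coordinate ball inside \<open>W\<close> the density has a positive
  minimum.\<close>

lemma emeasure_vol_open_pos:
  assumes W: "open W" "p \<in> W" shows "emeasure vol W > 0"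
proof -
  obtain c where c: "c \<in> A" "p \<in> fst c" using ex_chart by blast
  have "open (snd c ` (fst c \<inter> W))" using open_chart_image_Int c W by blast
  then obtain r where r: "r > 0" "cball (snd c p) r \<subseteq> snd c ` (fst c \<inter> W)"
    using open_contains_cball[of "snd c ` (fst c \<inter> W)"] c W by blast
  have im: "cball (snd c p) r \<subseteq> chart_image c" using r(2) by (auto simp: chart_image_def)
  have "\<exists>y\<in>cball (snd c p) r. \<forall>x\<in>cball (snd c p) r. volume_density G c (chart_inv c y) \<le> volume_density G c (chart_inv c x)"
    by (rule continuous_attains_inf[OF compact_cball])
      (use r c im in \<open>auto intro!: continuous_on_subset[OF volume_density_continuous]\<close>)
  then obtain d where d: "d > 0" "\<And>x. x \<in> cball (snd c p) r \<Longrightarrow> d \<le> volume_density G c (chart_inv c x)"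
    using volume_density_pos chart_inv_in c im by blast
  have "0 < ennreal d * emeasure lborel (ball (snd c p) r)"
    using d r content_ball_pos[of r "snd c p"]
    by (auto simp: ennreal_zero_less_mult_iff measure_def zero_less_iff_neq_zero)
  also have "\<dots> = (\<integral>\<^sup>+x. ennreal d * indicator (ball (snd c p) r) x \<partial>lborel)"
    by (rule nn_integral_cmult_indicator[symmetric]) simp
  also have "\<dots> \<le> (\<integral>\<^sup>+x\<in>snd c ` (fst c \<inter> W). ennreal (volume_density G c (chart_inv c x)) \<partial>lborel)"
    by (rule nn_integral_mono) (use d r in \<open>force simp: indicator_def intro: ennreal_leI\<close>)
  also have "\<dots> = emeasure vol (fst c \<inter> W)"
    using c W chart_open(1)[OF c(1)] by (intro emeasure_vol_chart[symmetric]) auto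
  also have "\<dots> \<le> emeasure vol W" using W by (intro emeasure_mono) auto
  finally show ?thesis .
qed

end

section \<open>Piecewise smooth curves and their length\<close>

lemma vector_derivative_cong_open:
  assumes "open S" "t \<in> S" "\<And>s. s \<in> S \<Longrightarrow> f s = g s"
  shows "vector_derivative f (at t) = vector_derivative g (at t)"
proof -
  have "(f has_vector_derivative D) (at t) \<longleftrightarrow> (g has_vector_derivative D) (at t)" for D
    using has_vector_derivative_transform_within_open[OF _ assms(1,2), of f D g]
      has_vector_derivative_transform_within_open[OF _ assms(1,2), of g D f] assms(3) by auto
  then show ?thesis by (simp add: vector_derivative_def)
qed

lemma isCont_open_nbhd:
  assumes "isCont f t" "open W" "f t \<in> W"
  obtains S where "open S" "t \<in> S" "\<And>s. s \<in> S \<Longrightarrow> f s \<in> W"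
proof -
  have "eventually (\<lambda>s. f s \<in> W) (nhds t)"
    using assms(1)[unfolded isCont_def tendsto_at_iff_tendsto_nhds] assms(2,3)
    by (auto simp: tendsto_def)
  then show ?thesis using that unfolding eventually_nhds by metis
qed

context riemannian_manifold
begin

section \<open>Curves of class C^1 and their speed in charts\<close>

abbreviation "speed \<equiv> curve_speed A G"
abbreviation "rdist \<equiv> riem_dist A G"

lemma C1_curve_onI_chart:
  assumes c: "c \<in> A" and im: "\<And>t. t \<in> {a..b} \<Longrightarrow> \<gamma> t \<in> fst c" and cD: "continuous_on {a..b} D"
    and D: "\<And>t. t \<in> {a..b} \<Longrightarrow> (snd c \<circ> \<gamma> has_vector_derivative D t) (at t within {a..b})"
  shows "C1_curve_on A a b \<gamma>"
  unfolding C1_curve_on_def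
proof (intro conjI ballI)
  have c1: "continuous_on {a..b} (snd c \<circ> \<gamma>)"
    using D has_vector_derivative_continuous continuous_on_eq_continuous_within by blast
  then have "continuous_on {a..b} (\<lambda>t. chart_inv c ((snd c \<circ> \<gamma>) t))"
    by (rule continuous_on_compose2[OF continuous_on_chart_inv[OF c]]) (use im snd_in[of _ c] in auto)
  then show "continuous_on {a..b} \<gamma>"
    by (rule continuous_on_eq) (simp add: im chart_inv_snd[OF c])
  fix c' assume c': "c' \<in> A"
  let ?T = "{t \<in> {a..b}. \<gamma> t \<in> fst c'}"
  let ?D = "\<lambda>t. frechet_derivative (snd c' \<circ> chart_inv c) (at ((snd c \<circ> \<gamma>) t)) (D t)"
  have "continuous_on ?T ?D"
  proof (rule continuous_on_frechet_derivative_apply)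
    show "higher_differentiable_on (snd c ` (fst c \<inter> fst c')) (snd c' \<circ> chart_inv c) 1"
      using chart_compat[OF c c'] unfolding smooth_on_def by blast
    show "continuous_on ?T (snd c \<circ> \<gamma>)" by (rule continuous_on_subset[OF c1]) auto
    show "(snd c \<circ> \<gamma>) ` ?T \<subseteq> snd c ` (fst c \<inter> fst c')" using im by auto
    show "continuous_on ?T D" by (rule continuous_on_subset[OF cD]) auto
  qed
  moreover have "(snd c' \<circ> \<gamma> has_vector_derivative ?D t) (at t within {a..b})" if t: "t \<in> {a..b}" "\<gamma> t \<in> fst c'" for t
  proof -
    have "(snd c' \<circ> chart_inv c has_derivative chart_diff c c' (\<gamma> t)) (at ((snd c \<circ> \<gamma>) t) within (snd c \<circ> \<gamma>) ` {a..b})"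
      using chart_trans_has_derivative[OF c c' im[OF t(1)] t(2)] by (simp add: has_derivative_at_withinI)
    from vector_derivative_diff_chain_within[OF D[OF t(1)] this]
    have "((snd c' \<circ> chart_inv c) \<circ> (snd c \<circ> \<gamma>) has_vector_derivative ?D t) (at t within {a..b})"
      by (simp add: chart_diff_def comp_def)
    then show ?thesis
      by (rule has_vector_derivative_transform[OF t(1), rotated]) (simp add: chart_inv_snd[OF c] im)
  qed
  ultimately show "\<exists>D. continuous_on ?T D \<and>
      (\<forall>t\<in>{a..b}. \<gamma> t \<in> fst c' \<longrightarrow> (snd c' \<circ> \<gamma> has_vector_derivative D t) (at t within {a..b}))"
    by blast
qed

lemma curve_derivative_change:
  assumes c: "c \<in> A" "c' \<in> A" "\<gamma> t \<in> fst c" "\<gamma> t \<in> fst c'" and cont: "isCont \<gamma> t"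
    and D: "(snd c \<circ> \<gamma> has_vector_derivative v) (at t)"
  shows "(snd c' \<circ> \<gamma> has_vector_derivative chart_diff c c' (\<gamma> t) v) (at t)"
proof -
  obtain S where S: "open S" "t \<in> S" "\<And>s. s \<in> S \<Longrightarrow> \<gamma> s \<in> fst c"
    using isCont_open_nbhd[OF cont chart_open(1)[OF c(1)] c(3)] by blast
  have "(snd c' \<circ> chart_inv c has_derivative chart_diff c c' (\<gamma> t)) (at ((snd c \<circ> \<gamma>) t))"
    using chart_trans_has_derivative[OF c] by simp
  then have "((snd c' \<circ> chart_inv c) \<circ> (snd c \<circ> \<gamma>) has_vector_derivative chart_diff c c' (\<gamma> t) v) (at t)"
    using vector_derivative_diff_chain_within[OF D] has_derivative_at_withinI by blast
  then show ?thesis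
    by (rule has_vector_derivative_transform_within_open[OF _ S(1,2)]) (simp add: chart_inv_snd[OF c(1)] S(3))
qed

text \<open>The chart used in \<open>curve_speed\<close> changes from one parameter value to the
  next; velocity and metric transform together, so any chart gives the same value.\<close>

lemma speed_eq:
  assumes c: "c \<in> A" "\<gamma> t \<in> fst c" and cont: "isCont \<gamma> t" and D: "(snd c \<circ> \<gamma> has_vector_derivative v) (at t)"
  shows "speed \<gamma> t = metric_norm G c (\<gamma> t) v"
proof -
  note c' = chart_at[of "\<gamma> t"]
  have "vector_derivative (snd (chart_at A (\<gamma> t)) \<circ> \<gamma>) (at t) = chart_diff c (chart_at A (\<gamma> t)) (\<gamma> t) v"
    using curve_derivative_change[OF c(1) c'(1) c(2) c'(2) cont D] by (rule vector_derivative_at)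
  then show ?thesis
    unfolding curve_speed_def Let_def using metric_norm_change[OF c(1) c'(1) c(2) c'(2)] by simp
qed

lemma speed_nonneg: "speed \<gamma> t \<ge> 0"
  unfolding curve_speed_def Let_def by (rule metric_norm_nonneg[OF chart_at])

lemma speed_cong_open:
  assumes "open S" "t \<in> S" "\<And>s. s \<in> S \<Longrightarrow> \<gamma> s = \<gamma>' s"
  shows "speed \<gamma> t = speed \<gamma>' t"
  unfolding curve_speed_def Let_def
  using vector_derivative_cong_open[OF assms(1,2), of "snd (chart_at A (\<gamma> t)) \<circ> \<gamma>" "snd (chart_at A (\<gamma> t)) \<circ> \<gamma>'"] assms
  by simp

lemma C1_curve_on_interior:
  assumes C: "C1_curve_on A a b \<gamma>" and t: "t \<in> {a<..<b}"
  obtains c v where "c \<in> A" "\<gamma> t \<in> fst c" "isCont \<gamma> t" "(snd c \<circ> \<gamma> has_vector_derivative v) (at t)"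
proof -
  obtain c where c: "c \<in> A" "\<gamma> t \<in> fst c" using ex_chart by blast
  obtain D where "(snd c \<circ> \<gamma> has_vector_derivative D t) (at t within {a..b})"
    using C[unfolded C1_curve_on_def] c t by fastforce
  then have "(snd c \<circ> \<gamma> has_vector_derivative D t) (at t)"
    using t at_within_Icc_at[of a t b] by simp
  moreover have "isCont \<gamma> t"
    using C[unfolded C1_curve_on_def] t continuous_on_interior[of "{a..b}" \<gamma> t] by simp
  ultimately show ?thesis using that c by blast
qed

text \<open>The speed is identified only at interior parameters: at an endpoint \<open>D\<close> is
  a one-sided derivative, while \<open>curve_speed\<close> uses the two-sided one.\<close>

lemma C1_curve_on_chart_derivative:
  assumes C: "C1_curve_on A a b \<gamma>" and c: "c \<in> A" and im: "\<And>t. t \<in> {a..b} \<Longrightarrow> \<gamma> t \<in> fst c"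
  obtains D where "continuous_on {a..b} D"
    "\<And>t. t \<in> {a..b} \<Longrightarrow> (snd c \<circ> \<gamma> has_vector_derivative D t) (at t within {a..b})"
    "\<And>t. t \<in> {a<..<b} \<Longrightarrow> speed \<gamma> t = metric_norm G c (\<gamma> t) (D t)"
proof -
  have eq: "{t \<in> {a..b}. \<gamma> t \<in> fst c} = {a..b}" using im by auto
  obtain D where D: "continuous_on {a..b} D"
    "\<And>t. t \<in> {a..b} \<Longrightarrow> (snd c \<circ> \<gamma> has_vector_derivative D t) (at t within {a..b})"
    using C[unfolded C1_curve_on_def, THEN conjunct2, rule_format, OF c] im unfolding eq by blast
  moreover have "speed \<gamma> t = metric_norm G c (\<gamma> t) (D t)" if t: "t \<in> {a<..<b}" for t
  proof (rule speed_eq[OF c])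
    show "\<gamma> t \<in> fst c" using im t by simp
    show "isCont \<gamma> t" using C1_curve_on_interior[OF C t] by blast
    show "(snd c \<circ> \<gamma> has_vector_derivative D t) (at t)"
      using D(2)[of t] t at_within_Icc_at[of a t b] by simp
  qed
  ultimately show ?thesis using that by blast
qed

lemma speed_integrable_chart:
  assumes C: "C1_curve_on A a b \<gamma>" and c: "c \<in> A" and im: "\<And>t. t \<in> {a..b} \<Longrightarrow> \<gamma> t \<in> fst c"
  shows "speed \<gamma> integrable_on {a..b}"
proof -
  obtain D where D: "continuous_on {a..b} D"
    "\<And>t. t \<in> {a<..<b} \<Longrightarrow> speed \<gamma> t = metric_norm G c (\<gamma> t) (D t)"
    using C1_curve_on_chart_derivative[OF C c im] by metis
  have c\<gamma>: "continuous_on {a..b} \<gamma>" using C by (simp add: C1_curve_on_def)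
  have "continuous_on {a..b} (\<lambda>t. snd c (\<gamma> t))"
    by (rule continuous_on_compose2[OF continuous_on_chart[OF c] c\<gamma>]) (use im in auto)
  then have "continuous_on {a..b} (\<lambda>t. G c (chart_inv c (snd c (\<gamma> t))))"
    by (rule continuous_on_compose2[OF continuous_on_metric[OF c]]) (use im snd_in[of _ c] in auto)
  then have "continuous_on {a..b} (\<lambda>t. G c (\<gamma> t))"
    by (rule continuous_on_eq) (simp add: im chart_inv_snd[OF c])
  then have "continuous_on {a..b} (\<lambda>t. metric_norm G c (\<gamma> t) (D t))"
    unfolding metric_norm_def metric_inner_def matrix_vector_mult_def inner_vec_def
    by (auto intro!: continuous_intros D(1))
  then have "(\<lambda>t. metric_norm G c (\<gamma> t) (D t)) integrable_on {a..b}"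
    by (rule integrable_continuous_interval)
  then show ?thesis
    by (rule integrable_spike[of _ _ "{a, b}"]) (use D(2) in auto)
qed

text \<open>Arbitrary parameter intervals are allowed so that curves can be cut, shifted and joined
  before being rescaled to the unit interval.\<close>

definition pw_C1 :: "real \<Rightarrow> real \<Rightarrow> (real \<Rightarrow> 'a) \<Rightarrow> bool" where
  "pw_C1 a b \<gamma> \<longleftrightarrow> continuous_on {a..b} \<gamma> \<and>
     (\<exists>S. finite S \<and>
        (\<forall>a' b'. a \<le> a' \<and> a' < b' \<and> b' \<le> b \<and> {a'<..<b'} \<inter> S = {} \<longrightarrow> C1_curve_on A a' b' \<gamma>))"

lemma piecewise_C1_curve_iff: "piecewise_C1_curve A \<gamma> \<longleftrightarrow> pw_C1 0 1 \<gamma>"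
  by (simp add: piecewise_C1_curve_def pw_C1_def)

lemma pw_C1_subset:
  assumes "pw_C1 a b \<gamma>" "a \<le> a'" "b' \<le> b" shows "pw_C1 a' b' \<gamma>"
proof -
  have "continuous_on {a'..b'} \<gamma>"
    using assms by (auto simp: pw_C1_def intro: continuous_on_subset)
  moreover obtain S where "finite S"
    "\<And>u v. a \<le> u \<Longrightarrow> u < v \<Longrightarrow> v \<le> b \<Longrightarrow> {u<..<v} \<inter> S = {} \<Longrightarrow> C1_curve_on A u v \<gamma>"
    using assms(1) unfolding pw_C1_def by blast
  ultimately show ?thesis unfolding pw_C1_def using assms(2,3) by (meson order_trans)
qed

lemma finite_avoid_ball:
  fixes x :: real
  assumes "finite S" obtains d where "d > 0" "S \<inter> ball x d \<subseteq> {x}"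
proof -
  obtain d where "d > 0" "\<forall>y\<in>S. y \<noteq> x \<longrightarrow> d \<le> dist x y"
    using finite_set_avoid[OF assms, of x] by blast
  then show ?thesis using that[of d] by force
qed

text \<open>Integrability is local. Near each \<open>x\<close> the curve stays in one chart, and the
  only possible break point is \<open>x\<close> itself.\<close>

lemma pw_C1_integrable:
  assumes P: "pw_C1 a b \<gamma>" shows "speed \<gamma> integrable_on {a..b}"
proof -
  obtain S where S: "finite S"
    "\<And>u v. a \<le> u \<Longrightarrow> u < v \<Longrightarrow> v \<le> b \<Longrightarrow> {u<..<v} \<inter> S = {} \<Longrightarrow> C1_curve_on A u v \<gamma>"
    using P unfolding pw_C1_def by blast
  have cont: "continuous_on {a..b} \<gamma>" using P by (simp add: pw_C1_def)
  have "speed \<gamma> integrable_on cbox a b"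
  proof (rule integrable_on_little_subintervals, rule ballI)
    fix x assume x: "x \<in> cbox a b"
    obtain c where c: "c \<in> A" "\<gamma> x \<in> fst c" using ex_chart by blast
    obtain W where W: "open W" "W \<inter> {a..b} = \<gamma> -` fst c \<inter> {a..b}"
      using continuous_on_open_invariant[THEN iffD1, OF cont, rule_format, OF chart_open(1)[OF c(1)]] by blast
    moreover have "x \<in> \<gamma> -` fst c \<inter> {a..b}" using x c by simp
    ultimately have "x \<in> W" by blast
    then obtain d1 where d1: "d1 > 0" "ball x d1 \<subseteq> W" using W(1) open_contains_ball by blast
    obtain d2 where d2: "d2 > 0" "S \<inter> ball x d2 \<subseteq> {x}" using finite_avoid_ball[OF S(1)] by blast
    have "speed \<gamma> integrable_on cbox u v"
      if uv: "x \<in> cbox u v" "cbox u v \<subseteq> ball x (min d1 d2)" "cbox u v \<subseteq> cbox a b" for u v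
    proof -
      have le: "u \<le> x" "x \<le> v" using uv(1) by auto
      have sub: "{u..v} \<subseteq> ball x (min d1 d2)" "{u..v} \<subseteq> {a..b}" using uv by auto
      have im: "\<gamma> t \<in> fst c" if "t \<in> {u..v}" for t
      proof -
        have "t \<in> ball x (min d1 d2)" using sub(1) that by blast
        then have "t \<in> ball x d1" by simp
        then have "t \<in> W \<inter> {a..b}" using that sub(2) d1(2) by blast
        then show ?thesis unfolding W(2) by blast
      qed
      \<comment> \<open>One endpoint is \<open>x\<close>, so the open interval avoids every break
        point and the curve is C^1 on the piece.\<close>
      have piece: "speed \<gamma> integrable_on {u'..v'}" if "u \<le> u'" "v' \<le> v" "u' = x \<or> v' = x" for u' v'
      proof (cases "u' < v'")
        case True
        have "{u'<..<v'} \<inter> S = {}"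
        proof (rule ccontr)
          assume "{u'<..<v'} \<inter> S \<noteq> {}"
          then obtain s where s: "s \<in> S" "u' < s" "s < v'" by auto
          then have "s \<in> {u..v}" using that by auto
          then have "s \<in> ball x (min d1 d2)" using sub(1) by blast
          then have "s \<in> ball x d2" by simp
          then show False using s d2(2) that(3) by auto
        qed
        moreover have "a \<le> u'" "v' \<le> b" using that sub(2) le True by auto
        ultimately have "C1_curve_on A u' v' \<gamma>" using S(2) True by blast
        then show ?thesis by (rule speed_integrable_chart[OF _ c(1)]) (use im that in auto)
      next
        case False
        then show ?thesis using integrable_on_refl[of "speed \<gamma>" u'] by (cases "u' = v'") (auto simp: cbox_interval)
      qed
      show ?thesis
        using Henstock_Kurzweil_Integration.integrable_combine[OF le piece[of u x] piece[of x v]] le by simp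
    qed
    then show "\<exists>d>0. \<forall>u v. x \<in> cbox u v \<and> cbox u v \<subseteq> ball x d \<and> cbox u v \<subseteq> cbox a b \<longrightarrow>
        speed \<gamma> integrable_on cbox u v"
      using d1(1) d2(1) by (intro exI[of _ "min d1 d2"]) auto
  qed
  then show ?thesis by simp
qed

lemma pw_C1_interior:
  assumes P: "pw_C1 a b \<gamma>"
  obtains S where "finite S" "\<And>t. t \<in> {a<..<b} - S \<Longrightarrow>
    isCont \<gamma> t \<and> (\<exists>c v. c \<in> A \<and> \<gamma> t \<in> fst c \<and> (snd c \<circ> \<gamma> has_vector_derivative v) (at t))"
proof -
  obtain S where S: "finite S"
    "\<And>u v. a \<le> u \<Longrightarrow> u < v \<Longrightarrow> v \<le> b \<Longrightarrow> {u<..<v} \<inter> S = {} \<Longrightarrow> C1_curve_on A u v \<gamma>"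
    using P unfolding pw_C1_def by blast
  have "isCont \<gamma> t \<and> (\<exists>c v. c \<in> A \<and> \<gamma> t \<in> fst c \<and> (snd c \<circ> \<gamma> has_vector_derivative v) (at t))"
    if t: "t \<in> {a<..<b} - S" for t
  proof -
    have "open ({a<..<b} - S)" using S(1) by (simp add: finite_imp_closed open_Diff)
    then obtain d where d: "d > 0" "cball t d \<subseteq> {a<..<b} - S" using t open_contains_cball by blast
    then have sub: "{t - d..t + d} \<subseteq> {a<..<b} - S" by (simp add: cball_eq_atLeastAtMost)
    have "C1_curve_on A (t - d) (t + d) \<gamma>"
    proof (rule S(2))
      have "t - d \<in> {t - d..t + d}" "t + d \<in> {t - d..t + d}" using d(1) by auto
      then show "a \<le> t - d" "t + d \<le> b" using sub by fastforce+
      have "{t - d<..<t + d} \<subseteq> {t - d..t + d}" by auto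
      then show "{t - d<..<t + d} \<inter> S = {}" using sub by blast
    qed (use d in simp)
    moreover have "t \<in> {t - d<..<t + d}" using d(1) by simp
    ultimately obtain c v where "c \<in> A" "\<gamma> t \<in> fst c" "isCont \<gamma> t" "(snd c \<circ> \<gamma> has_vector_derivative v) (at t)"
      using C1_curve_on_interior by blast
    then show ?thesis by blast
  qed
  then show ?thesis using that S(1) by blast
qed

section \<open>Reparametrisation and concatenation of curves\<close>

lemma C1_curve_on_cong:
  assumes "C1_curve_on A a b \<gamma>" and eq: "\<And>t. t \<in> {a..b} \<Longrightarrow> \<gamma> t = \<gamma>' t"
  shows "C1_curve_on A a b \<gamma>'"
  unfolding C1_curve_on_def
proof (intro conjI ballI)
  show "continuous_on {a..b} \<gamma>'"
    using assms continuous_on_eq unfolding C1_curve_on_def by blast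
  fix c assume c: "c \<in> A"
  have set_eq: "{t \<in> {a..b}. \<gamma>' t \<in> fst c} = {t \<in> {a..b}. \<gamma> t \<in> fst c}" using eq by auto
  obtain D where D: "continuous_on {t \<in> {a..b}. \<gamma> t \<in> fst c} D"
    "\<And>t. t \<in> {a..b} \<Longrightarrow> \<gamma> t \<in> fst c \<Longrightarrow> (snd c \<circ> \<gamma> has_vector_derivative D t) (at t within {a..b})"
    using assms(1)[unfolded C1_curve_on_def, THEN conjunct2, rule_format, OF c] by blast
  have "(snd c \<circ> \<gamma>' has_vector_derivative D t) (at t within {a..b})" if "t \<in> {a..b}" "\<gamma>' t \<in> fst c" for t
    by (rule has_vector_derivative_transform[OF that(1) _ D(2)[OF that(1)]]) (use eq that in auto)
  then show "\<exists>D. continuous_on {t \<in> {a..b}. \<gamma>' t \<in> fst c} D \<and>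
      (\<forall>t\<in>{a..b}. \<gamma>' t \<in> fst c \<longrightarrow> (snd c \<circ> \<gamma>' has_vector_derivative D t) (at t within {a..b}))"
    unfolding set_eq using D(1) by blast
qed

lemma C1_curve_on_affine:
  assumes C: "C1_curve_on A a b \<gamma>" and h: "\<And>t. t \<in> {a'..b'} \<Longrightarrow> \<alpha> * t + \<beta> \<in> {a..b}"
  shows "C1_curve_on A a' b' (\<lambda>t. \<gamma> (\<alpha> * t + \<beta>))"
  unfolding C1_curve_on_def
proof (intro conjI ballI)
  have "continuous_on {a..b} \<gamma>" using C unfolding C1_curve_on_def by blast
  then show "continuous_on {a'..b'} (\<lambda>t. \<gamma> (\<alpha> * t + \<beta>))"
    by (rule continuous_on_compose2) (use h in \<open>auto intro!: continuous_intros\<close>)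
  fix c assume c: "c \<in> A"
  obtain D where D: "continuous_on {t \<in> {a..b}. \<gamma> t \<in> fst c} D"
    "\<And>t. t \<in> {a..b} \<Longrightarrow> \<gamma> t \<in> fst c \<Longrightarrow> (snd c \<circ> \<gamma> has_vector_derivative D t) (at t within {a..b})"
    using C[unfolded C1_curve_on_def, THEN conjunct2, rule_format, OF c] by blast
  have "continuous_on {t \<in> {a'..b'}. \<gamma> (\<alpha> * t + \<beta>) \<in> fst c} (\<lambda>t. \<alpha> *\<^sub>R D (\<alpha> * t + \<beta>))"
    by (intro continuous_intros continuous_on_compose2[OF D(1)]) (use h in auto)
  moreover have "(snd c \<circ> (\<lambda>t. \<gamma> (\<alpha> * t + \<beta>)) has_vector_derivative \<alpha> *\<^sub>R D (\<alpha> * t + \<beta>)) (at t within {a'..b'})"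
    if t: "t \<in> {a'..b'}" "\<gamma> (\<alpha> * t + \<beta>) \<in> fst c" for t
  proof -
    have 1: "((\<lambda>t. \<alpha> * t + \<beta>) has_vector_derivative \<alpha>) (at t within {a'..b'})"
      by (auto intro!: derivative_eq_intros)
    have 2: "(snd c \<circ> \<gamma> has_vector_derivative D (\<alpha> * t + \<beta>)) (at (\<alpha> * t + \<beta>) within (\<lambda>t. \<alpha> * t + \<beta>) ` {a'..b'})"
      by (rule has_vector_derivative_within_subset[OF D(2)]) (use h t in auto)
    show ?thesis using vector_diff_chain_within[OF 1 2] by (simp add: comp_def)
  qed
  ultimately show "\<exists>D. continuous_on {t \<in> {a'..b'}. \<gamma> (\<alpha> * t + \<beta>) \<in> fst c} D \<and>
      (\<forall>t\<in>{a'..b'}. \<gamma> (\<alpha> * t + \<beta>) \<in> fst c \<longrightarrow>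
         (snd c \<circ> (\<lambda>t. \<gamma> (\<alpha> * t + \<beta>)) has_vector_derivative D t) (at t within {a'..b'}))"
    by blast
qed

text \<open>The speed is multiplied by the absolute value of \<alpha>, which the substitution in the
  length integral divides out. Negative \<alpha> is included so that the same lemma also reverses
  curves.\<close>

lemma pw_C1_affine:
  assumes P: "pw_C1 a b \<gamma>" and \<alpha>: "\<alpha> \<noteq> 0" and h: "(\<lambda>t. \<alpha> * t + \<beta>) ` {a'..b'} = {a..b}"
  shows "pw_C1 a' b' (\<lambda>t. \<gamma> (\<alpha> * t + \<beta>))"
    and "integral {a'..b'} (speed (\<lambda>t. \<gamma> (\<alpha> * t + \<beta>))) = integral {a..b} (speed \<gamma>)"
proof -
  let ?h = "\<lambda>t. \<alpha> * t + \<beta>"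
  have hin: "?h t \<in> {a..b}" if "t \<in> {a'..b'}" for t using h that by blast
  obtain S where S: "finite S"
    "\<And>u v. a \<le> u \<Longrightarrow> u < v \<Longrightarrow> v \<le> b \<Longrightarrow> {u<..<v} \<inter> S = {} \<Longrightarrow> C1_curve_on A u v \<gamma>"
    using P unfolding pw_C1_def by blast
  let ?S = "(\<lambda>s. (s - \<beta>) / \<alpha>) ` S"
  have "C1_curve_on A u v (\<lambda>t. \<gamma> (?h t))" if uv: "a' \<le> u" "u < v" "v \<le> b'" "{u<..<v} \<inter> ?S = {}" for u v
  proof (rule C1_curve_on_affine)
    \<comment> \<open>The affine map may reverse orientation, so the images of the endpoints have to
      be sorted.\<close>
    define lo hi where "lo = min (?h u) (?h v)" and "hi = max (?h u) (?h v)"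
    have ne: "?h u \<noteq> ?h v" using uv \<alpha> by simp
    show "C1_curve_on A lo hi \<gamma>"
    proof (rule S(2))
      show "a \<le> lo" "hi \<le> b" using hin[of u] hin[of v] uv by (auto simp: lo_def hi_def)
      show "lo < hi" using ne unfolding lo_def hi_def by linarith
      have "s \<notin> S" if s: "s \<in> {lo<..<hi}" for s
      proof
        assume "s \<in> S"
        moreover have "(s - \<beta>) / \<alpha> \<in> {u<..<v}"
          using s \<alpha> uv(2) by (cases "\<alpha> > 0")
            (auto simp: lo_def hi_def field_simps min_def max_def mult_less_cancel_left split: if_splits)
        ultimately show False using uv(4) by blast
      qed
      then show "{lo<..<hi} \<inter> S = {}" by blast
    qed
    show "?h t \<in> {lo..hi}" if "t \<in> {u..v}" for t
      using that \<alpha> by (cases "\<alpha> > 0") (auto simp: lo_def hi_def min_le_iff_disj le_max_iff_disj)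
  qed
  moreover have "continuous_on {a..b} \<gamma>" using P unfolding pw_C1_def by blast
  then have "continuous_on {a'..b'} (\<lambda>t. \<gamma> (?h t))"
    by (rule continuous_on_compose2) (use hin in \<open>auto intro!: continuous_intros\<close>)
  ultimately show pw: "pw_C1 a' b' (\<lambda>t. \<gamma> (?h t))"
    unfolding pw_C1_def using S(1) by (intro conjI exI[of _ ?S]) auto
  obtain Z where Z: "finite Z" "\<And>t. t \<in> {a<..<b} - Z \<Longrightarrow>
    isCont \<gamma> t \<and> (\<exists>c v. c \<in> A \<and> \<gamma> t \<in> fst c \<and> (snd c \<circ> \<gamma> has_vector_derivative v) (at t))"
    using pw_C1_interior[OF P] by blast
  have sp: "speed (\<lambda>t. \<gamma> (?h t)) t = \<bar>\<alpha>\<bar> * speed \<gamma> (?h t)" if t: "?h t \<in> {a<..<b} - Z" for t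
  proof -
    obtain c v where c: "c \<in> A" "\<gamma> (?h t) \<in> fst c" "(snd c \<circ> \<gamma> has_vector_derivative v) (at (?h t))"
      and cont: "isCont \<gamma> (?h t)" using Z(2)[OF t] by blast
    have 1: "(?h has_vector_derivative \<alpha>) (at t)" by (auto intro!: derivative_eq_intros)
    have "(snd c \<circ> \<gamma> \<circ> ?h has_vector_derivative \<alpha> *\<^sub>R v) (at t)"
      using vector_diff_chain_within[OF 1, of "snd c \<circ> \<gamma>" v] c(3) has_vector_derivative_at_within by blast
    moreover have "isCont (\<lambda>t. \<gamma> (?h t)) t"
      using isCont_o2[where f="?h" and g=\<gamma> and a=t] cont by (auto intro!: continuous_intros)
    ultimately have "speed (\<lambda>t. \<gamma> (?h t)) t = metric_norm G c (\<gamma> (?h t)) (\<alpha> *\<^sub>R v)"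
      by (intro speed_eq[OF c(1)]) (auto simp: comp_def c(2))
    then show ?thesis using speed_eq[OF c(1,2) cont c(3)] by (simp add: metric_norm_scaleR)
  qed
  have I: "(speed \<gamma> has_integral integral {a..b} (speed \<gamma>)) (cbox a b)"
    using pw_C1_integrable[OF P] integrable_integral by simp
  have img: "(\<lambda>x. (1 / \<alpha>) *\<^sub>R x + - ((1 / \<alpha>) *\<^sub>R \<beta>)) ` cbox a b = {a'..b'}"
  proof -
    have "(\<lambda>x. (1 / \<alpha>) *\<^sub>R x + - ((1 / \<alpha>) *\<^sub>R \<beta>)) ` ?h ` {a'..b'} = (\<lambda>x. x) ` {a'..b'}"
      unfolding image_image by (rule image_cong) (use \<alpha> in \<open>auto simp: field_simps\<close>)
    then show ?thesis using h by simp
  qed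
  have "((\<lambda>t. speed \<gamma> (\<alpha> *\<^sub>R t + \<beta>)) has_integral (1 / \<bar>\<alpha>\<bar> ^ DIM(real)) *\<^sub>R integral {a..b} (speed \<gamma>)) {a'..b'}"
    using has_integral_affinity[OF I \<alpha>, of \<beta>] unfolding img .
  from has_integral_mult_right[OF this, of "\<bar>\<alpha>\<bar>"]
  have "((\<lambda>t. \<bar>\<alpha>\<bar> * speed \<gamma> (?h t)) has_integral integral {a..b} (speed \<gamma>)) {a'..b'}"
    using \<alpha> by simp
  \<comment> \<open>The speed formula fails only at preimages of break points and endpoints, a
    finite and hence negligible set.\<close>
  moreover have "finite ((\<lambda>s. (s - \<beta>) / \<alpha>) ` (Z \<union> {a, b}))" using Z(1) by simp
  then have "negligible ((\<lambda>s. (s - \<beta>) / \<alpha>) ` (Z \<union> {a, b}))" by (rule negligible_finite)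
  ultimately have "(speed (\<lambda>t. \<gamma> (?h t)) has_integral integral {a..b} (speed \<gamma>)) {a'..b'}"
  proof (rule has_integral_spike[rotated 2])
    fix t assume t: "t \<in> {a'..b'} - (\<lambda>s. (s - \<beta>) / \<alpha>) ` (Z \<union> {a, b})"
    have "?h t \<notin> Z \<union> {a, b}"
    proof
      assume "?h t \<in> Z \<union> {a, b}"
      then have "(?h t - \<beta>) / \<alpha> \<in> (\<lambda>s. (s - \<beta>) / \<alpha>) ` (Z \<union> {a, b})" by (rule imageI)
      then show False using t \<alpha> by simp
    qed
    then have "?h t \<in> {a<..<b} - Z" using hin[of t] t by auto
    then show "speed (\<lambda>t. \<gamma> (?h t)) t = \<bar>\<alpha>\<bar> * speed \<gamma> (?h t)" by (rule sp)
  qed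
  then show "integral {a'..b'} (speed (\<lambda>t. \<gamma> (?h t))) = integral {a..b} (speed \<gamma>)"
    by (rule integral_unique)
qed

lemma pw_C1_cong:
  assumes "pw_C1 a b \<gamma>" "\<And>t. t \<in> {a..b} \<Longrightarrow> \<gamma> t = \<gamma>' t"
  shows "pw_C1 a b \<gamma>'" "integral {a..b} (speed \<gamma>') = integral {a..b} (speed \<gamma>)"
proof -
  obtain S where S: "finite S"
    "\<And>u v. a \<le> u \<Longrightarrow> u < v \<Longrightarrow> v \<le> b \<Longrightarrow> {u<..<v} \<inter> S = {} \<Longrightarrow> C1_curve_on A u v \<gamma>"
    using assms unfolding pw_C1_def by blast
  have "C1_curve_on A u v \<gamma>'" if "a \<le> u" "u < v" "v \<le> b" "{u<..<v} \<inter> S = {}" for u v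
    by (rule C1_curve_on_cong[OF S(2)[OF that]]) (use assms that in auto)
  moreover have "continuous_on {a..b} \<gamma>'"
    using assms continuous_on_eq unfolding pw_C1_def by blast
  ultimately show "pw_C1 a b \<gamma>'" unfolding pw_C1_def using S(1) by blast
  have sp: "speed \<gamma>' t = speed \<gamma> t" if "t \<in> {a..b} - {a, b}" for t
    by (rule speed_cong_open[of "{a<..<b}"]) (use that assms in auto)
  show "integral {a..b} (speed \<gamma>') = integral {a..b} (speed \<gamma>)"
    by (rule integral_spike[of "{a, b}"]) (use sp in auto)
qed

lemma pw_C1_join:
  assumes 1: "pw_C1 a m \<gamma>1" and 2: "pw_C1 m b \<gamma>2" and eq: "\<gamma>1 m = \<gamma>2 m" and le: "a \<le> m" "m \<le> b"
  defines "\<gamma> \<equiv> \<lambda>t. if t \<le> m then \<gamma>1 t else \<gamma>2 t"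
  shows "pw_C1 a b \<gamma>" "integral {a..b} (speed \<gamma>) = integral {a..m} (speed \<gamma>1) + integral {m..b} (speed \<gamma>2)"
proof -
  have left: "pw_C1 a m \<gamma>" "integral {a..m} (speed \<gamma>) = integral {a..m} (speed \<gamma>1)"
    using pw_C1_cong[OF 1, of \<gamma>] by (auto simp: \<gamma>_def)
  have right: "pw_C1 m b \<gamma>" "integral {m..b} (speed \<gamma>) = integral {m..b} (speed \<gamma>2)"
  proof -
    have "\<gamma>2 t = \<gamma> t" if "t \<in> {m..b}" for t
      using that eq by (cases "t = m") (auto simp: \<gamma>_def)
    then show "pw_C1 m b \<gamma>" "integral {m..b} (speed \<gamma>) = integral {m..b} (speed \<gamma>2)"
      using pw_C1_cong[OF 2, of \<gamma>] by blast+
  qed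
  obtain S1 where S1: "finite S1"
    "\<And>u v. a \<le> u \<Longrightarrow> u < v \<Longrightarrow> v \<le> m \<Longrightarrow> {u<..<v} \<inter> S1 = {} \<Longrightarrow> C1_curve_on A u v \<gamma>"
    using left unfolding pw_C1_def by blast
  obtain S2 where S2: "finite S2"
    "\<And>u v. m \<le> u \<Longrightarrow> u < v \<Longrightarrow> v \<le> b \<Longrightarrow> {u<..<v} \<inter> S2 = {} \<Longrightarrow> C1_curve_on A u v \<gamma>"
    using right unfolding pw_C1_def by blast
  have "C1_curve_on A u v \<gamma>" if uv: "a \<le> u" "u < v" "v \<le> b" "{u<..<v} \<inter> (insert m (S1 \<union> S2)) = {}" for u v
  proof -
    have "v \<le> m \<or> m \<le> u" using uv by auto
    then show ?thesis using S1(2)[of u v] S2(2)[of u v] uv by auto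
  qed
  moreover have "{a..m} \<union> {m..b} = {a..b}" using le by auto
  then have "continuous_on {a..b} \<gamma>"
    using continuous_on_closed_Un[of "{a..m}" "{m..b}" \<gamma>] left right unfolding pw_C1_def by auto
  ultimately show pw: "pw_C1 a b \<gamma>"
    \<comment> \<open>The junction \<open>m\<close> is added to the break points, so that every
      remaining interval lies on one side of it.\<close>
    unfolding pw_C1_def using S1(1) S2(1) by (intro conjI exI[of _ "insert m (S1 \<union> S2)"]) auto
  show "integral {a..b} (speed \<gamma>) = integral {a..m} (speed \<gamma>1) + integral {m..b} (speed \<gamma>2)"
    using Henstock_Kurzweil_Integration.integral_combine[OF le pw_C1_integrable[OF pw]] left right by simp
qed

end

section \<open>The Riemannian distance\<close>

context riemannian_manifold
begin

definition curves_between :: "'a \<Rightarrow> 'a \<Rightarrow> (real \<Rightarrow> 'a) set" where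
  "curves_between x y = {\<gamma>. pw_C1 0 1 \<gamma> \<and> \<gamma> 0 = x \<and> \<gamma> 1 = y}"

lemma rdist_eq: "rdist x y = (INF \<gamma>\<in>curves_between x y. integral {0..1} (speed \<gamma>))"
  unfolding riem_dist_def curves_between_def piecewise_C1_curve_iff curve_length_def
  by (simp add: image_def Collect_ex_eq[symmetric]) (rule arg_cong[where f=Inf], auto)

lemma length_nonneg: "integral {a..b} (speed \<gamma>) \<ge> 0"
  by (cases "speed \<gamma> integrable_on {a..b}")
    (auto simp: not_integrable_integral intro!: Henstock_Kurzweil_Integration.integral_nonneg speed_nonneg)

lemma pw_C1_normalize:
  assumes "pw_C1 a b \<gamma>" "a < b"
  obtains \<gamma>' where "\<gamma>' \<in> curves_between (\<gamma> a) (\<gamma> b)" "integral {0..1} (speed \<gamma>') = integral {a..b} (speed \<gamma>)"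
proof -
  have "(\<lambda>t. (b - a) * t + a) ` {0..1} = {a..b}"
    using assms(2) by (simp add: image_affinity_atLeastAtMost)
  from pw_C1_affine[OF assms(1) _ this] show ?thesis
    using that[of "\<lambda>t. \<gamma> ((b - a) * t + a)"] assms(2) by (simp add: curves_between_def)
qed

text \<open>A nondegenerate interval is rescaled to the unit interval; for \<open>a = b\<close> no
  rescaling exists, and a constant curve of length 0 is used instead.\<close>

lemma rdist_le_length:
  assumes "pw_C1 a b \<gamma>" "a \<le> b" "curves_between (\<gamma> a) (\<gamma> b) \<noteq> {}"
  shows "rdist (\<gamma> a) (\<gamma> b) \<le> integral {a..b} (speed \<gamma>)"
proof -
  have bdd: "bdd_below ((\<lambda>\<gamma>. integral {0..1} (speed \<gamma>)) ` curves_between x y)" for x y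
    by (rule bdd_belowI[of _ 0]) (auto simp: length_nonneg)
  show ?thesis
  proof (cases "a < b")
    case True
    obtain \<gamma>' where "\<gamma>' \<in> curves_between (\<gamma> a) (\<gamma> b)" "integral {0..1} (speed \<gamma>') = integral {a..b} (speed \<gamma>)"
      using pw_C1_normalize[OF assms(1) True] by blast
    then show ?thesis unfolding rdist_eq using cINF_lower[OF bdd] by metis
  next
    case False
    then have ab: "a = b" using assms(2) by simp
    have "pw_C1 0 1 (\<lambda>t. \<gamma> a)"
      unfolding pw_C1_def
    proof (intro conjI exI[of _ "{}"] allI impI)
      fix u v :: real
      obtain c where c: "c \<in> A" "\<gamma> a \<in> fst c" using ex_chart by blast
      show "C1_curve_on A u v (\<lambda>t. \<gamma> a)"
        by (rule C1_curve_onI_chart[OF c(1), where D="\<lambda>_. 0"]) (use c in \<open>auto simp: comp_def\<close>)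
    qed auto
    then have mem: "(\<lambda>t. \<gamma> a) \<in> curves_between (\<gamma> a) (\<gamma> b)" by (simp add: curves_between_def ab)
    have "speed (\<lambda>t. \<gamma> a) t = 0" for t
      unfolding curve_speed_def Let_def using metric_norm_eq_0[OF chart_at] by (simp add: comp_def)
    then have "speed (\<lambda>t. \<gamma> a) = (\<lambda>_. 0)" by (rule ext)
    then have "integral {0..1} (speed (\<lambda>t. \<gamma> a)) = 0" by simp
    then have "rdist (\<gamma> a) (\<gamma> b) \<le> 0" unfolding rdist_eq using cINF_lower[OF bdd mem] by simp
    then show ?thesis using length_nonneg[of a b \<gamma>] by simp
  qed
qed

lemma pw_C1_segment:
  assumes c: "c \<in> A" and seg: "closed_segment x y \<subseteq> chart_image c"
  defines "\<gamma> \<equiv> \<lambda>t. chart_inv c (x + t *\<^sub>R (y - x))"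
  shows "\<gamma> \<in> curves_between (chart_inv c x) (chart_inv c y)"
    "\<And>t. t \<in> {0<..<1} \<Longrightarrow> speed \<gamma> t = metric_norm G c (\<gamma> t) (y - x)"
proof -
  have im: "x + t *\<^sub>R (y - x) \<in> chart_image c" if "t \<in> {0..1}" for t
  proof -
    have "x + t *\<^sub>R (y - x) = (1 - t) *\<^sub>R x + t *\<^sub>R y" by (simp add: algebra_simps)
    then show ?thesis using seg that by (force simp: closed_segment_def)
  qed
  have mem: "\<gamma> t \<in> fst c" if "t \<in> {0..1}" for t unfolding \<gamma>_def using chart_inv_in[OF c im[OF that]] .
  have D: "(snd c \<circ> \<gamma> has_vector_derivative y - x) (at t within {u..v})" if "t \<in> {u..v}" "0 \<le> u" "v \<le> 1" for t u v
  proof (rule has_vector_derivative_transform[OF that(1)])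
    show "((\<lambda>t. x + t *\<^sub>R (y - x)) has_vector_derivative y - x) (at t within {u..v})"
      by (auto intro!: derivative_eq_intros simp: has_vector_derivative_def)
    show "(snd c \<circ> \<gamma>) s = x + s *\<^sub>R (y - x)" if "s \<in> {u..v}" for s
      using snd_chart_inv[OF c im[of s]] that \<open>0 \<le> u\<close> \<open>v \<le> 1\<close> by (simp add: \<gamma>_def)
  qed
  have C1: "C1_curve_on A u v \<gamma>" if "0 \<le> u" "v \<le> 1" for u v
    by (rule C1_curve_onI_chart[OF c, where D="\<lambda>_. y - x"]) (use mem D that in auto)
  then have "pw_C1 0 1 \<gamma>"
    unfolding pw_C1_def using C1[of 0 1] by (intro conjI exI[of _ "{}"]) (auto simp: C1_curve_on_def[of A 0 1])
  then show "\<gamma> \<in> curves_between (chart_inv c x) (chart_inv c y)" by (simp add: curves_between_def \<gamma>_def)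
  fix t :: real assume t: "t \<in> {0<..<1}"
  have "(snd c \<circ> \<gamma> has_vector_derivative y - x) (at t)"
    using D[of t 0 1] t at_within_Icc_at[of 0 t 1] by simp
  moreover have "isCont \<gamma> t" using C1_curve_on_interior[OF C1[of 0 1] t] by blast
  ultimately show "speed \<gamma> t = metric_norm G c (\<gamma> t) (y - x)"
    using speed_eq[OF c mem] t by simp
qed

lemma curves_between_sym:
  assumes "\<gamma> \<in> curves_between x y"
  obtains \<gamma>' where "\<gamma>' \<in> curves_between y x" "integral {0..1} (speed \<gamma>') = integral {0..1} (speed \<gamma>)"
proof -
  have img: "(\<lambda>t. - 1 * t + 1) ` {0..1} = {0..1::real}"
    by (simp add: image_affinity_atLeastAtMost)
  have P: "pw_C1 0 1 \<gamma>" using assms by (simp add: curves_between_def)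
  show ?thesis
    using that[of "\<lambda>t. \<gamma> (- 1 * t + 1)"] pw_C1_affine[OF P _ img] assms by (simp add: curves_between_def)
qed

text \<open>The second curve is shifted to [1, 2], joined to the first, and the result on [0, 2]
  rescaled.\<close>

lemma curves_between_trans:
  assumes "\<gamma>1 \<in> curves_between x y" "\<gamma>2 \<in> curves_between y z"
  obtains \<gamma> where "\<gamma> \<in> curves_between x z"
    "integral {0..1} (speed \<gamma>) = integral {0..1} (speed \<gamma>1) + integral {0..1} (speed \<gamma>2)"
proof -
  have img: "(\<lambda>t. 1 * t + - 1) ` {1..2} = {0..1::real}"
    by (simp add: image_affinity_atLeastAtMost)
  have P: "pw_C1 0 1 \<gamma>1" "pw_C1 0 1 \<gamma>2" using assms by (simp_all add: curves_between_def)
  note aff = pw_C1_affine[OF P(2) _ img]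
  have eq: "\<gamma>1 1 = (\<lambda>t. \<gamma>2 (1 * t + - 1)) 1" using assms by (simp add: curves_between_def)
  note j = pw_C1_join[OF P(1) aff(1) eq]
  have "pw_C1 0 2 (\<lambda>t. if t \<le> 1 then \<gamma>1 t else \<gamma>2 (1 * t + - 1))" using j(1) by simp
  from pw_C1_normalize[OF this]
  show ?thesis using that j(2) aff(2) assms by (auto simp: curves_between_def)
qed

lemma ball_preimage:
  assumes c: "c \<in> A" and r: "cball x r \<subseteq> chart_image c"
  shows "open (chart_inv c ` ball x r)" "compact (chart_inv c ` cball x r)"
    "chart_inv c ` ball x r = {p \<in> fst c. snd c p \<in> ball x r}"
proof -
  show eq: "chart_inv c ` ball x r = {p \<in> fst c. snd c p \<in> ball x r}"
  proof (intro set_eqI iffI)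
    fix p assume "p \<in> chart_inv c ` ball x r"
    then obtain y where "y \<in> ball x r" "p = chart_inv c y" by blast
    moreover from this have "y \<in> chart_image c" using r by auto
    ultimately show "p \<in> {p \<in> fst c. snd c p \<in> ball x r}"
      using chart_inv_in[OF c] snd_chart_inv[OF c] by simp
  next
    fix p assume "p \<in> {p \<in> fst c. snd c p \<in> ball x r}"
    then show "p \<in> chart_inv c ` ball x r"
      using chart_inv_snd[OF c, of p] by (intro image_eqI[of _ _ "snd c p"]) auto
  qed
  have "{p \<in> fst c. snd c p \<in> ball x r} = fst c \<inter> snd c -` ball x r" by auto
  then show "open (chart_inv c ` ball x r)"
    unfolding eq using continuous_open_preimage[OF continuous_on_chart[OF c] chart_open(1)[OF c]] by simp
  show "compact (chart_inv c ` cball x r)"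
    by (rule compact_continuous_image[OF continuous_on_subset[OF continuous_on_chart_inv[OF c] r] compact_cball])
qed

text \<open>Up to its first exit from the coordinate ball the curve covers Euclidean distance at
  least \<open>r\<close> in the chart, while the Euclidean speed is at most the Riemannian speed
  divided by \<open>a\<close>.\<close>

lemma exit_length:
  assumes c: "c \<in> A" and r: "cball x r \<subseteq> chart_image c" "r > 0"
    and a: "a > 0" "\<And>y v. y \<in> cball x r \<Longrightarrow> a * norm v \<le> metric_norm G c (chart_inv c y) v"
    and \<gamma>: "\<gamma> \<in> curves_between (chart_inv c x) q" and q: "q \<notin> chart_inv c ` ball x r"
  shows "a * r \<le> integral {0..1} (speed \<gamma>)"
proof -
  let ?V = "chart_inv c ` ball x r" and ?K = "chart_inv c ` cball x r"
  note bp = ball_preimage[OF c r(1)]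
  have P: "pw_C1 0 1 \<gamma>" and g0: "\<gamma> 0 = chart_inv c x" and g1: "\<gamma> 1 = q" using \<gamma> by (auto simp: curves_between_def)
  have cont: "continuous_on {0..1} \<gamma>" using P by (simp add: pw_C1_def)
  define U where "U = {t \<in> {0..1}. \<gamma> t \<in> - ?V}"
  have "closed ({0..1} \<inter> \<gamma> -` (- ?V))"
    using continuous_closed_preimage[OF cont closed_atLeastAtMost closed_Compl[OF bp(1)]] .
  moreover have "U = {0..1} \<inter> \<gamma> -` (- ?V)" unfolding U_def by blast
  ultimately have U: "closed U" by metis
  have U1: "1 \<in> U" using q g1 by (simp add: U_def)
  have Ubdd: "bdd_below U" by (rule bdd_belowI[of _ 0]) (auto simp: U_def)
  \<comment> \<open>The first exit time; it is attained because the complement of the open ball is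
    closed.\<close>
  define \<tau> where "\<tau> = Inf U"
  have \<tau>U: "\<tau> \<in> U" unfolding \<tau>_def using closed_contains_Inf[OF _ Ubdd U] U1 by blast
  have "chart_inv c x \<in> ?V" using r by simp
  then have "0 \<notin> U" using g0 by (simp add: U_def)
  then have \<tau>: "0 < \<tau>" "\<tau> \<le> 1" "\<gamma> \<tau> \<notin> ?V" using \<tau>U by (auto simp: U_def less_le)
  have before: "\<gamma> s \<in> ?V" if "0 \<le> s" "s < \<tau>" for s
  proof (rule ccontr)
    assume "\<gamma> s \<notin> ?V"
    then have "s \<in> U" using that \<tau> by (simp add: U_def)
    then have "\<tau> \<le> s" unfolding \<tau>_def using cInf_lower Ubdd by blast
    then show False using that by simp
  qed
  have c\<tau>: "continuous_on {0..\<tau>} \<gamma>" by (rule continuous_on_subset[OF cont]) (use \<tau> in auto)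
  have clK: "closed ?K" using bp(2) compact_imp_closed by blast
  have cl: "closure {0..<\<tau>} = {0..\<tau>}" using \<tau>(1) by simp
  have "\<gamma> ` closure {0..<\<tau>} \<subseteq> closure (\<gamma> ` {0..<\<tau>})"
    by (rule image_closure_subset) (simp_all add: cl c\<tau> closure_subset)
  then have "\<gamma> ` {0..\<tau>} \<subseteq> closure (\<gamma> ` {0..<\<tau>})" unfolding cl .
  also have "\<dots> \<subseteq> ?K"
    by (rule closure_minimal[OF _ clK]) (use before in \<open>fastforce\<close>)
  \<comment> \<open>At the exit time the curve has left the open ball, but continuity keeps it in
    the compact closed one, hence still inside the chart.\<close>
  finally have inK: "\<gamma> s \<in> ?K" if "s \<in> {0..\<tau>}" for s using that by blast
  define f where "f = snd c \<circ> \<gamma>"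
  have fK: "f s \<in> cball x r \<and> \<gamma> s = chart_inv c (f s) \<and> \<gamma> s \<in> fst c" if s: "s \<in> {0..\<tau>}" for s
  proof -
    obtain y where "y \<in> cball x r" "\<gamma> s = chart_inv c y" using inK[OF s] by blast
    moreover from this have "y \<in> chart_image c" using r by auto
    ultimately show ?thesis using chart_inv_in[OF c] snd_chart_inv[OF c] by (simp add: f_def)
  qed
  have cf: "continuous_on {0..\<tau>} f"
    unfolding f_def comp_def
    by (rule continuous_on_compose2[OF continuous_on_chart[OF c] c\<tau>]) (use fK in blast)
  have "\<gamma> \<tau> = chart_inv c (f \<tau>)" using fK[of \<tau>] \<tau> by simp
  then have "f \<tau> \<notin> ball x r" using \<tau>(3) by blast
  then have far: "r \<le> norm (f \<tau> - f 0)"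
    using g0 snd_chart_inv[OF c, of x] r by (auto simp: f_def dist_norm norm_minus_commute not_less subset_iff)
  obtain Z where Z: "finite Z" "\<And>t. t \<in> {0<..<1} - Z \<Longrightarrow>
    isCont \<gamma> t \<and> (\<exists>c v. c \<in> A \<and> \<gamma> t \<in> fst c \<and> (snd c \<circ> \<gamma> has_vector_derivative v) (at t))"
    using pw_C1_interior[OF P] by blast
  \<comment> \<open>The value 0 at exceptional parameters makes the bound by the speed hold at every
    point of the interval and leaves the integral unchanged.\<close>
  define f' where "f' t = (if t \<in> {0<..<\<tau>} - Z then vector_derivative f (at t) else 0)" for t
  have good: "(f has_vector_derivative f' t) (at t) \<and> speed \<gamma> t = metric_norm G c (\<gamma> t) (f' t)"
    if t: "t \<in> {0<..<\<tau>} - Z" for t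
  proof -
    have t1: "t \<in> {0<..<1} - Z" using t \<tau> by auto
    obtain c' v where c': "c' \<in> A" "\<gamma> t \<in> fst c'" "(snd c' \<circ> \<gamma> has_vector_derivative v) (at t)" and cont: "isCont \<gamma> t"
      using Z(2)[OF t1] by blast
    have "\<gamma> t \<in> fst c" using fK[of t] t by auto
    then have d: "(f has_vector_derivative chart_diff c' c (\<gamma> t) v) (at t)"
      unfolding f_def using curve_derivative_change[OF c'(1) c c'(2) _ cont c'(3)] by blast
    then have "f' t = chart_diff c' c (\<gamma> t) v" using t by (simp add: f'_def vector_derivative_at)
    then show ?thesis using d speed_eq[OF c \<open>\<gamma> t \<in> fst c\<close> cont] unfolding f_def by metis
  qed
  have I: "(f' has_integral (f \<tau> - f 0)) {0..\<tau>}"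
    by (rule fundamental_theorem_of_calculus_interior_strong[OF Z(1)]) (use \<tau> good cf in auto)
  have P\<tau>: "pw_C1 0 \<tau> \<gamma>" by (rule pw_C1_subset[OF P]) (use \<tau> in auto)
  have bound: "norm (f' t) \<le> speed \<gamma> t / a" if "t \<in> {0..\<tau>}" for t
  proof (cases "t \<in> {0<..<\<tau>} - Z")
    case True
    have "a * norm (f' t) \<le> metric_norm G c (chart_inv c (f t)) (f' t)" using a(2) fK[OF that] by blast
    also have "\<dots> = speed \<gamma> t" using good[OF True] fK[OF that] by simp
    finally show ?thesis using a(1) by (simp add: field_simps)
  next
    case False
    then show ?thesis using a(1) speed_nonneg[of \<gamma> t] unfolding f'_def by (simp only: if_False norm_zero) simp
  qed
  have int\<tau>: "(\<lambda>t. speed \<gamma> t / a) integrable_on {0..\<tau>}"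
    using pw_C1_integrable[OF P\<tau>] by (simp add: divide_inverse integrable_on_mult_left)
  have "norm (f \<tau> - f 0) \<le> integral {0..\<tau>} (\<lambda>t. speed \<gamma> t / a)"
    using Henstock_Kurzweil_Integration.integral_norm_bound_integral[OF has_integral_integrable[OF I] int\<tau> bound]
      integral_unique[OF I] by simp
  also have "\<dots> = integral {0..\<tau>} (speed \<gamma>) / a" by simp
  also have "integral {0..\<tau>} (speed \<gamma>) \<le> integral {0..1} (speed \<gamma>)"
    by (rule integral_subset_le) (use \<tau> pw_C1_integrable P P\<tau> speed_nonneg in auto)
  finally have "a * norm (f \<tau> - f 0) \<le> integral {0..1} (speed \<gamma>)"
    using a(1) by (simp add: field_simps)
  then show ?thesis using mult_left_mono[OF far, of a] a(1) by linarith
qed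

end

section \<open>The metric space of a connected Riemannian manifold\<close>

locale connected_riemannian_manifold = riemannian_manifold A G
  for A :: "('a::{t2_space, second_countable_topology}, 'n::finite) chart set"
    and G :: "('a, 'n) chart \<Rightarrow> 'a \<Rightarrow> real^'n^'n" +
  assumes connected_UNIV: "connected (UNIV :: 'a set)"
begin

text \<open>Being joined by a curve is an equivalence relation whose classes contain coordinate
  balls around their points, so connectedness leaves one class.\<close>

lemma curves_between_nonempty: "curves_between x y \<noteq> {}"
proof (rule connected_equivalence_relation[OF connected_UNIV, of x y "\<lambda>x y. curves_between x y \<noteq> {}"])
  show "curves_between y x \<noteq> {}" if "curves_between x y \<noteq> {}" for x y
    using that curves_between_sym by blast
  show "curves_between x z \<noteq> {}" if "curves_between x y \<noteq> {}" "curves_between y z \<noteq> {}" for x y z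
    using that curves_between_trans by blast
  fix p :: 'a
  obtain c where c: "c \<in> A" "p \<in> fst c" using ex_chart by blast
  obtain r where r: "r > 0" "cball (snd c p) r \<subseteq> chart_image c"
    using chart_open(2)[OF c(1)] snd_in[OF c(2)] open_contains_cball by blast
  have "curves_between p q \<noteq> {}" if q: "q \<in> chart_inv c ` ball (snd c p) r" for q
  proof -
    obtain y where y: "y \<in> ball (snd c p) r" "q = chart_inv c y" using q by blast
    have "closed_segment (snd c p) y \<subseteq> cball (snd c p) r"
      by (rule closed_segment_subset) (use y r in auto)
    from pw_C1_segment(1)[OF c(1) order_trans[OF this r(2)]]
    show ?thesis using y c by (auto simp: chart_inv_snd)
  qed
  moreover have "p \<in> chart_inv c ` ball (snd c p) r"
    using r c by (intro image_eqI[of _ _ "snd c p"]) (auto simp: chart_inv_snd)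
  ultimately show "\<exists>T. openin (top_of_set UNIV) T \<and> p \<in> T \<and> (\<forall>q\<in>T. curves_between p q \<noteq> {})"
    using ball_preimage(1)[OF c(1) r(2)] by (intro exI[of _ "chart_inv c ` ball (snd c p) r"]) auto
qed auto

lemma rdist_le: "pw_C1 a b \<gamma> \<Longrightarrow> a \<le> b \<Longrightarrow> rdist (\<gamma> a) (\<gamma> b) \<le> integral {a..b} (speed \<gamma>)"
  by (rule rdist_le_length[OF _ _ curves_between_nonempty])

lemma rdist_le_curve: "\<gamma> \<in> curves_between x y \<Longrightarrow> rdist x y \<le> integral {0..1} (speed \<gamma>)"
  using rdist_le[of 0 1 \<gamma>] by (auto simp: curves_between_def)

lemma rdist_approx:
  assumes "rdist x y < d" obtains \<gamma> where "\<gamma> \<in> curves_between x y" "integral {0..1} (speed \<gamma>) < d"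
proof -
  have ne: "(\<lambda>\<gamma>. integral {0..1} (speed \<gamma>)) ` curves_between x y \<noteq> {}" using curves_between_nonempty by simp
  show ?thesis using cInf_lessD[OF ne assms[unfolded rdist_eq]] that by auto
qed

lemma rdist_nonneg: "rdist x y \<ge> 0"
  unfolding rdist_eq by (rule cINF_greatest[OF curves_between_nonempty]) (rule length_nonneg)

lemma rdist_commute: "rdist x y = rdist y x"
proof -
  have "rdist x y \<le> rdist y x" for x y
  proof (rule field_le_epsilon)
    fix e :: real assume "e > 0"
    then obtain \<gamma> where g: "\<gamma> \<in> curves_between y x" "integral {0..1} (speed \<gamma>) < rdist y x + e"
      using rdist_approx[of y x "rdist y x + e"] by auto
    obtain \<gamma>' where "\<gamma>' \<in> curves_between x y" "integral {0..1} (speed \<gamma>') = integral {0..1} (speed \<gamma>)"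
      using curves_between_sym[OF g(1)] by blast
    then show "rdist x y \<le> rdist y x + e" using rdist_le_curve g by fastforce
  qed
  then show ?thesis by (metis order_antisym)
qed

lemma rdist_triangle: "rdist x z \<le> rdist x y + rdist y z"
proof (rule field_le_epsilon)
  fix e :: real assume e: "e > 0"
  obtain \<gamma>1 where 1: "\<gamma>1 \<in> curves_between x y" "integral {0..1} (speed \<gamma>1) < rdist x y + e / 2"
    using rdist_approx[of x y "rdist x y + e / 2"] e by auto
  obtain \<gamma>2 where 2: "\<gamma>2 \<in> curves_between y z" "integral {0..1} (speed \<gamma>2) < rdist y z + e / 2"
    using rdist_approx[of y z "rdist y z + e / 2"] e by auto
  obtain \<gamma> where "\<gamma> \<in> curves_between x z"
    "integral {0..1} (speed \<gamma>) = integral {0..1} (speed \<gamma>1) + integral {0..1} (speed \<gamma>2)"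
    using curves_between_trans[OF 1(1) 2(1)] by blast
  then show "rdist x z \<le> rdist x y + rdist y z + e" using rdist_le_curve[of \<gamma> x z] 1 2 by simp
qed

lemma rdist_refl: "rdist x x = 0"
proof -
  obtain \<gamma> where "\<gamma> \<in> curves_between x x" using curves_between_nonempty by blast
  then have "pw_C1 0 0 \<gamma>" "\<gamma> 0 = x"
    using pw_C1_subset[of 0 1 \<gamma> 0 0] by (auto simp: curves_between_def)
  then have "rdist x x \<le> 0" using rdist_le[of 0 0 \<gamma>] by simp
  then show ?thesis using rdist_nonneg[of x x] by simp
qed

text \<open>The straight coordinate segment is a competitor for the infimum, and by pinching its
  speed is at most twice the norm at \<open>p\<close>.\<close>

lemma rdist_local_upper:
  assumes c: "c \<in> A" "p \<in> fst c" and r: "cball (snd c p) r \<subseteq> chart_image c"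
    and b: "\<And>x v. x \<in> cball (snd c p) r \<Longrightarrow> metric_norm G c (chart_inv c x) v \<le> 2 * metric_norm G c p v"
    and xy: "x \<in> cball (snd c p) r" "y \<in> cball (snd c p) r"
  shows "rdist (chart_inv c x) (chart_inv c y) \<le> 2 * metric_norm G c p (y - x)"
proof -
  let ?\<gamma> = "\<lambda>t. chart_inv c (x + t *\<^sub>R (y - x))"
  have seg: "closed_segment x y \<subseteq> cball (snd c p) r" using xy by (intro closed_segment_subset) auto
  note s = pw_C1_segment[OF c(1) order_trans[OF seg r]]
  have "x + t *\<^sub>R (y - x) \<in> cball (snd c p) r" if "t \<in> {0..1}" for t
  proof -
    have "x + t *\<^sub>R (y - x) = (1 - t) *\<^sub>R x + t *\<^sub>R y" by (simp add: algebra_simps)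
    then show ?thesis using seg that by (force simp: closed_segment_def)
  qed
  then have sp: "speed ?\<gamma> t \<le> 2 * metric_norm G c p (y - x)" if "t \<in> {0<..<1}" for t
    using s(2)[OF that] b that by auto
  have P: "pw_C1 0 1 ?\<gamma>" using s(1) by (simp add: curves_between_def)
  have "integral {0..1} (speed ?\<gamma>) = integral {0<..<1} (speed ?\<gamma>)" by (simp add: integral_open_interval_real)
  also have "\<dots> \<le> integral {0<..<1::real} (\<lambda>_. 2 * metric_norm G c p (y - x))"
    by (rule Henstock_Kurzweil_Integration.integral_le)
      (use pw_C1_integrable[OF P] sp in \<open>simp_all add: integrable_on_open_interval_real integrable_const_ivl\<close>)
  also have "\<dots> = 2 * metric_norm G c p (y - x)"
    unfolding integral_open_interval_real[symmetric] by simp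
  finally show ?thesis using rdist_le_curve[OF s(1)] by simp
qed

text \<open>A curve from \<open>p\<close> to a point outside a small coordinate ball has to pay at
  least the exit length.\<close>

lemma rdist_local_lower:
  assumes "p \<in> W" "open W"
  obtains e where "e > 0" "\<And>q. rdist p q < e \<Longrightarrow> q \<in> W"
proof -
  obtain c where c: "c \<in> A" "p \<in> fst c" using ex_chart by blast
  obtain r where r: "r > 0" "cball (snd c p) r \<subseteq> chart_image c"
    "\<And>x v. x \<in> cball (snd c p) r \<Longrightarrow> metric_norm G c p v \<le> 2 * metric_norm G c (chart_inv c x) v"
    using metric_pinching[OF c] by metis
  obtain m where m: "m > 0" "\<And>v. m * norm v \<le> metric_norm G c p v"
    using metric_norm_euclidean_bounds[OF c] by metis
  have "open (snd c ` (fst c \<inter> W))" "snd c p \<in> snd c ` (fst c \<inter> W)"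
    using open_chart_image_Int[OF c(1) assms(2)] c assms(1) by auto
  then obtain r2 where r2: "r2 > 0" "ball (snd c p) r2 \<subseteq> snd c ` (fst c \<inter> W)"
    using open_contains_ball by blast
  define s where "s = min r r2"
  have s: "s > 0" "cball (snd c p) s \<subseteq> cball (snd c p) r" using r r2 by (auto simp: s_def)
  \<comment> \<open>The slope m/2 combines the Euclidean lower bound \<open>m\<close> at
    \<open>p\<close> with the pinching factor 2.\<close>
  have "q \<in> W" if q: "rdist p q < m / 2 * s" for q
  proof -
    obtain \<gamma> where g: "\<gamma> \<in> curves_between p q" "integral {0..1} (speed \<gamma>) < m / 2 * s"
      using rdist_approx[OF q] by blast
    have "q \<in> chart_inv c ` ball (snd c p) s"
    proof (rule ccontr)
      assume "q \<notin> chart_inv c ` ball (snd c p) s"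
      moreover have "m / 2 * norm v \<le> metric_norm G c (chart_inv c y) v" if "y \<in> cball (snd c p) s" for y v
        using m(2)[of v] r(3)[of y v] that s(2) by fastforce
      ultimately have "m / 2 * s \<le> integral {0..1} (speed \<gamma>)"
        by (intro exit_length[OF c(1)]) (use s r m g c in \<open>auto simp: chart_inv_snd\<close>)
      then show False using g by simp
    qed
    then obtain y where "y \<in> ball (snd c p) r2" "q = chart_inv c y" by (auto simp: s_def)
    then show ?thesis using r2(2) c by (auto simp: subset_iff chart_inv_snd)
  qed
  then show ?thesis using that[of "m / 2 * s"] m s by simp
qed

lemma rdist_tendsto_0:
  assumes "e > 0" obtains W where "open W" "p \<in> W" "\<And>q. q \<in> W \<Longrightarrow> rdist p q < e"
proof -
  obtain c where c: "c \<in> A" "p \<in> fst c" using ex_chart by blast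
  obtain r where r: "r > 0" "cball (snd c p) r \<subseteq> chart_image c"
    "\<And>x v. x \<in> cball (snd c p) r \<Longrightarrow> metric_norm G c (chart_inv c x) v \<le> 2 * metric_norm G c p v"
    using metric_pinching[OF c] by metis
  obtain M where M: "M > 0" "\<And>v. metric_norm G c p v \<le> M * norm v"
    using metric_norm_euclidean_bounds[OF c] by metis
  define s where "s = min r (e / (2 * M))"
  have s: "s > 0" "s \<le> r" using r assms M by (auto simp: s_def)
  have sub: "cball (snd c p) s \<subseteq> chart_image c" using r s by auto
  have "rdist p q < e" if q: "q \<in> chart_inv c ` ball (snd c p) s" for q
  proof -
    obtain y where y: "y \<in> ball (snd c p) s" "q = chart_inv c y" using q by blast
    have "rdist (chart_inv c (snd c p)) (chart_inv c y) \<le> 2 * metric_norm G c p (y - snd c p)"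
      by (rule rdist_local_upper[OF c r(2,3)]) (use y s r in auto)
    also have "\<dots> \<le> 2 * (M * norm (y - snd c p))" using M(2)[of "y - snd c p"] by simp
    also have "\<dots> < 2 * (M * s)" using y M by (auto simp: dist_norm norm_minus_commute)
    also have "\<dots> \<le> e" using M by (auto simp: s_def min_def field_simps)
    finally show ?thesis using y c by (simp add: chart_inv_snd)
  qed
  moreover have "p \<in> chart_inv c ` ball (snd c p) s"
    using s c by (intro image_eqI[of _ _ "snd c p"]) (auto simp: chart_inv_snd)
  ultimately show ?thesis using that ball_preimage(1)[OF c(1) sub] by blast
qed

lemma rdist_eq_0: "rdist x y = 0 \<longleftrightarrow> x = y"
proof
  assume d: "rdist x y = 0"
  show "x = y"
  proof (rule ccontr)
    assume "x \<noteq> y"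
    then obtain e where "e > 0" "\<And>q. rdist x q < e \<Longrightarrow> q \<in> - {y}"
      using rdist_local_lower[of x "- {y}"] by auto
    then show False using d by force
  qed
qed (simp add: rdist_refl)

text \<open>Connects \<open>rdist\<close> with the abstract metric space theory, in whose terms
  completeness is stated and total boundedness is available.\<close>

sublocale Metric_space UNIV rdist
  by unfold_locales (auto simp: rdist_nonneg rdist_commute rdist_eq_0 rdist_triangle)

lemma mtopology_eq: "mtopology = euclidean"
proof -
  have "openin mtopology W \<longleftrightarrow> open W" for W
  proof
    assume W: "openin mtopology W"
    show "open W"
    proof (subst open_subopen, rule ballI)
      fix p assume "p \<in> W"
      then obtain e where e: "e > 0" "mball p e \<subseteq> W" using W by (auto simp: openin_mtopology)
      obtain V where "open V" "p \<in> V" "\<And>q. q \<in> V \<Longrightarrow> rdist p q < e" using rdist_tendsto_0[OF e(1)] by blast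
      then show "\<exists>T. open T \<and> p \<in> T \<and> T \<subseteq> W" using e(2) by (intro exI[of _ V]) auto
    qed
  next
    assume W: "open W"
    show "openin mtopology W"
      unfolding openin_mtopology
    proof (intro conjI allI impI)
      fix p assume "p \<in> W"
      then obtain e where "e > 0" "\<And>q. rdist p q < e \<Longrightarrow> q \<in> W" using rdist_local_lower[OF _ W] by blast
      then show "\<exists>r>0. mball p r \<subseteq> W" by (intro exI[of _ e]) auto
    qed simp
  qed
  then show ?thesis by (simp add: topology_eq)
qed

lemma continuous_on_rdist: "continuous_on S (\<lambda>q. rdist q p)"
proof (rule continuous_at_imp_continuous_on, rule ballI)
  fix x
  show "isCont (\<lambda>q. rdist q p) x"
    unfolding isCont_def tendsto_iff eventually_at_topological
  proof (intro allI impI)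
    fix e :: real assume "e > 0"
    then obtain W where W: "open W" "x \<in> W" "\<And>q. q \<in> W \<Longrightarrow> rdist x q < e" using rdist_tendsto_0 by blast
    have "dist (rdist q p) (rdist x p) < e" if "q \<in> W" for q
      using W(3)[OF that] rdist_triangle[of q p x] rdist_triangle[of x p q] rdist_commute[of x q]
      by (simp add: dist_real_def abs_less_iff)
    then show "\<exists>S. open S \<and> x \<in> S \<and> (\<forall>q\<in>S. q \<noteq> x \<longrightarrow> q \<in> UNIV \<longrightarrow> dist (rdist q p) (rdist x p) < e)"
      using W by blast
  qed
qed

text \<open>An almost minimal curve plays the part of a geodesic: the distance from \<open>x\<close>
  takes the value \<open>s\<close> along it, and the remaining arc bounds the other distance up to
  \<open>e\<close>.\<close>

lemma rdist_intermediate: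
  assumes "0 \<le> s" "s \<le> rdist x y" "e > 0"
  obtains z where "rdist x z = s" "rdist z y \<le> rdist x y - s + e"
proof -
  obtain \<gamma> where g: "\<gamma> \<in> curves_between x y" "integral {0..1} (speed \<gamma>) < rdist x y + e"
    using rdist_approx[of x y "rdist x y + e"] assms by auto
  then have P: "pw_C1 0 1 \<gamma>" "\<gamma> 0 = x" "\<gamma> 1 = y" by (auto simp: curves_between_def)
  have "continuous_on {0..1} (\<lambda>t. rdist (\<gamma> t) x)"
    using P(1) by (intro continuous_on_compose2[OF continuous_on_rdist[of UNIV]]) (auto simp: pw_C1_def)
  then obtain t where t: "0 \<le> t" "t \<le> 1" "rdist (\<gamma> t) x = s"
    using IVT'[of "\<lambda>t. rdist (\<gamma> t) x" 0 s 1] P assms by (auto simp: rdist_refl rdist_commute)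
  have "rdist (\<gamma> 0) (\<gamma> t) \<le> integral {0..t} (speed \<gamma>)" "rdist (\<gamma> t) (\<gamma> 1) \<le> integral {t..1} (speed \<gamma>)"
    using t by (auto intro!: rdist_le pw_C1_subset[OF P(1)])
  moreover have "integral {0..t} (speed \<gamma>) + integral {t..1} (speed \<gamma>) = integral {0..1} (speed \<gamma>)"
    using Henstock_Kurzweil_Integration.integral_combine[OF t(1,2) pw_C1_integrable[OF P(1)]] .
  ultimately show ?thesis using that[of "\<gamma> t"] g t P by (auto simp: rdist_commute)
qed

section \<open>Compactness of closed balls\<close>

definition closed_rball :: "'a \<Rightarrow> real \<Rightarrow> 'a set" where
  "closed_rball p s = {q. rdist q p \<le> s}"

lemma closed_closed_rball: "closed (closed_rball p s)"
  unfolding closed_rball_def by (intro closed_Collect_le continuous_on_rdist continuous_on_const)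

lemma compact_nbhd_rball:
  obtains e where "e > 0" "\<exists>K. compact K \<and> {q. rdist p q < e} \<subseteq> K"
proof -
  obtain c where c: "c \<in> A" "p \<in> fst c" using ex_chart by blast
  obtain r where r: "r > 0" "cball (snd c p) r \<subseteq> chart_image c"
    using chart_open(2)[OF c(1)] snd_in[OF c(2)] open_contains_cball by blast
  note bp = ball_preimage[OF c(1) r(2)]
  have "p \<in> chart_inv c ` ball (snd c p) r"
    using r c by (intro image_eqI[of _ _ "snd c p"]) (auto simp: chart_inv_snd)
  then obtain e where e: "e > 0" "\<And>q. rdist p q < e \<Longrightarrow> q \<in> chart_inv c ` ball (snd c p) r"
    using rdist_local_lower[OF _ bp(1)] by blast
  have "{q. rdist p q < e} \<subseteq> chart_inv c ` ball (snd c p) r" using e(2) by blast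
  also have "\<dots> \<subseteq> chart_inv c ` cball (snd c p) r" by (intro image_mono ball_subset_cball)
  finally show ?thesis using bp(2) by (intro that[OF e(1)] exI conjI)
qed

text \<open>A Lebesgue-number argument: the balls of radius 2 e(p) have compact neighbourhoods,
  those of radius e(p) cover \<open>K\<close>, and the smallest radius of a finite subcover is the
  margin.\<close>

lemma compact_enlarge:
  assumes "compact K"
  obtains e K' where "e > 0" "compact K'" "\<And>q z. z \<in> K \<Longrightarrow> rdist z q < e \<Longrightarrow> q \<in> K'"
proof -
  have "\<exists>e>0. \<exists>K'. compact K' \<and> {q. rdist p q < 2 * e} \<subseteq> K'" for p
    using compact_nbhd_rball[of p] by (metis field_sum_of_halves half_gt_zero mult_2)
  then obtain e L where eL: "\<And>p. e p > 0" "\<And>p. compact (L p)" "\<And>p. {q. rdist p q < 2 * e p} \<subseteq> L p"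
    by metis
  have op: "open {q. rdist q p < e p}" for p by (intro open_Collect_less continuous_on_rdist continuous_on_const)
  have "K \<subseteq> (\<Union>p\<in>K. {q. rdist q p < e p})" using eL(1) by (auto simp: rdist_refl)
  then obtain F where F: "F \<subseteq> K" "finite F" "K \<subseteq> (\<Union>p\<in>F. {q. rdist q p < e p})"
    using compactE_image[OF assms, of K "\<lambda>p. {q. rdist q p < e p}"] op by blast
  define d where "d = Min (insert 1 (e ` F))"
  have d: "d > 0" "\<And>p. p \<in> F \<Longrightarrow> d \<le> e p" using F(2) eL(1) by (auto simp: d_def)
  have "q \<in> (\<Union>p\<in>F. L p)" if zq: "z \<in> K" "rdist z q < d" for q z
  proof -
    obtain p where p: "p \<in> F" "rdist z p < e p" using F(3) zq by blast
    have "rdist p q < 2 * e p"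
      using rdist_triangle[of p q z] p d(2)[OF p(1)] zq by (simp add: rdist_commute)
    then show ?thesis using eL(3) p by blast
  qed
  moreover have "compact (\<Union>p\<in>F. L p)" using F eL by (intro compact_UN) auto
  ultimately show ?thesis using that d(1) by blast
qed

text \<open>Hopf--Rinow: the supremum of the radii of compact balls can be neither attained nor missed.\<close>

lemma compact_closed_rball:
  assumes complete: "complete_manifold A G"
  shows "compact (closed_rball p s)"
proof -
  have mc: mcomplete using complete by (simp add: complete_manifold_def)
  define P where "P = {s. 0 \<le> s \<and> compact (closed_rball p s)}"
  have down: "compact (closed_rball p s)" if t: "compact (closed_rball p t)" "s \<le> t" for s t
  proof -
    have "closed_rball p s = closed_rball p t \<inter> closed_rball p s"
      using t(2) by (auto simp: closed_rball_def)
    then show ?thesis using compact_Int_closed[OF t(1) closed_closed_rball] by metis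
  qed
  have P0: "0 \<in> P"
  proof -
    have "rdist q p \<le> 0 \<longleftrightarrow> q = p" for q
      using rdist_nonneg[of q p] rdist_eq_0[of q p] by linarith
    then have "closed_rball p 0 = {p}" by (simp add: closed_rball_def)
    then show ?thesis by (simp add: P_def)
  qed
  have up: "\<exists>t>s. t \<in> P" if "s \<in> P" for s
  proof -
    have s: "0 \<le> s" "compact (closed_rball p s)" using that by (auto simp: P_def)
    obtain e K' where e: "e > 0" "compact K'" "\<And>q z. z \<in> closed_rball p s \<Longrightarrow> rdist z q < e \<Longrightarrow> q \<in> K'"
      using compact_enlarge[OF s(2)] by blast
    \<comment> \<open>A point at distance at most s + e/2 lies within e/2 + e/4 < e of an
      intermediate point at distance exactly \<open>s\<close>.\<close>
    have "closed_rball p (s + e / 2) \<subseteq> K'"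
    proof
      fix q assume q: "q \<in> closed_rball p (s + e / 2)"
      then have dq: "rdist p q \<le> s + e / 2" by (simp add: closed_rball_def rdist_commute)
      show "q \<in> K'"
      proof (cases "s \<le> rdist p q")
        case True
        obtain z where z: "rdist p z = s" "rdist z q \<le> rdist p q - s + e / 4"
          using rdist_intermediate[OF s(1) True, of "e / 4"] e by auto
        show ?thesis by (rule e(3)[of z]) (use z dq e(1) in \<open>auto simp: closed_rball_def rdist_commute\<close>)
      next
        case False
        show ?thesis by (rule e(3)[of q]) (use False e(1) in \<open>auto simp: closed_rball_def rdist_commute rdist_refl\<close>)
      qed
    qed
    then have "closed_rball p (s + e / 2) = K' \<inter> closed_rball p (s + e / 2)" by blast
    then have "compact (closed_rball p (s + e / 2))"
      using compact_Int_closed[OF e(2) closed_closed_rball] by metis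
    then show ?thesis using s e(1) by (intro exI[of _ "s + e / 2"]) (auto simp: P_def)
  qed
  have limit: "compact (closed_rball p s)" if s: "0 < s" "\<And>t. t < s \<Longrightarrow> compact (closed_rball p t)" for s
  proof -
    have "mtotally_bounded (closed_rball p s)"
      unfolding mtotally_bounded_def
    proof (intro allI impI)
      fix e :: real assume e: "e > 0"
      \<comment> \<open>Every point of the ball of radius \<open>s\<close> lies within e/2 of the
        compact ball of radius \<open>t\<close>, and a finite e/4-net there becomes an
        e-net.\<close>
      define t where "t = max 0 (s - e / 4)"
      have t: "0 \<le> t" "t < s" using s e by (auto simp: t_def)
      have "mtotally_bounded (closed_rball p t)"
        using compactin_imp_mtotally_bounded s(2)[OF t(2)] by (simp add: mtopology_eq)
      then obtain K where K: "finite K" "K \<subseteq> closed_rball p t" "closed_rball p t \<subseteq> (\<Union>x\<in>K. mball x (e / 4))"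
        unfolding mtotally_bounded_def using e by (metis zero_less_divide_iff zero_less_numeral)
      have "closed_rball p s \<subseteq> (\<Union>x\<in>K. mball x e)"
      proof
        fix q assume "q \<in> closed_rball p s"
        then have q: "rdist p q \<le> s" by (simp add: closed_rball_def rdist_commute)
        obtain z where z: "rdist p z \<le> t" "rdist z q \<le> e / 2"
        proof (cases "t \<le> rdist p q")
          case True
          obtain z where "rdist p z = t" "rdist z q \<le> rdist p q - t + e / 4"
            using rdist_intermediate[OF t(1) True, of "e / 4"] e by auto
          moreover have "s - e / 4 \<le> t" by (simp add: t_def)
          ultimately have "rdist p z \<le> t" "rdist z q \<le> e / 2" using q by linarith+
          then show ?thesis by (rule that)
        next
          case False
          then show ?thesis using that[of q] e by (simp add: rdist_refl)
        qed
        then have "z \<in> closed_rball p t" by (simp add: closed_rball_def rdist_commute)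
        then obtain x where x: "x \<in> K" "rdist x z < e / 4" using K(3) by auto
        then have "rdist x q < e" using rdist_triangle[of x q z] z e by simp
        then show "q \<in> (\<Union>x\<in>K. mball x e)" using x by auto
      qed
      moreover have "K \<subseteq> closed_rball p s" using K(2) t by (auto simp: closed_rball_def)
      ultimately show "\<exists>K. finite K \<and> K \<subseteq> closed_rball p s \<and> closed_rball p s \<subseteq> (\<Union>x\<in>K. mball x e)"
        using K(1) by blast
    qed
    \<comment> \<open>This is where completeness is used: total boundedness gives compact
      closure.\<close>
    then have "compactin mtopology (mtopology closure_of (closed_rball p s))"
      using mtotally_bounded_eq_compact_closure_of[OF mc] by blast
    then show ?thesis using closed_closed_rball by (simp add: mtopology_eq closure_closed)
  qed
  show ?thesis
  proof (rule ccontr)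
    assume nc: "\<not> compact (closed_rball p s)"
    have bdd: "bdd_above P"
    proof (rule bdd_aboveI[of _ s])
      fix t assume "t \<in> P"
      then show "t \<le> s" using down[of t s] nc by (fastforce simp: P_def)
    qed
    define \<rho> where "\<rho> = Sup P"
    have up\<rho>: "t \<le> \<rho>" if "t \<in> P" for t unfolding \<rho>_def using cSup_upper[OF that bdd] .
    obtain t0 where "t0 > 0" "t0 \<in> P" using up[OF P0] by blast
    then have "\<rho> > 0" using up\<rho> by fastforce
    moreover have "compact (closed_rball p t)" if t: "t < \<rho>" for t
    proof -
      obtain t' where "t' \<in> P" "t < t'" using less_cSupD[of P t] t P0 unfolding \<rho>_def by blast
      then show ?thesis using down[of t' t] by (simp add: P_def)
    qed
    ultimately have "\<rho> \<in> P" using limit by (simp add: P_def)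
    then show False using up up\<rho> by fastforce
  qed
qed

end

section \<open>Integration of compactly supported functions\<close>

text \<open>From the exponent 2 on, the kink of the positive part is flattened; at 0 the difference
  quotient is the next lower power of the positive part.\<close>

lemma pos_part_power_deriv:
  assumes "N \<ge> 2"
  shows "((\<lambda>t::real. (max 0 t) ^ N) has_real_derivative real N * (max 0 t) ^ (N - 1)) (at t)"
proof -
  consider "t > 0" | "t < 0" | "t = 0" by linarith
  then show ?thesis
  proof cases
    case 1
    have "((\<lambda>t::real. t ^ N) has_real_derivative real N * t ^ (N - 1)) (at t)"
      by (auto intro!: derivative_eq_intros)
    then have "((\<lambda>t::real. (max 0 t) ^ N) has_real_derivative real N * t ^ (N - 1)) (at t)"
      by (rule has_field_derivative_transform_within_open[of _ _ _ "{0<..}"]) (use 1 in auto)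
    then show ?thesis using 1 by simp
  next
    case 2
    have "((\<lambda>t::real. 0) has_real_derivative 0) (at t)" by simp
    then have "((\<lambda>t::real. (max 0 t) ^ N) has_real_derivative 0) (at t)"
      by (rule has_field_derivative_transform_within_open[of _ _ _ "{..<0}"]) (use 2 assms in auto)
    then show ?thesis using 2 assms by (simp add: power_0_left)
  next
    case 3
    have "((\<lambda>h::real. max 0 h ^ (N - 1)) \<longlongrightarrow> max 0 0 ^ (N - 1)) (at 0)"
      by (intro tendsto_intros)
    moreover have "max 0 0 ^ (N - 1) = (0::real)" using assms by (simp add: power_0_left)
    ultimately have "((\<lambda>h::real. max 0 h ^ (N - 1)) \<longlongrightarrow> 0) (at 0)" by metis
    moreover have "(max 0 (0 + h) ^ N - max 0 0 ^ N) / h = max 0 h ^ (N - 1)" if "h \<noteq> 0" for h :: real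
      using that assms by (cases "h > 0") (auto simp: max_def power_eq_if)
    ultimately have "((\<lambda>h::real. (max 0 (0 + h) ^ N - max 0 0 ^ N) / h) \<longlongrightarrow> 0) (at 0)"
      by (subst filterlim_cong[OF refl refl, of _ "\<lambda>h. max 0 h ^ (N - 1)"]) (auto simp: eventually_at_filter)
    then show ?thesis using 3 assms by (simp add: DERIV_def power_0_left)
  qed
qed

lemma pos_part_power_C1: "N \<ge> 2 \<Longrightarrow> higher_differentiable_on UNIV (\<lambda>t::real. (max 0 t) ^ N) 1"
  by (rule C1_on_realI[OF open_UNIV pos_part_power_deriv]) (auto intro!: continuous_intros)

text \<open>A C^1 transition from 0 to 1 on the unit interval, built from squared positive parts so
  that both slopes at the ends vanish.\<close>

definition C1_step :: "real \<Rightarrow> real" where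
  "C1_step t = 1 - (max 0 (1 - (max 0 t) ^ 2)) ^ 2"

lemma C1_step_C1: "higher_differentiable_on UNIV C1_step 1"
proof -
  let ?p = "\<lambda>t::real. (max 0 t) ^ 2"
  have p: "higher_differentiable_on UNIV ?p 1" by (rule pos_part_power_C1) simp
  have "higher_differentiable_on UNIV (\<lambda>t. 1 - ?p t) 1"
    by (intro higher_differentiable_on_diff higher_differentiable_on_const p open_UNIV)
  from higher_differentiable_on_compose[OF open_UNIV this p]
  have "higher_differentiable_on UNIV (\<lambda>t. ?p (1 - ?p t)) 1" by (simp add: comp_def)
  then show ?thesis unfolding C1_step_def[abs_def]
    by (intro higher_differentiable_on_diff higher_differentiable_on_const open_UNIV)
qed

lemma C1_step_bounds: "0 \<le> C1_step t" "C1_step t \<le> 1"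
  and C1_step_0: "t \<le> 0 \<Longrightarrow> C1_step t = 0" and C1_step_1: "t \<ge> 1 \<Longrightarrow> C1_step t = 1"
proof -
  have "max 0 (1 - (max 0 t) ^ 2) \<le> 1" by simp
  then have "(max 0 (1 - (max 0 t) ^ 2)) ^ 2 \<le> 1" by (simp add: power_le_one)
  then show "0 \<le> C1_step t" "C1_step t \<le> 1" by (simp_all add: C1_step_def)
  show "t \<le> 0 \<Longrightarrow> C1_step t = 0" by (simp add: C1_step_def)
  assume "t \<ge> 1"
  then have "(max 0 t) ^ 2 \<ge> 1" by (simp add: one_le_power)
  then show "C1_step t = 1" by (simp add: C1_step_def)
qed

lemma bounded_compact_support:
  fixes f :: "'a::topological_space \<Rightarrow> real"
  assumes "continuous_on UNIV f" "compact K" "\<And>x. x \<notin> K \<Longrightarrow> f x = 0"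
  obtains B where "B \<ge> 0" "\<And>x. \<bar>f x\<bar> \<le> B"
proof -
  have "compact (f ` K)" using assms by (auto intro: compact_continuous_image continuous_on_subset)
  then obtain B where B: "\<And>x. x \<in> K \<Longrightarrow> \<bar>f x\<bar> \<le> B"
    using compact_imp_bounded[of "f ` K"] by (auto simp: bounded_iff)
  have "\<bar>f x\<bar> \<le> max 0 B" for x using B[of x] assms(3)[of x] by (cases "x \<in> K") auto
  then show ?thesis using that[of "max 0 B"] by simp
qed

lemma continuous_on_extend_zero:
  fixes f :: "'a::topological_space \<Rightarrow> real"
  assumes "continuous_on U f" "open U" "closed K" "K \<subseteq> U" "\<And>x. x \<notin> K \<Longrightarrow> f x = 0"
  shows "continuous_on UNIV f"
proof -
  have "continuous_on (- K) f"
    using assms(5) by (subst continuous_on_cong[OF refl, of _ _ "\<lambda>_. 0"]) auto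
  moreover have "U \<union> - K = UNIV" using assms(4) by blast
  ultimately show ?thesis
    using continuous_on_open_Un[OF assms(2) open_Compl[OF assms(3)] assms(1), of ] by simp
qed

text \<open>Translation invariance makes the difference quotients integrate to zero.\<close>

lemma integral_derivative_compact_support:
  fixes Y :: "real^'n \<Rightarrow> real"
  assumes C1: "higher_differentiable_on UNIV Y 1" and K: "compact K" "\<And>x. x \<notin> K \<Longrightarrow> Y x = 0"
  shows "(LINT x|lborel. frechet_derivative Y (at x) v) = 0"
proof -
  have D: "(Y has_derivative frechet_derivative Y (at x)) (at x)" for x
    using C1 by (simp add: higher_differentiable_on_1 frechet_derivative_works[symmetric])
  have cY: "continuous_on UNIV Y" using C1 higher_differentiable_on_Suc_imp_continuous by blast
  have cY': "continuous_on UNIV (\<lambda>x. frechet_derivative Y (at x) v)"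
    using C1 by (simp add: higher_differentiable_on_1)
  have Y'0: "frechet_derivative Y (at x) v = 0" if "x \<notin> K" for x
  proof -
    have "frechet_derivative Y (at x) = frechet_derivative (\<lambda>x. 0) (at x)"
      by (rule frechet_derivative_cong_open[of "- K"]) (use K that compact_imp_closed in auto)
    then show ?thesis by simp
  qed
  obtain B where B: "B \<ge> 0" "\<And>x. \<bar>frechet_derivative Y (at x) v\<bar> \<le> B"
    using bounded_compact_support[OF cY' K(1) Y'0] by blast
  \<comment> \<open>All difference quotients with step at most 1 vanish outside this compact
    enlargement of \<open>K\<close>, which supports the dominating function.\<close>
  define L where "L = {x + y |x y. x \<in> K \<and> y \<in> cball (0::real^'n) (norm v)}"
  have L: "compact L" unfolding L_def by (rule compact_sums[OF K(1) compact_cball])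
  define f where "f n x = real (Suc n) * (Y (x + (1 / real (Suc n)) *\<^sub>R v) - Y x)" for n x
  have lin: "linear (frechet_derivative Y (at x))" for x using D has_derivative_linear by blast
  have bound: "\<bar>f n x\<bar> \<le> B * indicator L x" for n x
  proof (cases "x \<in> L")
    case True
    let ?w = "(1 / real (Suc n)) *\<^sub>R v"
    have dg: "((\<lambda>t. Y (x + t *\<^sub>R v)) has_vector_derivative frechet_derivative Y (at (x + t *\<^sub>R v)) v) (at t within S)" for t S
    proof -
      have "((\<lambda>t. x + t *\<^sub>R v) has_vector_derivative v) (at t)"
        by (auto intro!: derivative_eq_intros simp: has_vector_derivative_def)
      from vector_derivative_diff_chain_within[OF this has_derivative_at_withinI[OF D]]
      show ?thesis using has_vector_derivative_at_within by (fastforce simp: comp_def)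
    qed
    \<comment> \<open>The mean value theorem bounds every quotient by the supremum of the
      derivative, uniformly in \<open>n\<close>.\<close>
    have "\<exists>z. 0 < z \<and> z < 1 / real (Suc n) \<and> Y (x + (1 / real (Suc n)) *\<^sub>R v) - Y (x + 0 *\<^sub>R v)
        = (1 / real (Suc n) - 0) * frechet_derivative Y (at (x + z *\<^sub>R v)) v"
      by (rule MVT2) (use dg in \<open>auto simp: has_real_derivative_iff_has_vector_derivative\<close>)
    then obtain z where "Y (x + ?w) - Y x = (1 / real (Suc n)) * frechet_derivative Y (at (x + z *\<^sub>R v)) v" by auto
    then have "f n x = frechet_derivative Y (at (x + z *\<^sub>R v)) v" by (simp add: f_def del: of_nat_Suc)
    then show ?thesis using True B(2) by simp
  next
    case False
    have "(1 / real (Suc n)) * norm v \<le> 1 * norm v" by (rule mult_right_mono) auto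
    then have "norm ((1 / real (Suc n)) *\<^sub>R v) \<le> norm v" by simp
    then have "x + (1 / real (Suc n)) *\<^sub>R v \<notin> K"
      using False unfolding L_def mem_Collect_eq
      by (metis (no_types, lifting) add_diff_cancel diff_add_cancel diff_conv_add_uminus mem_cball_0 norm_minus_cancel)
    moreover have "x \<notin> K" using False unfolding L_def mem_Collect_eq
      by (metis (no_types, lifting) add.right_neutral mem_cball_0 norm_ge_zero norm_zero)
    ultimately show ?thesis using K(2) False by (simp add: f_def)
  qed
  have int: "integrable lborel Y"
  proof -
    obtain C where C: "C \<ge> 0" "\<And>x. \<bar>Y x\<bar> \<le> C" using bounded_compact_support[OF cY K] by blast
    have "\<bar>Y x\<bar> \<le> C * indicator K x" for x using K(2)[of x] C(2)[of x] by (cases "x \<in> K") auto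
    moreover have "integrable lborel (\<lambda>x. C * indicator K x)"
      using emeasure_compact_finite[OF K(1)] K(1)
      by (intro integrable_mult_right integrable_real_indicator) (auto simp: borel_closed compact_imp_closed)
    ultimately show ?thesis
      by (rule_tac Bochner_Integration.integrable_bound[of _ "\<lambda>x. C * indicator K x"])
        (use C(1) in \<open>auto intro!: borel_measurable_continuous_onI cY AE_I2 simp: abs_mult\<close>)
  qed
  have shift: "integrable lborel (\<lambda>x. Y (x + w))" "(LINT x|lborel. Y (x + w)) = (LINT x|lborel. Y x)" for w
  proof -
    have m: "Y \<in> borel_measurable borel" using cY by (rule borel_measurable_continuous_onI)
    have d: "lborel = distr lborel borel ((+) w)" by (rule lborel_distr_plus[symmetric])
    show "(LINT x|lborel. Y (x + w)) = (LINT x|lborel. Y x)"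
      by (subst (2) d, subst integral_distr) (use m in \<open>auto simp: add.commute\<close>)
    have "integrable (distr lborel borel ((+) w)) Y" using int d by simp
    then show "integrable lborel (\<lambda>x. Y (x + w))"
      by (subst (asm) integrable_distr_eq) (use m in \<open>auto simp: add.commute\<close>)
  qed
  have f0: "(LINT x|lborel. f n x) = 0" for n
    unfolding f_def using shift int by simp
  have lim: "(\<lambda>n. f n x) \<longlonglongrightarrow> frechet_derivative Y (at x) v" for x
  proof -
    have "((\<lambda>t. Y (x + t *\<^sub>R v)) has_real_derivative frechet_derivative Y (at x) v) (at 0)"
    proof -
      have 1: "((\<lambda>t. x + t *\<^sub>R v) has_vector_derivative v) (at 0)"
        by (auto intro!: derivative_eq_intros simp: has_vector_derivative_def)
      have "(Y has_derivative frechet_derivative Y (at x)) (at (x + 0 *\<^sub>R v) within range (\<lambda>t. x + t *\<^sub>R v))"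
        using D[of x] by (simp add: has_derivative_at_withinI)
      from vector_derivative_diff_chain_within[OF 1 this]
      show ?thesis by (simp add: comp_def has_real_derivative_iff_has_vector_derivative)
    qed
    then have "((\<lambda>h. (Y (x + h *\<^sub>R v) - Y x) / h) \<longlongrightarrow> frechet_derivative Y (at x) v) (at 0)"
      by (simp add: DERIV_def)
    moreover have "filterlim (\<lambda>n. 1 / real (Suc n)) (at 0) sequentially"
      by (rule filterlim_atI) (use LIMSEQ_inverse_real_of_nat in \<open>auto simp: inverse_eq_divide\<close>)
    ultimately have "(\<lambda>n. (Y (x + (1 / real (Suc n)) *\<^sub>R v) - Y x) / (1 / real (Suc n))) \<longlonglongrightarrow> frechet_derivative Y (at x) v"
      by (rule filterlim_compose)
    then show ?thesis by (simp add: f_def mult.commute)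
  qed
  have "(\<lambda>n. LINT x|lborel. f n x) \<longlonglongrightarrow> (LINT x|lborel. frechet_derivative Y (at x) v)"
  proof (rule integral_dominated_convergence[where w="\<lambda>x. B * indicator L x"])
    show "(\<lambda>x. frechet_derivative Y (at x) v) \<in> borel_measurable lborel"
      using cY' by (simp add: borel_measurable_continuous_onI)
    show "f n \<in> borel_measurable lborel" for n
      unfolding f_def using cY
      by (auto intro!: borel_measurable_continuous_onI continuous_intros continuous_on_compose2[OF cY])
    show "integrable lborel (\<lambda>x. B * indicator L x)"
      using emeasure_compact_finite[OF L] L
      by (intro integrable_mult_right integrable_real_indicator) (auto simp: borel_closed compact_imp_closed)
  qed (use lim bound in auto)
  then show ?thesis using f0 by (simp add: LIMSEQ_const_iff)
qed

context riemannian_manifold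
begin

lemma integrable_compact_support:
  assumes F: "continuous_on UNIV F" and K: "compact K" "\<And>p. p \<notin> K \<Longrightarrow> F p = (0::real)"
  shows "integrable vol F"
proof -
  obtain B where B: "B \<ge> 0" "\<And>p. \<bar>F p\<bar> \<le> B" using bounded_compact_support[OF F K] by blast
  have i: "integrable vol (\<lambda>p. B * indicator K p)"
    using emeasure_vol_compact[OF K(1)] K(1)
    by (intro integrable_mult_right integrable_real_indicator) (auto simp: borel_closed compact_imp_closed)
  have m: "F \<in> borel_measurable vol"
    using borel_measurable_continuous_onI[OF F] measurable_cong_sets[OF sets_vol refl, of borel] by simp
  have b: "norm (F p) \<le> norm (B * indicator K p)" for p
    using B(1) B(2)[of p] K(2)[of p] by (cases "p \<in> K") auto
  show ?thesis by (rule Bochner_Integration.integrable_bound[OF i m AE_I2[OF b]])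
qed

section \<open>Calculus of differentials and continuity of the flux\<close>

lemma dform_add:
  assumes "Ck_on 1 W f" "Ck_on 1 W g" "p \<in> W" "c \<in> A" "p \<in> fst c"
  shows "dform (\<lambda>q. f q + g q) c p v = dform f c p v + dform g c p v"
proof -
  have "(\<lambda>q. f q + g q) \<circ> chart_inv c = (\<lambda>x. (f \<circ> chart_inv c) x + (g \<circ> chart_inv c) x)" by auto
  then have "((\<lambda>q. f q + g q) \<circ> chart_inv c has_derivative (\<lambda>v. dform f c p v + dform g c p v)) (at (snd c p))"
    using has_derivative_add[OF dform_has_derivative dform_has_derivative, of W f p c W g] assms by simp
  from dform_unique[OF this] show ?thesis by simp
qed

lemma dform_mult:
  assumes "Ck_on 1 W f" "Ck_on 1 W g" "p \<in> W" "c \<in> A" "p \<in> fst c"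
  shows "dform (\<lambda>q. f q * g q) c p v = f p * dform g c p v + dform f c p v * g p"
proof -
  have "(\<lambda>q. f q * g q) \<circ> chart_inv c = (\<lambda>x. (f \<circ> chart_inv c) x * (g \<circ> chart_inv c) x)" by auto
  then have "((\<lambda>q. f q * g q) \<circ> chart_inv c has_derivative (\<lambda>v. f p * dform g c p v + dform f c p v * g p)) (at (snd c p))"
    using has_derivative_mult[OF dform_has_derivative dform_has_derivative, of W f p c W g] assms
    by (simp add: chart_inv_snd)
  from dform_unique[OF this] show ?thesis by simp
qed

lemma dform_const: "dform (\<lambda>_. a) c p v = 0"
  by (simp add: dform_def comp_def)

lemma dform_compose:
  assumes "Ck_on 1 W f" "p \<in> W" "c \<in> A" "p \<in> fst c" "(g has_real_derivative g') (at (f p))"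
  shows "dform (\<lambda>q. g (f q)) c p v = g' * dform f c p v"
proof -
  have "(g has_derivative (\<lambda>x. g' * x)) (at ((f \<circ> chart_inv c) (snd c p)))"
    using assms by (simp add: chart_inv_snd has_field_derivative_def)
  from diff_chain_at[OF dform_has_derivative[OF assms(1-4)] this]
  have "((\<lambda>q. g (f q)) \<circ> chart_inv c has_derivative (\<lambda>v. g' * dform f c p v)) (at (snd c p))"
    by (simp add: comp_def)
  from dform_unique[OF this] show ?thesis by simp
qed

lemma dform_off_support:
  assumes "closed K" "\<And>q. q \<notin> K \<Longrightarrow> f q = 0" "p \<notin> K" "c \<in> A" "p \<in> fst c"
  shows "dform f c p v = 0"
proof -
  have "dform f c p = dform (\<lambda>_. 0) c p"
    by (rule dform_cong[of "- K"]) (use assms in auto)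
  then show ?thesis by (simp add: dform_const)
qed

lemma continuous_on_metric_chart: "c \<in> A \<Longrightarrow> continuous_on (fst c) (G c)"
proof -
  assume c: "c \<in> A"
  have "continuous_on (fst c) (\<lambda>p. G c (chart_inv c (snd c p)))"
    by (rule continuous_on_compose2[OF continuous_on_metric[OF c] continuous_on_chart[OF c]]) (use snd_in[of _ c] in auto)
  then show ?thesis by (rule continuous_on_eq) (simp add: chart_inv_snd[OF c])
qed

lemma continuous_on_dform:
  assumes "c \<in> A" "Ck_on 1 UNIV f" "continuous_on (fst c) w"
  shows "continuous_on (fst c) (\<lambda>p. dform f c p (w p))"
  unfolding dform_def
proof (rule continuous_on_frechet_derivative_apply[OF _ continuous_on_chart[OF assms(1)] _ assms(3)])
  show "higher_differentiable_on (chart_image c) (f \<circ> chart_inv c) 1"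
    using assms by (simp add: Ck_on_def chart_image_def)
qed (use snd_in[of _ c] in auto)

text \<open>Cramer's rule writes the components as quotients of determinants, which are polynomial
  in the metric entries and the partial derivatives.\<close>

lemma continuous_on_gradient:
  assumes c: "c \<in> A" and u: "Ck_on 1 UNIV u"
  shows "continuous_on (fst c) (gradient G u c)"
proof -
  note cG = continuous_on_metric_chart[OF c]
  let ?d = "\<lambda>p. (\<chi> j. dform u c p (axis j 1)) :: real^'n"
  have cd: "continuous_on (fst c) (\<lambda>p. dform u c p (axis j 1))" for j
    by (rule continuous_on_dform[OF c u continuous_on_const])
  have eq: "gradient G u c p = (\<chi> k. det (\<chi> i j. if j = k then ?d p $ i else G c p $ i $ j) / det (G c p))"
    if p: "p \<in> fst c" for p
  proof -
    have "G c p *v gradient G u c p = ?d p"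
      using metric_gradient[OF c p] by (simp add: dform_def partial_deriv_def)
    then show ?thesis using cramer[of "G c p" "gradient G u c p" "?d p"] det_metric_pos[OF c p] by auto
  qed
  have ent: "continuous_on (fst c) (\<lambda>p. if j = k then ?d p $ i else G c p $ i $ j)" for i j k
    using cd cG by (cases "j = k") (auto intro!: continuous_intros)
  have "continuous_on (fst c) (\<lambda>p. (\<chi> k. det (\<chi> i j. if j = k then ?d p $ i else G c p $ i $ j) / det (G c p)) :: real^'n)"
    unfolding det_def using det_metric_pos[OF c, unfolded det_def]
    by (intro continuous_on_vec_lambda continuous_on_divide continuous_on_sum continuous_on_mult
        continuous_on_prod continuous_on_const)
      (use ent cG in \<open>force intro!: continuous_intros\<close>)+
  then show ?thesis by (rule continuous_on_eq) (simp add: eq)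
qed

lemma continuous_on_metric_norm:
  assumes "c \<in> A" "continuous_on (fst c) w"
  shows "continuous_on (fst c) (\<lambda>p. metric_norm G c p (w p))"
  unfolding metric_norm_def metric_inner_def matrix_vector_mult_def inner_vec_def
  using assms(2) continuous_on_metric_chart[OF assms(1)] by (auto intro!: continuous_intros)

lemma metric_norm_phi_gradient:
  assumes "c \<in> A" "p \<in> fst c" "\<phi> 0 = 0"
  shows "metric_norm G c p (phi_gradient G \<phi> u c p) = \<bar>\<phi> (metric_norm G c p (gradient G u c p))\<bar>"
proof -
  have z: "metric_norm G c p 0 = 0" using metric_norm_eq_0[OF assms(1,2)] by blast
  show ?thesis
  proof (cases "gradient G u c p = 0")
    case True
    then show ?thesis by (simp add: phi_gradient_def z assms(3))
  next
    case False
    then have "metric_norm G c p (gradient G u c p) > 0"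
      using metric_norm_eq_0[OF assms(1,2)] metric_norm_nonneg[OF assms(1,2)] by (metis less_le)
    with False show ?thesis by (simp add: phi_gradient_def Let_def metric_norm_scaleR)
  qed
qed

text \<open>Away from critical points the formula is continuous. At a critical point the metric
  length of the flux is \<phi>(|grad u|), which tends to \<phi>(0) = 0, and pinching turns this into
  a bound on its components.\<close>

lemma continuous_on_phi_gradient:
  assumes c: "c \<in> A" and u: "Ck_on 1 UNIV u" and \<phi>: "continuous_on {0..} \<phi>" "\<phi> 0 = 0"
  shows "continuous_on (fst c) (phi_gradient G \<phi> u c)"
proof -
  let ?v = "gradient G u c" and ?X = "phi_gradient G \<phi> u c"
  let ?s = "\<lambda>p. metric_norm G c p (?v p)"
  note cv = continuous_on_gradient[OF c u]
  have cs: "continuous_on (fst c) ?s" by (rule continuous_on_metric_norm[OF c cv])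
  have c\<phi>: "continuous_on (fst c) (\<lambda>p. \<phi> (?s p))"
    by (rule continuous_on_compose2[OF \<phi>(1) cs]) (use metric_norm_nonneg[OF c] in auto)
  note op = chart_open(1)[OF c]
  show ?thesis
  proof (rule continuous_at_imp_continuous_on, rule ballI)
    fix p assume p: "p \<in> fst c"
    show "isCont ?X p"
    proof (cases "?v p = 0")
      case False
      let ?U = "fst c \<inter> ?v -` (- {0})"
      have U: "open ?U" using continuous_open_preimage[OF cv op open_Compl[OF closed_singleton]] .
      have "continuous_on ?U (\<lambda>q. (\<phi> (?s q) / ?s q) *\<^sub>R ?v q)"
        by (intro continuous_intros continuous_on_subset[OF c\<phi>] continuous_on_subset[OF cs] continuous_on_subset[OF cv])
          (use metric_norm_eq_0[OF c] in auto)
      then have "continuous_on ?U ?X"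
        by (rule continuous_on_eq) (simp add: phi_gradient_def Let_def)
      then show ?thesis using U p False continuous_on_eq_continuous_at by auto
    next
      case True
      obtain m where m: "m > 0" "\<And>v. m * norm v \<le> metric_norm G c p v"
        using metric_norm_euclidean_bounds[OF c p] by metis
      obtain r where r: "r > 0" "cball (snd c p) r \<subseteq> chart_image c"
        "\<And>x v. x \<in> cball (snd c p) r \<Longrightarrow> metric_norm G c p v \<le> 2 * metric_norm G c (chart_inv c x) v"
        using metric_pinching[OF c p] by metis
      have bound: "norm (?X q) \<le> 2 / m * \<bar>\<phi> (?s q)\<bar>" if "q \<in> chart_inv c ` ball (snd c p) r" for q
      proof -
        have q: "q \<in> fst c" "snd c q \<in> cball (snd c p) r" using that ball_preimage(3)[OF c r(2)] by auto
        have "m * norm (?X q) \<le> 2 * metric_norm G c q (?X q)"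
          using m(2)[of "?X q"] r(3)[OF q(2), of "?X q"] chart_inv_snd[OF c q(1)] by simp
        then show ?thesis using m(1) metric_norm_phi_gradient[where \<phi>=\<phi>, OF c q(1) \<phi>(2)] by (simp add: field_simps)
      qed
      have X0: "?X p = 0" using True by (simp add: phi_gradient_def)
      have "isCont (\<lambda>q. 2 / m * \<bar>\<phi> (?s q)\<bar>) p"
        using c\<phi> op p m(1) continuous_on_eq_continuous_at by (auto intro!: continuous_intros)
      moreover have "?s p = 0" using True metric_norm_eq_0[OF c p] by metis
      then have "\<phi> (?s p) = 0" by (simp add: \<phi>(2))
      ultimately have lim: "((\<lambda>q. 2 / m * \<bar>\<phi> (?s q)\<bar>) \<longlongrightarrow> 0) (at p)"
        unfolding isCont_def by simp
      have ev: "eventually (\<lambda>q. norm (?X q) \<le> 2 / m * \<bar>\<phi> (?s q)\<bar>) (at p)"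
        unfolding eventually_at_topological
      proof (intro exI conjI ballI impI)
        show "open (chart_inv c ` ball (snd c p) r)" by (rule ball_preimage(1)[OF c r(2)])
        show "p \<in> chart_inv c ` ball (snd c p) r"
          using r p by (intro image_eqI[of _ _ "snd c p"]) (auto simp: chart_inv_snd[OF c])
      qed (rule bound)
      show ?thesis unfolding isCont_def X0 by (rule Lim_null_comparison[OF ev lim])
    qed
  qed
qed

end

section \<open>The weak inequality for continuously differentiable test functions\<close>

lemma higher_differentiable_on_extend_zero:
  assumes "open U" "closed K" "K \<subseteq> U" "\<And>x. x \<notin> K \<Longrightarrow> f x = 0" "higher_differentiable_on U f k"
  shows "higher_differentiable_on UNIV f k"
proof (rule higher_differentiable_on_local)
  fix x
  show "\<exists>T. open T \<and> x \<in> T \<and> higher_differentiable_on T f k"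
  proof (cases "x \<in> K")
    case True
    then show ?thesis using assms by blast
  next
    case False
    have "higher_differentiable_on (- K) f k"
      by (rule higher_differentiable_on_cong[OF open_Compl[OF assms(2)] _ higher_differentiable_on_const[of _ 0]])
        (simp add: assms(4))
    then show ?thesis using False assms(2) by (intro exI[of _ "- K"]) auto
  qed
qed

lemma frechet_derivative_off_support:
  assumes "closed K" "\<And>x. x \<notin> K \<Longrightarrow> f x = 0" "y \<notin> K"
  shows "frechet_derivative f (at y) v = 0"
proof -
  have "frechet_derivative f (at y) = frechet_derivative (\<lambda>_. 0) (at y)"
    by (rule frechet_derivative_cong_open[of "- K"]) (use assms in auto)
  then show ?thesis by simp
qed

text \<open>Each directional derivative along a basis vector is continuous with compact support,
  hence bounded; linearity combines these bounds into one.\<close>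

lemma C1_compact_support_derivative_bound:
  fixes H :: "'a::euclidean_space \<Rightarrow> real"
  assumes H: "higher_differentiable_on UNIV H 1" and K: "compact K" "\<And>x. x \<notin> K \<Longrightarrow> H x = 0"
  obtains B where "B \<ge> 0" "\<And>y v. \<bar>frechet_derivative H (at y) v\<bar> \<le> norm v * B"
proof -
  have "\<exists>B. \<forall>y. \<bar>frechet_derivative H (at y) b\<bar> \<le> B" for b
  proof -
    have cont: "continuous_on UNIV (\<lambda>x. frechet_derivative H (at x) b)"
      using H by (simp add: higher_differentiable_on_1)
    have z: "frechet_derivative H (at y) b = 0" if "y \<notin> K" for y
      by (rule frechet_derivative_off_support[OF compact_imp_closed[OF K(1)] _ that]) (rule K(2))
    show ?thesis using bounded_compact_support[OF cont K(1) z] by blast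
  qed
  then obtain Bd where Bd: "\<And>b y. \<bar>frechet_derivative H (at y) b\<bar> \<le> Bd b" by metis
  have Bd0: "Bd b \<ge> 0" for b using Bd[of 0 b] by linarith
  have "\<bar>frechet_derivative H (at y) v\<bar> \<le> norm v * (\<Sum>b\<in>Basis. Bd b)" for v y
  proof -
    have lin: "linear (frechet_derivative H (at y))"
      using H by (intro linear_frechet_derivative) (simp add: higher_differentiable_on_1)
    have "frechet_derivative H (at y) v = frechet_derivative H (at y) (\<Sum>b\<in>Basis. (v \<bullet> b) *\<^sub>R b)"
      by (simp add: euclidean_representation)
    also have "\<dots> = (\<Sum>b\<in>Basis. (v \<bullet> b) * frechet_derivative H (at y) b)"
      by (simp add: linear_sum[OF lin] linear_cmul[OF lin])
    also have "\<bar>\<dots>\<bar> \<le> (\<Sum>b\<in>Basis. norm v * Bd b)"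
    proof (rule order_trans[OF sum_abs], rule sum_mono)
      fix b :: 'a assume "b \<in> Basis"
      then show "\<bar>v \<bullet> b * frechet_derivative H (at y) b\<bar> \<le> norm v * Bd b"
        unfolding abs_mult using Basis_le_norm Bd by (intro mult_mono) auto
    qed
    finally show ?thesis by (simp add: sum_distrib_left)
  qed
  then show ?thesis using that[of "\<Sum>b\<in>Basis. Bd b"] Bd0 by (simp add: sum_nonneg)
qed

lemma convolve_tendsto:
  fixes h :: "'a::euclidean_space \<Rightarrow> real"
  assumes h: "continuous_on UNIV h" and k: "\<And>n. mollifier (e n) (k n)" and e: "e \<longlonglongrightarrow> 0"
  shows "(\<lambda>n. convolve h (k n) y) \<longlonglongrightarrow> h y"
proof (rule LIMSEQ_I)
  fix \<epsilon> :: real assume \<epsilon>: "\<epsilon> > 0"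
  have "isCont h y" using h continuous_on_eq_continuous_at by blast
  then obtain d where d: "d > 0" "\<And>z. dist z y < d \<Longrightarrow> dist (h z) (h y) < \<epsilon> / 2"
    unfolding continuous_at_eps_delta using \<epsilon> by (metis half_gt_zero)
  obtain N where N: "\<And>n. n \<ge> N \<Longrightarrow> e n < d"
    using order_tendstoD(2)[OF e d(1)] by (auto simp: eventually_sequentially)
  have "\<bar>convolve h (k n) y - h y\<bar> \<le> \<epsilon> / 2" if "n \<ge> N" for n
  proof (rule convolve_near[OF k h])
    fix z :: 'a assume "norm z < e n"
    then have "dist (y - z) y < d" using N[OF that] by (simp add: dist_norm)
    then show "\<bar>h (y - z) - h y\<bar> \<le> \<epsilon> / 2" using d(2) by (fastforce simp: dist_real_def)
  qed
  then show "\<exists>N. \<forall>n\<ge>N. norm (convolve h (k n) y - h y) < \<epsilon>" using \<epsilon> by (intro exI[of _ N]) force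
qed

context riemannian_manifold
begin

text \<open>The factor 4 / (3 r^2) is chosen so that the argument reaches 1 at coordinate distance
  r/2, where r^2 - r^2/4 = 3/4 r^2, and 0 at distance \<open>r\<close>.\<close>

definition chart_bump :: "('a, 'n) chart \<Rightarrow> 'a \<Rightarrow> real \<Rightarrow> 'a \<Rightarrow> real" where
  "chart_bump c p r q = (if q \<in> fst c
     then C1_step (4 / 3 / r\<^sup>2 * (r\<^sup>2 - (snd c q - snd c p) \<bullet> (snd c q - snd c p))) else 0)"

lemma chart_bump:
  assumes c: "c \<in> A" and r: "r > 0" "cball (snd c p) r \<subseteq> chart_image c"
  shows chart_bump_C1: "Ck_on 1 UNIV (chart_bump c p r)"
    and chart_bump_bounds: "0 \<le> chart_bump c p r q" "chart_bump c p r q \<le> 1"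
    and chart_bump_1: "q \<in> chart_inv c ` ball (snd c p) (r / 2) \<Longrightarrow> chart_bump c p r q = 1"
    and chart_bump_0: "q \<notin> chart_inv c ` cball (snd c p) r \<Longrightarrow> chart_bump c p r q = 0"
proof -
  let ?x = "snd c p"
  show "0 \<le> chart_bump c p r q" "chart_bump c p r q \<le> 1"
    by (simp_all add: chart_bump_def C1_step_bounds)
  show zero: "chart_bump c p r q = 0" if "q \<notin> chart_inv c ` cball ?x r" for q
  proof (cases "q \<in> fst c")
    case True
    have "snd c q \<notin> cball ?x r" using that chart_inv_snd[OF c True] by (metis image_eqI)
    then have "r < norm (snd c q - ?x)" by (simp add: dist_norm norm_minus_commute)
    then have "r\<^sup>2 < (snd c q - ?x) \<bullet> (snd c q - ?x)"
      using r(1) by (metis power2_norm_eq_inner power_strict_mono less_imp_le zero_less_numeral)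
    then have "4 / 3 / r\<^sup>2 * (r\<^sup>2 - (snd c q - ?x) \<bullet> (snd c q - ?x)) \<le> 0"
      by (intro mult_nonneg_nonpos) auto
    then show ?thesis using True by (simp add: chart_bump_def C1_step_0)
  qed (simp add: chart_bump_def)
  show "chart_bump c p r q = 1" if q: "q \<in> chart_inv c ` ball ?x (r / 2)"
  proof -
    obtain y where y: "y \<in> ball ?x (r / 2)" "q = chart_inv c y" using q by blast
    then have yi: "y \<in> chart_image c" using r by auto
    then have q': "q \<in> fst c" "snd c q = y" using y chart_inv_in[OF c] snd_chart_inv[OF c] by auto
    have "norm (y - ?x) \<le> r / 2" using y by (simp add: dist_norm norm_minus_commute)
    then have "(y - ?x) \<bullet> (y - ?x) \<le> (r / 2)\<^sup>2"
      by (metis power2_norm_eq_inner power_mono norm_ge_zero)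
    then have "3 / 4 * r\<^sup>2 \<le> r\<^sup>2 - (y - ?x) \<bullet> (y - ?x)" by (simp add: power2_eq_square)
    then have "4 / 3 / r\<^sup>2 * (3 / 4 * r\<^sup>2) \<le> 4 / 3 / r\<^sup>2 * (r\<^sup>2 - (y - ?x) \<bullet> (y - ?x))"
      by (intro mult_left_mono) auto
    then have "1 \<le> 4 / 3 / r\<^sup>2 * (r\<^sup>2 - (y - ?x) \<bullet> (y - ?x))" using r by simp
    then show ?thesis using q' by (simp add: chart_bump_def C1_step_1)
  qed
  note bp = ball_preimage[OF c r(2)]
  show "Ck_on 1 UNIV (chart_bump c p r)"
  proof (rule Ck_on_extend_zero[OF c _ _ zero])
    show "closed (chart_inv c ` cball ?x r)" using bp(2) compact_imp_closed by blast
    show "chart_inv c ` cball ?x r \<subseteq> fst c" using chart_inv_in[OF c] r(2) by auto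
    have lin: "higher_differentiable_on UNIV (\<lambda>y::real^'n. y \<bullet> b - ?x \<bullet> b) 1" for b
      by (intro higher_differentiable_on_diff higher_differentiable_on_const open_UNIV
          higher_differentiable_on_linear bounded_linear_inner_left)
    have "higher_differentiable_on UNIV (\<lambda>y::real^'n. 4 / 3 / r\<^sup>2 * (r\<^sup>2 - (\<Sum>b\<in>Basis. (y \<bullet> b - ?x \<bullet> b) * (y \<bullet> b - ?x \<bullet> b)))) 1"
      by (intro higher_differentiable_on_diff higher_differentiable_on_sum higher_differentiable_on_mult
          higher_differentiable_on_const open_UNIV lin)
    then have "higher_differentiable_on UNIV (\<lambda>y::real^'n. 4 / 3 / r\<^sup>2 * (r\<^sup>2 - (y - ?x) \<bullet> (y - ?x))) 1"
      by (subst euclidean_inner) (simp only: inner_diff_left)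
    from higher_differentiable_on_compose[OF open_UNIV this C1_step_C1]
    have "higher_differentiable_on UNIV (\<lambda>y::real^'n. C1_step (4 / 3 / r\<^sup>2 * (r\<^sup>2 - (y - ?x) \<bullet> (y - ?x)))) 1"
      by (simp add: comp_def)
    then have "higher_differentiable_on (chart_image c) (\<lambda>y::real^'n. C1_step (4 / 3 / r\<^sup>2 * (r\<^sup>2 - (y - ?x) \<bullet> (y - ?x)))) 1"
      by (rule higher_differentiable_on_subset) simp
    then show "higher_differentiable_on (chart_image c) (chart_bump c p r \<circ> chart_inv c) 1"
      by (rule higher_differentiable_on_cong[OF chart_open(2)[OF c], rotated])
        (simp add: chart_bump_def chart_inv_in[OF c] snd_chart_inv[OF c])
  qed
qed

definition pullback :: "('a, 'n) chart \<Rightarrow> ('a \<Rightarrow> real) \<Rightarrow> real^'n \<Rightarrow> real" where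
  "pullback c \<psi> y = (if y \<in> chart_image c then \<psi> (chart_inv c y) else 0)"

text \<open>Since the support is compact in the chart, the representative extended by 0 is C^1 on
  the whole Euclidean space, where convolution and partial integration are carried out.\<close>

lemma chart_pullback:
  assumes c: "c \<in> A" and K: "compact K" "K \<subseteq> fst c" and \<psi>: "Ck_on 1 UNIV \<psi>" "\<forall>p. p \<notin> K \<longrightarrow> \<psi> p = 0"
  defines "H \<equiv> pullback c \<psi>"
  shows "compact (snd c ` K)" "snd c ` K \<subseteq> chart_image c" "\<And>y. y \<notin> snd c ` K \<Longrightarrow> H y = 0"
    "higher_differentiable_on UNIV H 1"
    "\<And>p. p \<in> fst c \<Longrightarrow> dform \<psi> c p = frechet_derivative H (at (snd c p))"
proof -
  show cK: "compact (snd c ` K)"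
    by (rule compact_continuous_image[OF continuous_on_subset[OF continuous_on_chart[OF c]]]) (use K in auto)
  show sub: "snd c ` K \<subseteq> chart_image c" using K by (auto simp: chart_image_def)
  show zero: "H y = 0" if "y \<notin> snd c ` K" for y
  proof (cases "y \<in> chart_image c")
    case True
    then have "chart_inv c y \<notin> K" using that snd_chart_inv[OF c True] by (metis image_eqI)
    then show ?thesis using \<psi>(2) by (simp add: H_def pullback_def)
  qed (simp add: H_def pullback_def)
  have "higher_differentiable_on (chart_image c) (\<psi> \<circ> chart_inv c) 1"
    using \<psi>(1) c unfolding Ck_on_def by (metis Int_UNIV_right chart_image_def)
  then have H1: "higher_differentiable_on (chart_image c) H 1"
    by (rule higher_differentiable_on_cong[OF chart_open(2)[OF c], rotated]) (simp add: H_def pullback_def)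
  show "higher_differentiable_on UNIV H 1"
    by (rule higher_differentiable_on_extend_zero[OF chart_open(2)[OF c] compact_imp_closed[OF cK] sub _ H1]) (rule zero)
  show "dform \<psi> c p = frechet_derivative H (at (snd c p))" if "p \<in> fst c" for p
    unfolding dform_def
    by (rule frechet_derivative_cong_open[OF chart_open(2)[OF c] snd_in[OF that]]) (simp add: H_def pullback_def)
qed

section \<open>From the differential inequality to C^1 test functions\<close>

context
  fixes \<phi> :: "real \<Rightarrow> real" and u :: "'a \<Rightarrow> real"
  assumes u: "Ck_on 1 UNIV u" and \<phi>: "continuous_on {0..} \<phi>" "\<phi> 0 = 0"
begin

abbreviation "flux \<equiv> phi_gradient G \<phi> u"
abbreviation "pairing \<equiv> pairing_gradient A G flux"

lemma pairing_eq:
  "c \<in> A \<Longrightarrow> p \<in> fst c \<Longrightarrow> Ck_on 1 UNIV \<psi> \<Longrightarrow> pairing \<psi> p = dform \<psi> c p (flux c p)"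
  by (rule pairing_phi_gradient[OF _ _ u UNIV_I _ UNIV_I])

lemma continuous_on_pairing:
  assumes \<psi>: "Ck_on 1 UNIV \<psi>" shows "continuous_on UNIV (pairing \<psi>)"
proof (rule continuous_at_imp_continuous_on, rule ballI)
  fix p
  obtain c where c: "c \<in> A" "p \<in> fst c" using ex_chart by blast
  have "continuous_on (fst c) (\<lambda>q. dform \<psi> c q (flux c q))"
    by (rule continuous_on_dform[OF c(1) \<psi> continuous_on_phi_gradient[OF c(1) u \<phi>]])
  then have "continuous_on (fst c) (pairing \<psi>)"
    by (rule continuous_on_eq) (simp add: pairing_eq[OF c(1) _ \<psi>])
  then show "isCont (pairing \<psi>) p" using c chart_open(1)[OF c(1)] continuous_on_eq_continuous_at by blast
qed

lemma pairing_off_support: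
  assumes "Ck_on 1 UNIV \<psi>" "closed K" "\<And>q. q \<notin> K \<Longrightarrow> \<psi> q = 0" "p \<notin> K"
  shows "pairing \<psi> p = 0"
proof -
  obtain c where c: "c \<in> A" "p \<in> fst c" using ex_chart by blast
  show ?thesis unfolding pairing_eq[OF c assms(1)] by (rule dform_off_support[OF assms(2-4) c])
qed

lemma pairing_add:
  assumes "Ck_on 1 UNIV f" "Ck_on 1 UNIV g"
  shows "pairing (\<lambda>q. f q + g q) p = pairing f p + pairing g p"
proof -
  obtain c where c: "c \<in> A" "p \<in> fst c" using ex_chart by blast
  show ?thesis
    using pairing_eq[OF c] dform_add[OF assms UNIV_I c] Ck_on_add[OF open_UNIV assms] assms by simp
qed

lemma integrable_pairing:
  assumes "Ck_on 1 UNIV \<psi>" "compact K" "\<And>q. q \<notin> K \<Longrightarrow> \<psi> q = 0"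
  shows "integrable vol (pairing \<psi>)"
  by (rule integrable_compact_support[OF continuous_on_pairing[OF assms(1)] assms(2)])
    (rule pairing_off_support[OF assms(1) compact_imp_closed[OF assms(2)] assms(3)])

definition weak_ge :: "('a \<Rightarrow> real) \<Rightarrow> ('a \<Rightarrow> real) \<Rightarrow> bool" where
  "weak_ge h \<psi> \<longleftrightarrow> (LINT x|vol. h x * \<psi> x) \<le> - (LINT x|vol. pairing \<psi> x)"

text \<open>Mollifying in the chart yields admissible smooth test functions whose values and
  differentials converge pointwise with uniform bounds and a common compact support, so both
  integrals pass to the limit.\<close>

lemma weak_ge_chart_distributional:
  assumes dist: "distributional_div_ge A G W flux h" and h: "continuous_on UNIV h" and W: "open W"
    and c: "c \<in> A" and K: "compact K" "K \<subseteq> fst c \<inter> W"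
    and \<psi>: "Ck_on 1 UNIV \<psi>" "\<And>p. p \<notin> K \<Longrightarrow> \<psi> p = 0" "\<And>p. \<psi> p \<ge> 0"
  shows "weak_ge h \<psi>"
proof -
  define H where "H = pullback c \<psi>"
  have Kc: "K \<subseteq> fst c" using K by blast
  have \<psi>0: "\<forall>p. p \<notin> K \<longrightarrow> \<psi> p = 0" using \<psi>(2) by blast
  note pb = chart_pullback[OF c K(1) Kc \<psi>(1) \<psi>0, folded H_def]
  have Hn: "H y \<ge> 0" for y by (simp add: H_def pullback_def \<psi>(3))
  have cH: "continuous_on UNIV H" using pb(4) higher_differentiable_on_Suc_imp_continuous by blast
  let ?O = "snd c ` (fst c \<inter> W)"
  have "snd c ` K \<subseteq> ?O" using K by blast
  \<comment> \<open>Compactness leaves a margin around the support, and mollification at scales up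
    to \<open>e0\<close> stays inside the chart and inside \<open>W\<close>.\<close>
  then obtain e0 where e0: "e0 > 0" "(\<Union>x\<in>snd c ` K. cball x e0) \<subseteq> ?O"
    using compact_subset_open_imp_cball_epsilon_subset[OF pb(1) open_chart_image_Int[OF c W]] by blast
  define e where "e n = e0 / real (Suc n)" for n
  have e: "e n > 0" "e n \<le> e0" for n using e0(1) by (auto simp: e_def field_simps)
  have e_lim: "e \<longlonglongrightarrow> 0"
    using tendsto_mult_left[OF LIMSEQ_inverse_real_of_nat, of e0] by (simp add: e_def[abs_def] divide_inverse)
  have "\<forall>n. \<exists>k::real^'n \<Rightarrow> real. mollifier (e n) k" using ex_mollifier e(1) by blast
  then obtain k where k: "\<And>n. mollifier (e n) (k n :: real^'n \<Rightarrow> real)" by metis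
  define K2 where "K2 = {x + y |x y. x \<in> snd c ` K \<and> y \<in> cball (0::real^'n) e0}"
  have K2: "compact K2" unfolding K2_def by (rule compact_sums[OF pb(1) compact_cball])
  have K2O: "K2 \<subseteq> ?O"
  proof
    fix z assume "z \<in> K2"
    then obtain x y where "x \<in> snd c ` K" "y \<in> cball 0 e0" "z = x + y" unfolding K2_def by blast
    then have "z \<in> cball x e0" by (simp add: dist_norm)
    then show "z \<in> ?O" using e0(2) \<open>x \<in> snd c ` K\<close> by blast
  qed
  have kz: "\<forall>x. norm x \<ge> e n \<longrightarrow> k n x = 0" and ks: "\<And>j. higher_differentiable_on UNIV (k n) j" for n
    using k[of n] unfolding mollifier_def by blast+
  have conv0: "convolve H (k n) y = 0" if y: "y \<notin> K2" for n y
  proof -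
    have "H (y - z) * k n z = 0" for z
    proof (cases "norm z < e n")
      case True
      have "y - z \<notin> snd c ` K"
      proof
        assume "y - z \<in> snd c ` K"
        moreover have "z \<in> cball 0 e0" using True e(2)[of n] by simp
        ultimately have "(y - z) + z \<in> K2" unfolding K2_def by blast
        then show False using y by simp
      qed
      then show ?thesis using pb(3) by simp
    qed (use kz[of n] in simp)
    then have "(\<lambda>z. H (y - z) * k n z) = (\<lambda>_. 0)" by (rule ext)
    then show ?thesis by (simp add: convolve_def)
  qed
  define L where "L = chart_inv c ` K2"
  have K2c: "K2 \<subseteq> chart_image c" using K2O by (auto simp: chart_image_def)
  have L: "compact L" unfolding L_def
    by (rule compact_continuous_image[OF continuous_on_subset[OF continuous_on_chart_inv[OF c] K2c] K2])
  have LW: "L \<subseteq> fst c" "L \<subseteq> W"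
  proof -
    have "chart_inv c x \<in> fst c \<inter> W" if "x \<in> K2" for x
      using K2O that chart_inv_snd[OF c] by auto
    then show "L \<subseteq> fst c" "L \<subseteq> W" unfolding L_def by blast+
  qed
  have clL: "closed L" by (rule compact_imp_closed[OF L])
  define \<psi>n where "\<psi>n n p = (if p \<in> fst c then convolve H (k n) (snd c p) else 0)" for n p
  have \<psi>n0: "\<psi>n n p = 0" if "p \<notin> L" for n p
  proof (cases "p \<in> fst c")
    case True
    then have "snd c p \<notin> K2" using that chart_inv_snd[OF c True] unfolding L_def by (metis image_eqI)
    then show ?thesis by (simp add: \<psi>n_def conv0)
  qed (simp add: \<psi>n_def)
  have \<psi>ns: "Ck_on j UNIV (\<psi>n n)" for j n
  proof (rule Ck_on_extend_zero[OF c clL LW(1) \<psi>n0])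
    have "higher_differentiable_on (chart_image c) (convolve H (k n)) j"
      by (rule higher_differentiable_on_subset[OF convolve_smooth[OF kz cH ks]]) simp
    then show "higher_differentiable_on (chart_image c) (\<psi>n n \<circ> chart_inv c) j"
      by (rule higher_differentiable_on_cong[OF chart_open(2)[OF c], rotated])
        (simp add: \<psi>n_def chart_inv_in[OF c] snd_chart_inv[OF c])
  qed
  have \<psi>nn: "\<psi>n n p \<ge> 0" for n p using convolve_nonneg[OF k Hn] by (simp add: \<psi>n_def)
  have ineq: "(LINT x|vol. h x * \<psi>n n x) \<le> - (LINT x|vol. pairing (\<psi>n n) x)" for n
  proof -
    have sub: "closure {x. \<psi>n n x \<noteq> 0} \<subseteq> L" by (rule closure_minimal[OF _ clL]) (use \<psi>n0 in blast)
    then have "closure {x. \<psi>n n x \<noteq> 0} = L \<inter> closure {x. \<psi>n n x \<noteq> 0}" by blast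
    then have "compact (closure {x. \<psi>n n x \<noteq> 0})" using compact_Int_closed[OF L closed_closure] by metis
    then have "test_function_on A W (\<psi>n n)"
      unfolding test_function_on_def smooth_function_iff using \<psi>ns sub LW(2) by blast
    then show ?thesis using dist \<psi>nn unfolding distributional_div_ge_def by blast
  qed
  obtain BH where BH: "BH \<ge> 0" "\<And>y. \<bar>H y\<bar> \<le> BH" using bounded_compact_support[OF cH pb(1,3)] by blast
  have "bounded (h ` L)"
    by (intro compact_imp_bounded compact_continuous_image continuous_on_subset[OF h] L) simp
  then obtain Bh where Bh: "\<And>p. p \<in> L \<Longrightarrow> \<bar>h p\<bar> \<le> Bh" by (auto simp: bounded_iff)
  have ind: "integrable vol (\<lambda>p. B * indicator L p)" for B :: real
    using emeasure_vol_compact[OF L] clL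
    by (intro integrable_mult_right integrable_real_indicator) (auto simp: borel_closed)
  have meas: "F \<in> borel_measurable vol" if "continuous_on UNIV F" for F :: "'a \<Rightarrow> real"
    using borel_measurable_continuous_onI[OF that] measurable_cong_sets[OF sets_vol refl, of borel] by simp
  have lim1: "(\<lambda>n. LINT x|vol. h x * \<psi>n n x) \<longlonglongrightarrow> (LINT x|vol. h x * \<psi> x)"
  proof (rule integral_dominated_convergence[where w="\<lambda>p. (\<bar>Bh\<bar> * BH) * indicator L p"])
    show "(\<lambda>x. h x * \<psi> x) \<in> borel_measurable vol"
      by (intro meas continuous_intros h Ck_on_continuous[OF \<psi>(1) open_UNIV])
    show "(\<lambda>x. h x * \<psi>n n x) \<in> borel_measurable vol" for n
      by (intro meas continuous_intros h Ck_on_continuous[OF \<psi>ns[of 1] open_UNIV])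
    show "AE x in vol. (\<lambda>n. h x * \<psi>n n x) \<longlonglongrightarrow> h x * \<psi> x"
    proof (rule AE_I2)
      fix p
      have "(\<lambda>n. \<psi>n n p) \<longlonglongrightarrow> \<psi> p"
      proof (cases "p \<in> fst c")
        case True
        then show ?thesis
          using convolve_tendsto[OF cH k e_lim, of "snd c p"] snd_in[OF True] chart_inv_snd[OF c True]
          by (simp add: \<psi>n_def H_def pullback_def)
      next
        case False
        then have "\<psi> p = 0" using \<psi>(2) Kc by blast
        then show ?thesis using False by (simp add: \<psi>n_def)
      qed
      then show "(\<lambda>n. h p * \<psi>n n p) \<longlonglongrightarrow> h p * \<psi> p" by (rule tendsto_mult_left)
    qed
    show "AE x in vol. norm (h x * \<psi>n n x) \<le> \<bar>Bh\<bar> * BH * indicator L x" for n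
    proof (rule AE_I2)
      fix p
      show "norm (h p * \<psi>n n p) \<le> \<bar>Bh\<bar> * BH * indicator L p"
      proof (cases "p \<in> L")
        case True
        have "\<bar>convolve H (k n) y - 0\<bar> \<le> BH" for y by (rule convolve_near[OF k cH]) (simp add: BH)
        then have "\<bar>\<psi>n n p\<bar> \<le> BH" using BH(1) by (simp add: \<psi>n_def)
        moreover have "\<bar>h p\<bar> \<le> \<bar>Bh\<bar>" using Bh[OF True] by linarith
        ultimately show ?thesis using True by (simp add: abs_mult mult_mono')
      qed (simp add: \<psi>n0)
    qed
  qed (rule ind)
  have "bounded (flux c ` L)"
    by (intro compact_imp_bounded compact_continuous_image continuous_on_subset[OF continuous_on_phi_gradient[OF c u \<phi>]] L LW)
  then obtain BX where BX: "\<And>p. p \<in> L \<Longrightarrow> norm (flux c p) \<le> BX" by (auto simp: bounded_iff)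
  define Hd where "Hd v x = frechet_derivative H (at x) v" for v x
  have cHd: "continuous_on UNIV (Hd v)" for v using pb(4) unfolding higher_differentiable_on_1 Hd_def by blast
  obtain BD where BD0: "BD \<ge> 0" "\<And>y v. \<bar>frechet_derivative H (at y) v\<bar> \<le> norm v * BD"
    by (rule C1_compact_support_derivative_bound[OF pb(4,1)]) (use pb(3) in blast)+
  have BD: "\<bar>Hd v y\<bar> \<le> norm v * BD" for v y using BD0(2) by (simp add: Hd_def)
  \<comment> \<open>The flux vector is frozen at \<open>p\<close>; the pairing is then the
    mollification of one directional derivative of \<open>H\<close>, evaluated at
    \<open>snd c p\<close>.\<close>
  have pr\<psi>n: "pairing (\<psi>n n) p = convolve (Hd (flux c p)) (k n) (snd c p)" if p: "p \<in> fst c" for n p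
  proof -
    have "dform (\<psi>n n) c p = frechet_derivative (convolve H (k n)) (at (snd c p))"
      unfolding dform_def
      by (rule frechet_derivative_cong_open[OF chart_open(2)[OF c] snd_in[OF p]])
        (simp add: \<psi>n_def chart_inv_in[OF c] snd_chart_inv[OF c])
    also have "\<dots> = (\<lambda>v. convolve (Hd v) (k n) (snd c p))"
    proof -
      have ck: "continuous_on UNIV (k n)" using ks[of n 0] by simp
      show ?thesis unfolding Hd_def
        by (rule frechet_derivative_eqI[OF convolve_has_derivative_function[OF kz ck pb(4)]])
    qed
    finally show ?thesis using pairing_eq[OF c p \<psi>ns] by simp
  qed
  have lim2: "(\<lambda>n. LINT x|vol. pairing (\<psi>n n) x) \<longlonglongrightarrow> (LINT x|vol. pairing \<psi> x)"
  proof (rule integral_dominated_convergence[where w="\<lambda>p. (\<bar>BX\<bar> * BD) * indicator L p"])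
    show "pairing \<psi> \<in> borel_measurable vol" by (intro meas continuous_on_pairing \<psi>(1))
    show "pairing (\<psi>n n) \<in> borel_measurable vol" for n by (intro meas continuous_on_pairing \<psi>ns)
    show "AE x in vol. (\<lambda>n. pairing (\<psi>n n) x) \<longlonglongrightarrow> pairing \<psi> x"
    proof (rule AE_I2)
      fix p
      show "(\<lambda>n. pairing (\<psi>n n) p) \<longlonglongrightarrow> pairing \<psi> p"
      proof (cases "p \<in> fst c")
        case True
        then show ?thesis
          using convolve_tendsto[OF cHd k e_lim, of "flux c p" "snd c p"]
          by (simp add: pr\<psi>n pairing_eq[OF c True \<psi>(1)] pb(5) Hd_def)
      next
        case False
        have z: "pairing (\<psi>n n) p = 0" for n
          by (rule pairing_off_support[OF \<psi>ns clL \<psi>n0]) (use False LW in auto)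
        have "pairing \<psi> p = 0"
          by (rule pairing_off_support[OF \<psi>(1) compact_imp_closed[OF K(1)] \<psi>(2)]) (use False Kc in auto)
        then show ?thesis by (simp add: z)
      qed
    qed
    show "AE x in vol. norm (pairing (\<psi>n n) x) \<le> \<bar>BX\<bar> * BD * indicator L x" for n
    proof (rule AE_I2)
      fix p
      show "norm (pairing (\<psi>n n) p) \<le> \<bar>BX\<bar> * BD * indicator L p"
      proof (cases "p \<in> L")
        case True
        then have p: "p \<in> fst c" using LW by blast
        have "\<bar>convolve (Hd (flux c p)) (k n) (snd c p) - 0\<bar> \<le> norm (flux c p) * BD"
          by (rule convolve_near[OF k cHd]) (simp add: BD)
        also have "\<dots> \<le> \<bar>BX\<bar> * BD"
          using BX[OF True] BD0(1) by (intro mult_right_mono) auto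
        finally show ?thesis using True pr\<psi>n[OF p] by simp
      next
        case False
        have "pairing (\<psi>n n) p = 0"
          by (rule pairing_off_support[OF \<psi>ns clL \<psi>n0 False])
        then show ?thesis using False by simp
      qed
    qed
  qed (rule ind)
  show ?thesis unfolding weak_ge_def
    by (rule LIMSEQ_le[OF lim1 tendsto_minus[OF lim2]]) (use ineq in blast)
qed

text \<open>The divergence theorem for \<psi> X, where X is the flux: in coordinates the density
  times div(\<psi> X) is a Euclidean divergence with compact support, which integrates to 0, and
  div(\<psi> X) is the sum of \<psi> div X and the pairing.\<close>

lemma weak_ge_chart_classical:
  assumes X: "C1_vector_field_on A W flux" and div: "classical_div_ge A G W flux h"
    and h: "continuous_on UNIV h" and W: "open W"
    and c: "c \<in> A" and K: "compact K" "K \<subseteq> fst c \<inter> W"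
    and \<psi>: "Ck_on 1 UNIV \<psi>" "\<And>p. p \<notin> K \<Longrightarrow> \<psi> p = 0" "\<And>p. \<psi> p \<ge> 0"
  shows "weak_ge h \<psi>"
proof -
  define H where "H = pullback c \<psi>"
  have Kc: "K \<subseteq> fst c" using K by blast
  have \<psi>0: "\<forall>p. p \<notin> K \<longrightarrow> \<psi> p = 0" using \<psi>(2) by blast
  note pb = chart_pullback[OF c K(1) Kc \<psi>(1) \<psi>0, folded H_def]
  let ?O = "snd c ` (fst c \<inter> W)" and ?K = "snd c ` K"
  have op: "open ?O" by (rule open_chart_image_Int[OF c W])
  have KO: "?K \<subseteq> ?O" using K by blast
  have clK: "closed ?K" by (rule compact_imp_closed[OF pb(1)])
  have Oc: "?O \<subseteq> chart_image c" by (auto simp: chart_image_def)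
  define Z where "Z i x = volume_density G c (chart_inv c x) * (flux c (chart_inv c x) $ i)" for i x
  have Z: "higher_differentiable_on ?O (Z i) 1" for i
  proof -
    have "higher_differentiable_on ?O (flux c \<circ> chart_inv c) 1" using X c unfolding C1_vector_field_on_def by blast
    from higher_differentiable_on_compose_linear[OF bounded_linear_vec_nth op this]
    have "higher_differentiable_on ?O (\<lambda>x. flux c (chart_inv c x) $ i) 1" by (simp add: comp_def)
    moreover have "higher_differentiable_on ?O (\<lambda>x. volume_density G c (chart_inv c x)) 1"
      by (rule higher_differentiable_on_subset[OF volume_density_C1[OF c] Oc])
    ultimately show ?thesis unfolding Z_def by (intro higher_differentiable_on_mult op)
  qed
  \<comment> \<open>Components of \<psi> X weighted by the volume density and extended by 0. The
    support lies inside the open set where the flux is C^1, so the extension is C^1.\<close>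
  define Y where "Y i x = (if x \<in> ?O then Z i x * H x else 0)" for i x
  have Y0: "Y i x = 0" if "x \<notin> ?K" for i x using pb(3)[OF that] by (simp add: Y_def)
  have ZH: "higher_differentiable_on ?O (\<lambda>x. Z i x * H x) 1" for i
    by (intro higher_differentiable_on_mult op Z higher_differentiable_on_subset[OF pb(4)]) simp
  have YO: "higher_differentiable_on ?O (Y i) 1" for i
    by (rule higher_differentiable_on_cong[OF op _ ZH[of i]]) (simp add: Y_def)
  have Y1: "higher_differentiable_on UNIV (Y i) 1" for i
    by (rule higher_differentiable_on_extend_zero[OF op clK KO _ YO]) (rule Y0)
  define S where "S x = (\<Sum>i\<in>UNIV. frechet_derivative (Y i) (at x) (axis i 1))" for x
  have Yd0: "frechet_derivative (Y i) (at x) v = 0" if "x \<notin> ?K" for i x v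
    by (rule frechet_derivative_off_support[OF clK _ that]) (rule Y0)
  have cYd: "continuous_on UNIV (\<lambda>x. frechet_derivative (Y i) (at x) v)" for i v
    using Y1 by (simp add: higher_differentiable_on_1)
  have cS: "continuous_on UNIV S" unfolding S_def by (intro continuous_on_sum cYd)
  have S0: "S x = 0" if "x \<notin> ?K" for x using Yd0[OF that] by (simp add: S_def)
  have intYd: "integrable lborel (\<lambda>x. frechet_derivative (Y i) (at x) v)" for i v
  proof -
    obtain B where B: "B \<ge> 0" "\<And>x. \<bar>frechet_derivative (Y i) (at x) v\<bar> \<le> B"
      using bounded_compact_support[OF cYd pb(1) Yd0] by blast
    have 1: "integrable lborel (\<lambda>x. B * indicator ?K x)"
      using emeasure_compact_finite[OF pb(1)] clK
      by (intro integrable_mult_right integrable_real_indicator) (auto simp: borel_closed)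
    have 2: "(\<lambda>x. frechet_derivative (Y i) (at x) v) \<in> borel_measurable lborel"
      using borel_measurable_continuous_onI[OF cYd] by simp
    have 3: "norm (frechet_derivative (Y i) (at x) v) \<le> norm (B * indicator ?K x)" for x
      using B Yd0[of x i v] by (cases "x \<in> ?K") auto
    show ?thesis by (rule Bochner_Integration.integrable_bound[OF 1 2 AE_I2[OF 3]])
  qed
  have "(LINT x|lborel. S x) = 0"
    unfolding S_def using intYd integral_derivative_compact_support[OF Y1 pb(1) Y0] by simp
  have S_eq: "S x = volume_density G c p * (divergence G flux c p * \<psi> p + pairing \<psi> p)"
    if p: "p \<in> fst c" "p \<in> W" "x = snd c p" for x p
  proof -
    have x: "x \<in> ?O" using p by blast
    have d: "volume_density G c p > 0" using volume_density_pos[OF c p(1)] .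
    have HD: "(H has_derivative frechet_derivative H (at x)) (at x)"
      using pb(4) by (simp add: higher_differentiable_on_1 frechet_derivative_works[symmetric])
    have ZD: "(Z i has_derivative frechet_derivative (Z i) (at x)) (at x)" for i
      using Z[of i] x unfolding higher_differentiable_on_1 frechet_derivative_works by blast
    have Hx: "H x = \<psi> p" using p snd_in[of p c] by (simp add: H_def pullback_def chart_inv_snd[OF c])
    have Yd: "frechet_derivative (Y i) (at x) v = Z i x * frechet_derivative H (at x) v + frechet_derivative (Z i) (at x) v * H x" for i v
    proof -
      have "frechet_derivative (Y i) (at x) = frechet_derivative (\<lambda>x. Z i x * H x) (at x)"
        by (rule frechet_derivative_cong_open[OF op x]) (simp add: Y_def)
      also have "\<dots> = (\<lambda>v. Z i x * frechet_derivative H (at x) v + frechet_derivative (Z i) (at x) v * H x)"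
        by (rule frechet_derivative_eqI[OF has_derivative_mult[OF ZD HD]])
      finally show ?thesis by simp
    qed
    have lin: "linear (frechet_derivative H (at x))" using HD has_derivative_linear by blast
    have "(\<Sum>i\<in>UNIV. Z i x * frechet_derivative H (at x) (axis i 1)) =
        volume_density G c p * (\<Sum>i\<in>UNIV. flux c p $ i * frechet_derivative H (at x) (axis i 1))"
      by (simp add: Z_def p(3) chart_inv_snd[OF c p(1)] sum_distrib_left mult.assoc)
    also have "(\<Sum>i\<in>UNIV. flux c p $ i * frechet_derivative H (at x) (axis i 1)) =
        frechet_derivative H (at x) (\<Sum>i\<in>UNIV. flux c p $ i *\<^sub>R axis i 1)"
      by (simp add: linear_sum[OF lin] linear_cmul[OF lin])
    also have "(\<Sum>i\<in>UNIV. flux c p $ i *\<^sub>R axis i (1::real)) = flux c p"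
      by (simp add: basis_expansion scalar_mult_eq_scaleR[symmetric])
    also have "frechet_derivative H (at x) (flux c p) = pairing \<psi> p"
      using pairing_eq[OF c p(1) \<psi>(1)] pb(5)[OF p(1)] p(3) by simp
    finally have 1: "(\<Sum>i\<in>UNIV. Z i x * frechet_derivative H (at x) (axis i 1)) = volume_density G c p * pairing \<psi> p" .
    have "divergence G flux c p = (1 / volume_density G c p) * (\<Sum>i\<in>UNIV. frechet_derivative (Z i) (at x) (axis i 1))"
      by (simp add: divergence_def partial_deriv_def Z_def[abs_def] p(3))
    then have 2: "(\<Sum>i\<in>UNIV. frechet_derivative (Z i) (at x) (axis i 1)) = volume_density G c p * divergence G flux c p"
      using d by simp
    show ?thesis unfolding S_def Yd sum.distrib 1 sum_distrib_right[symmetric] 2 Hx by (simp add: algebra_simps)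
  qed
  \<comment> \<open>This is div(\<psi> X) as a function on the manifold, recovered from its weighted
    coordinate form.\<close>
  define F where "F p = (if p \<in> fst c then S (snd c p) / volume_density G c p else 0)" for p
  have F_eq: "F p = divergence G flux c p * \<psi> p + pairing \<psi> p" if "p \<in> fst c" "p \<in> W" for p
    using S_eq[OF that refl] volume_density_pos[OF c that(1)] that by (simp add: F_def)
  have F0: "F p = 0" if "p \<notin> K" for p
  proof (cases "p \<in> fst c")
    case True
    have "snd c p \<notin> ?K"
    proof
      assume "snd c p \<in> ?K"
      then obtain q where "q \<in> K" "snd c p = snd c q" by blast
      then have "p = q" using chart_inv_snd[OF c] True Kc by (metis subsetD)
      then show False using that \<open>q \<in> K\<close> by simp
    qed
    then show ?thesis by (simp add: F_def S0)
  qed (simp add: F_def)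
  have "continuous_on (fst c) (\<lambda>p. S (snd c p) / volume_density G c p)"
  proof (intro continuous_on_divide)
    show "continuous_on (fst c) (\<lambda>p. S (snd c p))"
      by (rule continuous_on_compose2[OF cS continuous_on_chart[OF c]]) simp
    have "continuous_on (fst c) (\<lambda>p. volume_density G c (chart_inv c (snd c p)))"
      by (rule continuous_on_compose2[OF volume_density_continuous[OF c] continuous_on_chart[OF c]])
        (use snd_in[of _ c] in auto)
    then show "continuous_on (fst c) (volume_density G c)"
      by (rule continuous_on_eq) (simp add: chart_inv_snd[OF c])
    show "\<forall>p\<in>fst c. volume_density G c p \<noteq> 0" using volume_density_pos[OF c] by force
  qed
  then have "continuous_on (fst c) F" by (rule continuous_on_eq) (simp add: F_def)
  then have cF: "continuous_on UNIV F"
    by (rule continuous_on_extend_zero[OF _ chart_open(1)[OF c] compact_imp_closed[OF K(1)] Kc F0])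
  have "(LINT p|vol. F p) = (LINT x|lborel. chart_dens c x * F (chart_inv c x))"
    by (rule integral_vol_chart[OF c borel_measurable_continuous_onI[OF cF]]) (simp add: F_def)
  also have "\<dots> = (LINT x|lborel. S x)"
  proof (rule Bochner_Integration.integral_cong[OF refl])
    fix x
    show "chart_dens c x * F (chart_inv c x) = S x"
    proof (cases "x \<in> chart_image c")
      case True
      then show ?thesis using volume_density_pos[OF c chart_inv_in[OF c True]]
        by (simp add: chart_dens_def F_def chart_inv_in[OF c] snd_chart_inv[OF c])
    next
      case False
      then have "x \<notin> ?K" using pb(2) by blast
      then show ?thesis using False by (simp add: chart_dens_def S0)
    qed
  qed
  finally have intF: "(LINT p|vol. F p) = 0" using \<open>(LINT x|lborel. S x) = 0\<close> by simp
  have i1: "integrable vol (\<lambda>p. h p * \<psi> p)"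
    by (rule integrable_compact_support[OF _ K(1)]) (auto intro!: continuous_intros h Ck_on_continuous[OF \<psi>(1)] simp: \<psi>(2))
  have i2: "integrable vol (pairing \<psi>)" by (rule integrable_pairing[OF \<psi>(1) K(1) \<psi>(2)])
  have "(LINT p|vol. h p * \<psi> p) + (LINT p|vol. pairing \<psi> p) = (LINT p|vol. h p * \<psi> p + pairing \<psi> p)"
    using i1 i2 by simp
  also have "\<dots> \<le> (LINT p|vol. F p)"
  proof (rule integral_mono)
    show "integrable vol (\<lambda>p. h p * \<psi> p + pairing \<psi> p)" using i1 i2 by simp
    show "integrable vol F" by (rule integrable_compact_support[OF cF K(1) F0])
    fix p
    show "h p * \<psi> p + pairing \<psi> p \<le> F p"
    proof (cases "p \<in> K")
      case True
      then have p: "p \<in> fst c" "p \<in> W" using K by auto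
      have "h p \<le> divergence G flux c p" using div c p unfolding classical_div_ge_def by blast
      then show ?thesis using F_eq[OF p] \<psi>(3)[of p] by (simp add: mult_right_mono)
    next
      case False
      then show ?thesis using F0 \<psi>(2) pairing_off_support[OF \<psi>(1) compact_imp_closed[OF K(1)] \<psi>(2) False] by simp
    qed
  qed
  finally show ?thesis unfolding weak_ge_def intF by simp
qed

text \<open>The weak inequality is additive in the test function. An induction over a finite cover
  by coordinate balls splits off, at each step, a summand supported in a single chart.\<close>

lemma weak_ge_C1:
  assumes div: "div_ge_on A G W flux h" and h: "continuous_on UNIV h" and W: "open W"
    and K: "compact K" "K \<subseteq> W"
    and \<psi>: "Ck_on 1 UNIV \<psi>" "\<And>p. p \<notin> K \<Longrightarrow> \<psi> p = 0" "\<And>p. \<psi> p \<ge> 0"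
  shows "weak_ge h \<psi>"
proof -
  \<comment> \<open>Classical and distributional readings give the same conclusion within one chart;
    from here on the distinction is gone.\<close>
  have chart: "weak_ge h \<psi>"
    if "c \<in> A" "compact K" "K \<subseteq> fst c \<inter> W" "Ck_on 1 UNIV \<psi>" "\<And>p. p \<notin> K \<Longrightarrow> \<psi> p = 0" "\<And>p. \<psi> p \<ge> 0" for c K \<psi>
    using div weak_ge_chart_classical[OF _ _ h W that] weak_ge_chart_distributional[OF _ h W that]
    unfolding div_ge_on_def by (metis (full_types))
  have "\<forall>p. \<exists>c r. c \<in> A \<and> p \<in> fst c \<and> r > 0 \<and> cball (snd c p) r \<subseteq> chart_image c"
    using ex_chart chart_open(2) snd_in open_contains_cball by metis
  then obtain C R where C: "\<And>p. C p \<in> A" "\<And>p. p \<in> fst (C p)" and R: "\<And>p. R p > (0::real)"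
    "\<And>p. cball (snd (C p) p) (R p) \<subseteq> chart_image (C p)"
    by metis
  define V where "V p = chart_inv (C p) ` ball (snd (C p) p) (R p / 2)" for p
  define \<beta> where "\<beta> p = chart_bump (C p) p (R p)" for p
  note bump = chart_bump[OF C(1) R, folded \<beta>_def]
  have half: "cball (snd (C p) p) (R p / 2) \<subseteq> chart_image (C p)" for p
  proof -
    have "cball (snd (C p) p) (R p / 2) \<subseteq> cball (snd (C p) p) (R p)" using R(1)[of p] by (intro subset_cball) simp
    then show ?thesis using R(2) by (rule order_trans)
  qed
  have V: "open (V p)" "p \<in> V p" for p
  proof -
    show "open (V p)" unfolding V_def by (rule ball_preimage(1)[OF C(1) half])
    have "p = chart_inv (C p) (snd (C p) p)" by (simp add: chart_inv_snd[OF C])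
    then show "p \<in> V p" unfolding V_def using R(1)[of p] by (intro image_eqI[of _ _ "snd (C p) p"]) auto
  qed
  have main: "weak_ge h \<psi>"
    if "finite F" "compact K" "K \<subseteq> W" "K \<subseteq> (\<Union>p\<in>F. V p)" "Ck_on 1 UNIV \<psi>" "\<And>p. p \<notin> K \<Longrightarrow> \<psi> p = 0" "\<And>p. \<psi> p \<ge> 0"
    for F K \<psi>
    using that
  proof (induction F arbitrary: K \<psi> rule: finite_induct)
    case empty
    then have "\<psi> = (\<lambda>_. 0)" by auto
    moreover have "pairing (\<lambda>_. 0) q = 0" for q
      by (rule pairing_off_support[of _ "{}"]) (auto simp: Ck_on_const)
    ultimately show ?case by (simp add: weak_ge_def)
  next
    case (insert a F)
    let ?L = "chart_inv (C a) ` cball (snd (C a) a) (R a)"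
    let ?f = "\<lambda>p. \<beta> a p * \<psi> p" and ?g = "\<lambda>p. (1 - \<beta> a p) * \<psi> p"
    have \<beta>1: "Ck_on 1 UNIV (\<lambda>p. 1 - \<beta> a p)" by (intro Ck_on_diff Ck_on_const bump(1) open_UNIV)
    have f1: "Ck_on 1 UNIV ?f" by (rule Ck_on_mult[OF open_UNIV bump(1) insert.prems(4)])
    have g1: "Ck_on 1 UNIV ?g" by (rule Ck_on_mult[OF open_UNIV \<beta>1 insert.prems(4)])
    have cL: "compact ?L" by (rule ball_preimage(2)[OF C(1) R(2)])
    have Lc: "?L \<subseteq> fst (C a)" using chart_inv_in[OF C(1)] R(2)[of a] by auto
    have f: "weak_ge h ?f"
    proof (rule chart[OF C(1)[of a]])
      show "compact (K \<inter> ?L)" using insert.prems(1) cL by (rule compact_Int)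
      show "K \<inter> ?L \<subseteq> fst (C a) \<inter> W" using Lc insert.prems(2) by blast
      show "?f p = 0" if "p \<notin> K \<inter> ?L" for p
        using that bump(5)[of p a] insert.prems(5)[of p] by auto
      show "?f p \<ge> 0" for p using bump(2) insert.prems(6) by simp
    qed (rule f1)
    have g: "weak_ge h ?g"
    proof (rule insert.IH)
      \<comment> \<open>The bump equals 1 on \<open>V a\<close>, so the remainder vanishes there and
        the rest of the cover suffices for its support.\<close>
      show "compact (K - V a)" using insert.prems(1) V(1) by (rule compact_diff)
      show "K - V a \<subseteq> W" using insert.prems(2) by blast
      show "K - V a \<subseteq> (\<Union>p\<in>F. V p)" using insert.prems(3) by blast
      show "?g p = 0" if "p \<notin> K - V a" for p
        using that bump(4)[of p a] insert.prems(5)[of p] unfolding V_def by auto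
      show "?g p \<ge> 0" for p using bump(3) insert.prems(6) by simp
    qed (rule g1)
    have h\<psi>: "\<psi> = (\<lambda>p. ?f p + ?g p)" by (simp add: algebra_simps)
    have zf: "?f p = 0" and zg: "?g p = 0" if "p \<notin> K" for p using insert.prems(5)[OF that] by auto
    have if': "integrable vol (\<lambda>p. h p * ?f p)" and ig: "integrable vol (\<lambda>p. h p * ?g p)"
      by (rule integrable_compact_support[OF _ insert.prems(1)];
          use insert.prems(5) in \<open>auto intro!: continuous_intros h Ck_on_continuous[OF insert.prems(4)] Ck_on_continuous[OF bump(1)]\<close>)+
    have 1: "(LINT p|vol. h p * \<psi> p) = (LINT p|vol. h p * ?f p) + (LINT p|vol. h p * ?g p)"
      using Bochner_Integration.integral_add[OF if' ig] by (simp add: algebra_simps)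
    have pf: "integrable vol (pairing ?f)" "integrable vol (pairing ?g)"
      using integrable_pairing[OF f1 insert.prems(1) zf] integrable_pairing[OF g1 insert.prems(1) zg] by blast+
    have "pairing \<psi> p = pairing ?f p + pairing ?g p" for p
      by (subst h\<psi>) (rule pairing_add[OF f1 g1])
    then have 2: "(LINT p|vol. pairing \<psi> p) = (LINT p|vol. pairing ?f p) + (LINT p|vol. pairing ?g p)"
      using Bochner_Integration.integral_add[OF pf] by simp
    show ?case using f g unfolding weak_ge_def 1 2 by linarith
  qed
  have "K \<subseteq> (\<Union>p\<in>K. V p)" using V(2) by blast
  then obtain F where "F \<subseteq> K" "finite F" "K \<subseteq> (\<Union>p\<in>F. V p)"
    using compactE_image[OF K(1), of K V] V(1) by blast
  then show ?thesis using main K \<psi> by blast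
qed

end

end

section \<open>Smoothing the distance function\<close>

context riemannian_manifold
begin

section \<open>Bounds on differentials and partitions of unity\<close>

lemma dform_sum:
  assumes "finite F" "\<And>a. a \<in> F \<Longrightarrow> Ck_on 1 W (f a)" "p \<in> W" "c \<in> A" "p \<in> fst c"
  shows "dform (\<lambda>q. \<Sum>a\<in>F. f a q) c p v = (\<Sum>a\<in>F. dform (f a) c p v)"
proof -
  have "((\<lambda>x. \<Sum>a\<in>F. (f a \<circ> chart_inv c) x) has_derivative (\<lambda>v. \<Sum>a\<in>F. dform (f a) c p v)) (at (snd c p))"
    by (rule has_derivative_sum) (use dform_has_derivative[OF assms(2) assms(3-5)] in blast)
  then have "((\<lambda>q. \<Sum>a\<in>F. f a q) \<circ> chart_inv c has_derivative (\<lambda>v. \<Sum>a\<in>F. dform (f a) c p v)) (at (snd c p))"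
    by (simp add: comp_def)
  from dform_unique[OF this] show ?thesis by simp
qed

lemma dform_bound_change:
  assumes "c \<in> A" "c' \<in> A" "p \<in> fst c" "p \<in> fst c'" "Ck_on 1 W f" "p \<in> W"
    and "\<And>v. \<bar>dform f c' p v\<bar> \<le> B * metric_norm G c' p v"
  shows "\<bar>dform f c p v\<bar> \<le> B * metric_norm G c p v"
  using assms(7)[of "chart_diff c c' p v"] dform_change[OF assms(1-6)] metric_norm_change[OF assms(1-4)] by simp

lemma dform_bound_chart_support:
  assumes c: "c \<in> A" and K: "compact K" "K \<subseteq> fst c" and f: "Ck_on 1 UNIV f" "\<forall>p. p \<notin> K \<longrightarrow> f p = 0"
    and a: "a > 0" "\<And>p v. p \<in> K \<Longrightarrow> a * norm v \<le> metric_norm G c p v"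
  obtains B where "B \<ge> 0" "\<And>c' p v. c' \<in> A \<Longrightarrow> p \<in> fst c' \<Longrightarrow> \<bar>dform f c' p v\<bar> \<le> B * metric_norm G c' p v"
proof -
  note pb = chart_pullback[OF c K f]
  obtain B where B: "B \<ge> 0" "\<And>y v. \<bar>frechet_derivative (pullback c f) (at y) v\<bar> \<le> norm v * B"
    using C1_compact_support_derivative_bound[OF pb(4,1,3)] by blast
  have "\<bar>dform f c' p v\<bar> \<le> (B / a) * metric_norm G c' p v" if c': "c' \<in> A" "p \<in> fst c'" for c' p v
  proof (cases "p \<in> K")
    case True
    then have p: "p \<in> fst c" using K by blast
    have "\<bar>dform f c p v\<bar> \<le> (B / a) * metric_norm G c p v" for v
    proof -
      have "\<bar>dform f c p v\<bar> \<le> norm v * B" using B(2) pb(5)[OF p] by simp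
      also have "\<dots> \<le> (metric_norm G c p v / a) * B"
        using a(1) a(2)[OF True, of v] B(1) by (intro mult_right_mono) (simp_all add: field_simps)
      finally show ?thesis by (simp add: mult.commute)
    qed
    then show ?thesis by (rule dform_bound_change[OF c'(1) c c'(2) p f(1) UNIV_I])
  next
    case False
    have "dform f c' p v = 0"
      by (rule dform_off_support[OF compact_imp_closed[OF K(1)] _ False c']) (use f(2) in blast)
    then show ?thesis using metric_norm_nonneg[OF c', of v] B(1) a(1) by simp
  qed
  then show ?thesis using that[of "B / a"] B(1) a(1) by simp
qed

text \<open>Each new function is its bump times the product of 1 - \<beta> over the bumps treated
  before; the sum telescopes and equals 1 wherever some bump is 1.\<close>

lemma partition_from_bumps:
  assumes "finite F" "\<And>a. a \<in> F \<Longrightarrow> Ck_on 1 UNIV (\<beta> a)" "\<And>a p. a \<in> F \<Longrightarrow> 0 \<le> \<beta> a p \<and> \<beta> a p \<le> 1"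
  shows "\<exists>\<theta>. (\<forall>a\<in>F. Ck_on 1 UNIV (\<theta> a) \<and> (\<forall>p. 0 \<le> \<theta> a p \<and> (\<beta> a p = 0 \<longrightarrow> \<theta> a p = 0))) \<and>
    (\<forall>p. (\<Sum>a\<in>F. \<theta> a p) = 1 - (\<Prod>a\<in>F. 1 - \<beta> a p))"
  using assms
proof (induction F rule: finite_induct)
  case empty
  then show ?case by simp
next
  case (insert b F)
  obtain \<theta> where \<theta>: "\<And>a. a \<in> F \<Longrightarrow> Ck_on 1 UNIV (\<theta> a)" "\<And>a p. a \<in> F \<Longrightarrow> 0 \<le> \<theta> a p"
    "\<And>a p. a \<in> F \<Longrightarrow> \<beta> a p = 0 \<Longrightarrow> \<theta> a p = 0" "\<And>p. (\<Sum>a\<in>F. \<theta> a p) = 1 - (\<Prod>a\<in>F. 1 - \<beta> a p)"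
    using insert.IH insert.prems by (metis insertCI)
  define \<theta>' where "\<theta>' = \<theta>(b := \<lambda>p. \<beta> b p * (1 - (\<Sum>a\<in>F. \<theta> a p)))"
  have eq: "\<theta>' a = \<theta> a" if "a \<in> F" for a using that insert.hyps by (auto simp: \<theta>'_def)
  have b: "\<theta>' b = (\<lambda>p. \<beta> b p * (1 - (\<Sum>a\<in>F. \<theta> a p)))" by (simp add: \<theta>'_def)
  have C1: "Ck_on 1 UNIV (\<theta>' a)" if "a \<in> insert b F" for a
  proof (cases "a = b")
    case True
    have "Ck_on 1 UNIV (\<lambda>p. \<beta> b p * (1 - (\<Sum>a\<in>F. \<theta> a p)))"
      by (intro Ck_on_mult Ck_on_diff Ck_on_const Ck_on_sum open_UNIV \<theta>(1) insert.prems(1)) auto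
    then show ?thesis using True b by simp
  qed (use that eq \<theta>(1) in auto)
  have nn: "0 \<le> \<theta>' a p" if "a \<in> insert b F" for a p
  proof (cases "a = b")
    case True
    have "(\<Prod>a\<in>F. 1 - \<beta> a p) \<ge> 0" using insert.prems(2) by (intro prod_nonneg) auto
    then show ?thesis using True insert.prems(2)[of b p] by (simp add: b \<theta>(4))
  qed (use that eq \<theta>(2) in auto)
  have z: "\<theta>' a p = 0" if "a \<in> insert b F" "\<beta> a p = 0" for a p
    using that eq \<theta>(3) by (cases "a = b") (auto simp: b)
  have "(\<Sum>a\<in>insert b F. \<theta>' a p) = 1 - (\<Prod>a\<in>insert b F. 1 - \<beta> a p)" for p
  proof -
    have "(\<Sum>a\<in>F. \<theta>' a p) = (\<Sum>a\<in>F. \<theta> a p)" by (rule sum.cong) (auto simp: eq)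
    then show ?thesis using insert.hyps by (simp add: b \<theta>(4) algebra_simps)
  qed
  then show ?case using C1 nn z by blast
qed

end

context connected_riemannian_manifold
begin

section \<open>Local mollification of the distance and gluing\<close>

lemma rdist_lipschitz: "\<bar>rdist x p - rdist y p\<bar> \<le> rdist x y"
  using rdist_triangle[of x p y] rdist_triangle[of y p x] rdist_commute[of x y] by linarith

text \<open>In coordinates the distance is 2-Lipschitz for the norm frozen at \<open>p\<close>, and
  mollification keeps this constant. Passing to the norm at the actual point costs another factor 2,
  whence the slope 4.\<close>

lemma local_smoothing:
  assumes c: "c \<in> A" "p \<in> fst c" and R: "R > 0" "cball (snd c p) R \<subseteq> chart_image c"
    and lo: "\<And>x v. x \<in> cball (snd c p) R \<Longrightarrow> metric_norm G c p v \<le> 2 * metric_norm G c (chart_inv c x) v"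
    and up: "\<And>x v. x \<in> cball (snd c p) R \<Longrightarrow> metric_norm G c (chart_inv c x) v \<le> 2 * metric_norm G c p v"
    and s: "s > 0"
  obtains m where "higher_differentiable_on UNIV m 1"
    "\<And>y. y \<in> cball (snd c p) (R / 2) \<Longrightarrow> \<bar>m y - rdist (chart_inv c y) p0\<bar> \<le> s"
    "\<And>y v. y \<in> cball (snd c p) (R / 2) \<Longrightarrow> \<bar>frechet_derivative m (at y) v\<bar> \<le> 4 * metric_norm G c (chart_inv c y) v"
proof -
  let ?x = "snd c p" and ?N = "metric_norm G c p"
  obtain M where M: "M > 0" "\<And>v. ?N v \<le> M * norm v" using metric_norm_euclidean_bounds[OF c] by metis
  \<comment> \<open>The projection onto the coordinate ball extends the distance continuously to the
    whole space, as convolution requires; the estimates only involve points inside the ball.\<close>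
  define h where "h y = rdist (chart_inv c (closest_point (cball ?x R) y)) p0" for y
  have ne: "cball ?x R \<noteq> {}" using R(1) by simp
  have cp: "closest_point (cball ?x R) y \<in> cball ?x R" for y
    by (rule closest_point_in_set[OF closed_cball ne])
  have h_in: "h y = rdist (chart_inv c y) p0" if "y \<in> cball ?x R" for y
    using closest_point_self[OF that] by (simp add: h_def)
  have ch: "continuous_on UNIV h"
  proof -
    have "continuous_on UNIV (\<lambda>y. chart_inv c (closest_point (cball ?x R) y))"
      by (rule continuous_on_compose2[OF continuous_on_chart_inv[OF c(1)]
            continuous_on_closest_point[OF convex_cball closed_cball ne]]) (use cp R(2) in blast)
    from continuous_on_compose2[OF continuous_on_rdist[of UNIV] this] show ?thesis by (simp add: h_def)
  qed
  have N_minus: "?N (y - z) = ?N (z - y)" for y z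
    using metric_norm_scaleR[of c p "-1" "y - z"] by simp
  have lip: "\<bar>h y - h z\<bar> \<le> 2 * ?N (z - y)" if "y \<in> cball ?x R" "z \<in> cball ?x R" for y z
    using rdist_lipschitz[of "chart_inv c y" p0 "chart_inv c z"] rdist_local_upper[OF c R(2) up that]
    by (simp add: h_in[OF that(1)] h_in[OF that(2)])
  \<comment> \<open>The bound R/4 keeps translates of the ball of radius 3R/4 inside the one of
    radius \<open>R\<close>; the other makes the mollification error at most 2 M e \<le> s.\<close>
  define e where "e = min (R / 4) (s / (2 * M))"
  have e: "e > 0" "e \<le> R / 4" "2 * (M * e) \<le> s"
    using R(1) s M(1) by (auto simp: e_def min_def field_simps)
  obtain k :: "real^'n \<Rightarrow> real" where k: "mollifier e k" using ex_mollifier[OF e(1)] by blast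
  have kz: "\<forall>x. norm x \<ge> e \<longrightarrow> k x = 0" and ks: "\<And>j. higher_differentiable_on UNIV k j"
    using k unfolding mollifier_def by blast+
  define m where "m = convolve h k"
  have m1: "higher_differentiable_on UNIV m 1" unfolding m_def by (rule convolve_smooth[OF kz ch ks])
  have near: "y - z \<in> cball ?x R" if "y \<in> cball ?x (3 * R / 4)" "norm z < e" for y z
  proof -
    have "norm (?x - (y - z)) \<le> norm (?x - y) + norm z" using norm_triangle_ineq[of "?x - y" z] by (simp add: algebra_simps)
    then show ?thesis using that e(2) by (simp add: dist_norm)
  qed
  have mlip: "\<bar>m y - m y'\<bar> \<le> 2 * ?N (y - y')" if "y \<in> cball ?x (3 * R / 4)" "y' \<in> cball ?x (3 * R / 4)" for y y'
    unfolding m_def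
  proof (rule convolve_diff_bound[OF k ch])
    fix z :: "real^'n" assume "norm z < e"
    then show "\<bar>h (y - z) - h (y' - z)\<bar> \<le> 2 * ?N (y - y')"
      using lip[OF near[OF that(1)] near[OF that(2)], of z z] N_minus[of y y'] by simp
  qed
  have half: "y \<in> cball ?x (3 * R / 4)" if "y \<in> cball ?x (R / 2)" for y
    using that R(1) by (auto simp: field_simps)
  have "\<bar>m y - rdist (chart_inv c y) p0\<bar> \<le> s" if y: "y \<in> cball ?x (R / 2)" for y
  proof -
    have yR: "y \<in> cball ?x R" using y R(1) by auto
    have "\<bar>m y - h y\<bar> \<le> s" unfolding m_def
    proof (rule convolve_near[OF k ch])
      fix z :: "real^'n" assume z: "norm z < e"
      have "\<bar>h (y - z) - h y\<bar> \<le> 2 * ?N z" using lip[OF near[OF half[OF y] z] yR] by simp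
      also have "\<dots> \<le> 2 * (M * norm z)" using M(2)[of z] by simp
      also have "\<dots> \<le> 2 * (M * e)" using z M(1) by simp
      also have "\<dots> \<le> s" by (rule e(3))
      finally show "\<bar>h (y - z) - h y\<bar> \<le> s" .
    qed
    then show ?thesis by (simp add: h_in[OF yR])
  qed
  moreover have "\<bar>frechet_derivative m (at y) v\<bar> \<le> 4 * metric_norm G c (chart_inv c y) v"
    if y: "y \<in> cball ?x (R / 2)" for y v
  proof -
    have mD: "(m has_derivative frechet_derivative m (at y)) (at y)"
      using m1 by (simp add: higher_differentiable_on_1 frechet_derivative_works[symmetric])
    have "((\<lambda>t. m (y + t *\<^sub>R v)) has_real_derivative frechet_derivative m (at y) v) (at 0)"
    proof -
      have 1: "((\<lambda>t. y + t *\<^sub>R v) has_vector_derivative v) (at 0)"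
        by (auto intro!: derivative_eq_intros simp: has_vector_derivative_def)
      have "(m has_derivative frechet_derivative m (at y)) (at (y + 0 *\<^sub>R v) within range (\<lambda>t. y + t *\<^sub>R v))"
        using mD by (simp add: has_derivative_at_withinI)
      from vector_derivative_diff_chain_within[OF 1 this]
      show ?thesis by (simp add: comp_def has_real_derivative_iff_has_vector_derivative)
    qed
    then have lim: "((\<lambda>t. \<bar>(m (y + t *\<^sub>R v) - m y) / t\<bar>) \<longlongrightarrow> \<bar>frechet_derivative m (at y) v\<bar>) (at 0)"
      by (intro tendsto_rabs) (simp add: DERIV_def)
    have op: "open ((\<lambda>t::real. y + t *\<^sub>R v) -` ball ?x (3 * R / 4))"
      by (intro open_vimage open_ball continuous_intros)
    have mem: "0 \<in> (\<lambda>t::real. y + t *\<^sub>R v) -` ball ?x (3 * R / 4)"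
      using y R(1) by auto
    have "eventually (\<lambda>t. \<bar>(m (y + t *\<^sub>R v) - m y) / t\<bar> \<le> 2 * ?N v) (at 0)"
      unfolding eventually_at_topological
    proof (intro exI conjI ballI impI, rule op, rule mem)
      fix t :: real assume t: "t \<in> (\<lambda>t. y + t *\<^sub>R v) -` ball ?x (3 * R / 4)" "t \<noteq> 0"
      have "\<bar>m (y + t *\<^sub>R v) - m y\<bar> \<le> 2 * ?N ((y + t *\<^sub>R v) - y)"
        by (rule mlip[OF _ half[OF y]]) (use t in auto)
      also have "\<dots> = 2 * (\<bar>t\<bar> * ?N v)" by (simp add: metric_norm_scaleR)
      finally show "\<bar>(m (y + t *\<^sub>R v) - m y) / t\<bar> \<le> 2 * ?N v" using t(2) by (simp add: field_simps)
    qed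
    then have "\<bar>frechet_derivative m (at y) v\<bar> \<le> 2 * ?N v"
      by (rule tendsto_upperbound[OF lim]) simp
    moreover have "y \<in> cball ?x R" using y R(1) by auto
    ultimately show ?thesis using lo[of y v] by linarith
  qed
  ultimately show ?thesis using that m1 by blast
qed

text \<open>
  Since the gradients of a partition of unity sum to zero, the gradient of the glued function only
  sees the differences between the local approximations and the distance itself.
\<close>

lemma smooth_distance:
  assumes K: "compact K" and N: "open N" "N \<subseteq> K"
  obtains \<rho> where "Ck_on 1 UNIV \<rho>"
    "\<And>p. p \<in> K \<Longrightarrow> rdist p p0 \<le> \<rho> p \<and> \<rho> p \<le> rdist p p0 + 1"
    "\<And>p c v. p \<in> N \<Longrightarrow> c \<in> A \<Longrightarrow> p \<in> fst c \<Longrightarrow> \<bar>dform \<rho> c p v\<bar> \<le> 5 * metric_norm G c p v"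
proof -
  have "\<forall>p. \<exists>c R a. c \<in> A \<and> p \<in> fst c \<and> R > 0 \<and> a > 0 \<and> cball (snd c p) R \<subseteq> chart_image c \<and>
      (\<forall>x v. x \<in> cball (snd c p) R \<longrightarrow> metric_norm G c p v \<le> 2 * metric_norm G c (chart_inv c x) v) \<and>
      (\<forall>x v. x \<in> cball (snd c p) R \<longrightarrow> metric_norm G c (chart_inv c x) v \<le> 2 * metric_norm G c p v) \<and>
      (\<forall>v. a * norm v \<le> metric_norm G c p v)"
  proof
    fix p
    obtain c where c: "c \<in> A" "p \<in> fst c" using ex_chart by blast
    obtain R where "R > 0" "cball (snd c p) R \<subseteq> chart_image c"
      "\<And>x v. x \<in> cball (snd c p) R \<Longrightarrow> metric_norm G c p v \<le> 2 * metric_norm G c (chart_inv c x) v"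
      "\<And>x v. x \<in> cball (snd c p) R \<Longrightarrow> metric_norm G c (chart_inv c x) v \<le> 2 * metric_norm G c p v"
      using metric_pinching[OF c] by metis
    moreover obtain a where "a > 0" "\<And>v. a * norm v \<le> metric_norm G c p v"
      using metric_norm_euclidean_bounds[OF c] by metis
    ultimately show "\<exists>c R a. c \<in> A \<and> p \<in> fst c \<and> R > 0 \<and> a > 0 \<and> cball (snd c p) R \<subseteq> chart_image c \<and>
      (\<forall>x v. x \<in> cball (snd c p) R \<longrightarrow> metric_norm G c p v \<le> 2 * metric_norm G c (chart_inv c x) v) \<and>
      (\<forall>x v. x \<in> cball (snd c p) R \<longrightarrow> metric_norm G c (chart_inv c x) v \<le> 2 * metric_norm G c p v) \<and>
      (\<forall>v. a * norm v \<le> metric_norm G c p v)"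
      using c by (intro exI[of _ c] exI[of _ R] exI[of _ a]) blast
  qed
  then obtain C R a where C: "\<And>p. C p \<in> A" "\<And>p. p \<in> fst (C p)" and R: "\<And>p. R p > (0::real)"
    "\<And>p. cball (snd (C p) p) (R p) \<subseteq> chart_image (C p)"
    and lo: "\<And>p x v. x \<in> cball (snd (C p) p) (R p) \<Longrightarrow> metric_norm G (C p) p v \<le> 2 * metric_norm G (C p) (chart_inv (C p) x) v"
    and up: "\<And>p x v. x \<in> cball (snd (C p) p) (R p) \<Longrightarrow> metric_norm G (C p) (chart_inv (C p) x) v \<le> 2 * metric_norm G (C p) p v"
    and a: "\<And>p. a p > (0::real)" "\<And>p v. a p * norm v \<le> metric_norm G (C p) p v"
    by metis
  have half: "cball (snd (C p) p) (R p / 2) \<subseteq> chart_image (C p)" for p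
  proof -
    have "cball (snd (C p) p) (R p / 2) \<subseteq> cball (snd (C p) p) (R p)" using R(1)[of p] by (intro subset_cball) simp
    then show ?thesis using R(2) by (rule order_trans)
  qed
  have quarter: "cball (snd (C p) p) (R p / 2 / 2) \<subseteq> chart_image (C p)" for p
  proof -
    have "cball (snd (C p) p) (R p / 2 / 2) \<subseteq> cball (snd (C p) p) (R p)" using R(1)[of p] by (intro subset_cball) simp
    then show ?thesis using R(2) by (rule order_trans)
  qed
  have R2: "R p / 2 > 0" for p using R(1)[of p] by simp
  \<comment> \<open>Supports of radius R/2 keep each partition function where its local
    approximation is controlled.\<close>
  define \<beta> where "\<beta> p = chart_bump (C p) p (R p / 2)" for p
  define V where "V p = chart_inv (C p) ` ball (snd (C p) p) (R p / 2 / 2)" for p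
  define L where "L p = chart_inv (C p) ` cball (snd (C p) p) (R p / 2)" for p
  note bump = chart_bump[OF C(1) R2 half, folded \<beta>_def V_def L_def]
  have V: "open (V p)" "p \<in> V p" for p
  proof -
    show "open (V p)" unfolding V_def by (rule ball_preimage(1)[OF C(1) quarter])
    have "p = chart_inv (C p) (snd (C p) p)" by (simp add: chart_inv_snd[OF C])
    then show "p \<in> V p" unfolding V_def using R(1)[of p] by (intro image_eqI[of _ _ "snd (C p) p"]) auto
  qed
  have L: "compact (L p)" "L p \<subseteq> fst (C p)" for p
  proof -
    show "compact (L p)" unfolding L_def by (rule ball_preimage(2)[OF C(1) half])
    show "L p \<subseteq> fst (C p)" unfolding L_def using chart_inv_in[OF C(1)] half[of p] by auto
  qed
  have Ly: "snd (C p) q \<in> cball (snd (C p) p) (R p / 2) \<and> chart_inv (C p) (snd (C p) q) = q" if q: "q \<in> L p" for p q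
  proof -
    obtain y where y: "y \<in> cball (snd (C p) p) (R p / 2)" "q = chart_inv (C p) y" using q unfolding L_def by blast
    then have "y \<in> chart_image (C p)" using half by blast
    then show ?thesis using y snd_chart_inv[OF C(1)] by simp
  qed
  have LR: "cball (snd (C p) p) (R p / 2) \<subseteq> cball (snd (C p) p) (R p)" for p using R(1)[of p] by (intro subset_cball) simp
  have "K \<subseteq> (\<Union>p\<in>K. V p)" using V(2) by blast
  then obtain F where F: "F \<subseteq> K" "finite F" "K \<subseteq> (\<Union>p\<in>F. V p)"
    using compactE_image[OF K, of K V] V(1) by blast
  obtain \<theta> where \<theta>: "\<And>b. b \<in> F \<Longrightarrow> Ck_on 1 UNIV (\<theta> b)" "\<And>b p. b \<in> F \<Longrightarrow> 0 \<le> \<theta> b p"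
    "\<And>b p. b \<in> F \<Longrightarrow> \<beta> b p = 0 \<Longrightarrow> \<theta> b p = 0" "\<And>p. (\<Sum>b\<in>F. \<theta> b p) = 1 - (\<Prod>b\<in>F. 1 - \<beta> b p)"
    using partition_from_bumps[OF F(2), of \<beta>] bump(1,2,3) by metis
  have \<theta>L: "\<theta> b p = 0" if "b \<in> F" "p \<notin> L b" for b p using \<theta>(3)[OF that(1)] bump(5)[OF that(2)] by blast
  have \<theta>1: "(\<Sum>b\<in>F. \<theta> b p) = 1" if p: "p \<in> K" for p
  proof -
    obtain b where "b \<in> F" "p \<in> V b" using F(3) p by blast
    then have "\<exists>b\<in>F. 1 - \<beta> b p = 0" using bump(4) by force
    then have "(\<Prod>b\<in>F. 1 - \<beta> b p) = 0" by (rule prod_zero[OF F(2)])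
    then show ?thesis using \<theta>(4) by simp
  qed
  have "\<forall>b\<in>F. \<exists>B\<ge>0. \<forall>c' p v. c' \<in> A \<longrightarrow> p \<in> fst c' \<longrightarrow> \<bar>dform (\<theta> b) c' p v\<bar> \<le> B * metric_norm G c' p v"
  proof
    fix b assume b: "b \<in> F"
    have lowb: "a b / 2 * norm v \<le> metric_norm G (C b) p v" if "p \<in> L b" for p v
      using lo[of "snd (C b) p" b v] a(2)[of b v] Ly[OF that] LR[of b] by fastforce
    have a2: "a b / 2 > 0" using a(1)[of b] by simp
    have z: "\<forall>p. p \<notin> L b \<longrightarrow> \<theta> b p = 0" using \<theta>L[OF b] by blast
    show "\<exists>B\<ge>0. \<forall>c' p v. c' \<in> A \<longrightarrow> p \<in> fst c' \<longrightarrow> \<bar>dform (\<theta> b) c' p v\<bar> \<le> B * metric_norm G c' p v"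
      using dform_bound_chart_support[OF C(1) L \<theta>(1)[OF b] z a2 lowb] by metis
  qed
  then obtain B where B: "\<And>b. b \<in> F \<Longrightarrow> B b \<ge> 0"
    "\<And>b c' p v. b \<in> F \<Longrightarrow> c' \<in> A \<Longrightarrow> p \<in> fst c' \<Longrightarrow> \<bar>dform (\<theta> b) c' p v\<bar> \<le> B b * metric_norm G c' p v"
    by metis
  \<comment> \<open>The accuracy is fixed after the partition: \<open>s\<close> is small enough for
    the terms containing differentials of the partition to contribute slope at most 1.\<close>
  define s where "s = min (1 / 2) (1 / (1 + (\<Sum>b\<in>F. B b)))"
  have sB: "(\<Sum>b\<in>F. B b) \<ge> 0" using B(1) by (rule sum_nonneg)
  have s: "s > 0" "s \<le> 1 / 2" "(\<Sum>b\<in>F. B b) * s \<le> 1"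
  proof -
    show "s > 0" "s \<le> 1 / 2" using sB by (auto simp: s_def)
    have "(\<Sum>b\<in>F. B b) * s \<le> (\<Sum>b\<in>F. B b) * (1 / (1 + (\<Sum>b\<in>F. B b)))"
      using sB by (intro mult_left_mono) (auto simp: s_def)
    also have "\<dots> \<le> 1" using sB by simp
    finally show "(\<Sum>b\<in>F. B b) * s \<le> 1" .
  qed
  have "\<forall>b. \<exists>m. higher_differentiable_on UNIV m 1 \<and>
    (\<forall>y\<in>cball (snd (C b) b) (R b / 2). \<bar>m y - rdist (chart_inv (C b) y) p0\<bar> \<le> s \<and>
      (\<forall>v. \<bar>frechet_derivative m (at y) v\<bar> \<le> 4 * metric_norm G (C b) (chart_inv (C b) y) v))"
    using local_smoothing[OF C R lo up s(1)] by metis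
  then obtain m where m: "\<And>b. higher_differentiable_on UNIV (m b) 1"
    "\<And>b y. y \<in> cball (snd (C b) b) (R b / 2) \<Longrightarrow> \<bar>m b y - rdist (chart_inv (C b) y) p0\<bar> \<le> s"
    "\<And>b y v. y \<in> cball (snd (C b) b) (R b / 2) \<Longrightarrow>
       \<bar>frechet_derivative (m b) (at y) v\<bar> \<le> 4 * metric_norm G (C b) (chart_inv (C b) y) v"
    by metis
  define M where "M b q = m b (snd (C b) q)" for b q
  have MC: "higher_differentiable_on (chart_image (C b)) (M b \<circ> chart_inv (C b)) 1" for b
    by (rule higher_differentiable_on_cong[OF chart_open(2)[OF C(1)] _ higher_differentiable_on_subset[OF m(1) subset_UNIV]])
      (simp add: M_def snd_chart_inv[OF C(1)])
  have M1: "Ck_on 1 (fst (C b)) (M b)" for b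
    using Ck_on_chartI[OF C(1) chart_open(1)[OF C(1)] subset_refl] MC[of b] unfolding chart_image_def by blast
  have Md: "dform (M b) (C b) p v = frechet_derivative (m b) (at (snd (C b) p)) v" if p: "p \<in> fst (C b)" for b p v
  proof -
    have "dform (M b) (C b) p = frechet_derivative (m b) (at (snd (C b) p))"
      unfolding dform_def
      by (rule frechet_derivative_cong_open[OF chart_open(2)[OF C(1)] snd_in[OF p]])
        (simp add: M_def snd_chart_inv[OF C(1)])
    then show ?thesis by simp
  qed
  have near: "\<bar>M b p - rdist p p0\<bar> \<le> s" if "p \<in> L b" for b p
    using m(2)[of "snd (C b) p" b] Ly[OF that] by (simp add: M_def)
  have slope: "\<bar>dform (M b) c p v\<bar> \<le> 4 * metric_norm G c p v" if p: "p \<in> L b" and c: "c \<in> A" "p \<in> fst c" for b p c v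
  proof -
    have pC: "p \<in> fst (C b)" using p L by blast
    show ?thesis
      by (rule dform_bound_change[OF c(1) C(1) c(2) pC M1 pC]) (use m(3)[of "snd (C b) p" b] Ly[OF p] Md[OF pC] in simp)
  qed
  define g where "g b q = \<theta> b q * M b q" for b q
  have g0: "g b q = 0" if "b \<in> F" "q \<notin> L b" for b q using \<theta>L[OF that] by (simp add: g_def)
  have g1: "Ck_on 1 UNIV (g b)" if b: "b \<in> F" for b
  proof (rule Ck_on_extend_zero[OF C(1) compact_imp_closed[OF L(1)] L(2) g0[OF b]])
    have "higher_differentiable_on (chart_image (C b)) (\<theta> b \<circ> chart_inv (C b)) 1"
      using \<theta>(1)[OF b] C(1) unfolding Ck_on_def by (metis Int_UNIV_right chart_image_def)
    from higher_differentiable_on_mult[OF chart_open(2)[OF C(1)] this MC]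
    show "higher_differentiable_on (chart_image (C b)) (g b \<circ> chart_inv (C b)) 1"
      by (simp add: comp_def g_def)
  qed
  have gd: "dform (g b) c p v = \<theta> b p * dform (M b) c p v + dform (\<theta> b) c p v * M b p"
    if b: "b \<in> F" and c: "c \<in> A" "p \<in> fst c" for b c p v
  proof (cases "p \<in> L b")
    case True
    have pC: "p \<in> fst (C b)" using True L by blast
    show ?thesis unfolding g_def
      using dform_mult[OF Ck_on_subset[OF \<theta>(1)[OF b] subset_UNIV] M1 pC c] by simp
  next
    case False
    have "dform (g b) c p v = 0" by (rule dform_off_support[OF compact_imp_closed[OF L(1)] g0[OF b] False c])
    moreover have "dform (\<theta> b) c p v = 0" by (rule dform_off_support[OF compact_imp_closed[OF L(1)] \<theta>L[OF b] False c])
    ultimately show ?thesis using \<theta>L[OF b False] by simp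
  qed
  \<comment> \<open>The glued function differs from the distance by at most \<open>s\<close>, hence
    by at most 1/2; the shift by 1/2 puts the error between 0 and 1.\<close>
  define \<rho> where "\<rho> q = 1 / 2 + (\<Sum>b\<in>F. g b q)" for q
  have \<rho>1: "Ck_on 1 UNIV \<rho>" unfolding \<rho>_def by (intro Ck_on_add Ck_on_const Ck_on_sum open_UNIV g1)
  have val: "rdist p p0 \<le> \<rho> p \<and> \<rho> p \<le> rdist p p0 + 1" if p: "p \<in> K" for p
  proof -
    have "(\<Sum>b\<in>F. g b p) - rdist p p0 = (\<Sum>b\<in>F. g b p) - (\<Sum>b\<in>F. \<theta> b p) * rdist p p0" using \<theta>1[OF p] by simp
    also have "\<dots> = (\<Sum>b\<in>F. \<theta> b p * (M b p - rdist p p0))"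
      by (simp add: g_def sum_distrib_right sum_subtractf right_diff_distrib)
    also have "\<bar>\<dots>\<bar> \<le> (\<Sum>b\<in>F. \<theta> b p * s)"
    proof (rule order_trans[OF sum_abs], rule sum_mono)
      fix b assume b: "b \<in> F"
      show "\<bar>\<theta> b p * (M b p - rdist p p0)\<bar> \<le> \<theta> b p * s"
        using near[of p b] \<theta>L[OF b, of p] \<theta>(2)[OF b, of p] by (cases "p \<in> L b") (auto simp: abs_mult intro: mult_left_mono)
    qed
    also have "\<dots> = s" using \<theta>1[OF p] by (simp add: sum_distrib_right[symmetric])
    finally show ?thesis using s(2) by (auto simp: \<rho>_def abs_le_iff)
  qed
  have grad: "\<bar>dform \<rho> c p v\<bar> \<le> 5 * metric_norm G c p v" if p: "p \<in> N" and c: "c \<in> A" "p \<in> fst c" for p c v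
  proof -
    have pK: "p \<in> K" using p N by blast
    have "dform \<rho> c p v = dform (\<lambda>_. 1 / 2) c p v + dform (\<lambda>q. \<Sum>b\<in>F. g b q) c p v"
      unfolding \<rho>_def by (rule dform_add[OF Ck_on_const Ck_on_sum[OF open_UNIV g1] UNIV_I c])
    also have "\<dots> = dform (\<lambda>q. \<Sum>b\<in>F. g b q) c p v" by (simp add: dform_const)
    also have "\<dots> = (\<Sum>b\<in>F. dform (g b) c p v)" by (rule dform_sum[OF F(2) g1 UNIV_I c])
    also have "\<dots> = (\<Sum>b\<in>F. \<theta> b p * dform (M b) c p v + dform (\<theta> b) c p v * M b p)"
      by (rule sum.cong) (use gd[OF _ c] in auto)
    finally have 1: "dform \<rho> c p v = (\<Sum>b\<in>F. \<theta> b p * dform (M b) c p v) + (\<Sum>b\<in>F. dform (\<theta> b) c p v * M b p)"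
      by (simp add: sum.distrib)
    have "(\<Sum>b\<in>F. dform (\<theta> b) c p v) = dform (\<lambda>q. \<Sum>b\<in>F. \<theta> b q) c p v"
      by (rule dform_sum[OF F(2) \<theta>(1) UNIV_I c, symmetric])
    also have "\<dots> = 0"
    proof -
      \<comment> \<open>The partition sums to 1 on a whole neighbourhood inside \<open>N\<close>, so
        its differentials cancel; this is why the slope bound is claimed on an open set.\<close>
      have "dform (\<lambda>q. \<Sum>b\<in>F. \<theta> b q) c p = dform (\<lambda>_. 1) c p"
        by (rule dform_cong[OF N(1) p c]) (use \<theta>1 N(2) in blast)
      then show ?thesis by (simp add: dform_const)
    qed
    finally have 2: "(\<Sum>b\<in>F. dform (\<theta> b) c p v) = 0" .
    have nn: "metric_norm G c p v \<ge> 0" by (rule metric_norm_nonneg[OF c])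
    have "\<bar>\<Sum>b\<in>F. \<theta> b p * dform (M b) c p v\<bar> \<le> (\<Sum>b\<in>F. \<theta> b p * (4 * metric_norm G c p v))"
    proof (rule order_trans[OF sum_abs], rule sum_mono)
      fix b assume b: "b \<in> F"
      show "\<bar>\<theta> b p * dform (M b) c p v\<bar> \<le> \<theta> b p * (4 * metric_norm G c p v)"
        using slope[OF _ c, of b v] \<theta>L[OF b, of p] \<theta>(2)[OF b, of p]
        by (cases "p \<in> L b") (auto simp: abs_mult intro: mult_left_mono)
    qed
    also have "\<dots> = 4 * metric_norm G c p v" using \<theta>1[OF pK] by (simp add: sum_distrib_right[symmetric])
    finally have 3: "\<bar>\<Sum>b\<in>F. \<theta> b p * dform (M b) c p v\<bar> \<le> 4 * metric_norm G c p v" .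
    \<comment> \<open>Subtracting the distance times the vanishing sum of differentials leaves only
      the small local errors as coefficients.\<close>
    have "(\<Sum>b\<in>F. dform (\<theta> b) c p v * M b p) =
        (\<Sum>b\<in>F. dform (\<theta> b) c p v * M b p) - (\<Sum>b\<in>F. dform (\<theta> b) c p v) * rdist p p0" using 2 by simp
    also have "\<dots> = (\<Sum>b\<in>F. dform (\<theta> b) c p v * (M b p - rdist p p0))"
      by (simp add: sum_distrib_right sum_subtractf right_diff_distrib)
    also have "\<bar>\<dots>\<bar> \<le> (\<Sum>b\<in>F. B b * metric_norm G c p v * s)"
    proof (rule order_trans[OF sum_abs], rule sum_mono)
      fix b assume b: "b \<in> F"
      show "\<bar>dform (\<theta> b) c p v * (M b p - rdist p p0)\<bar> \<le> B b * metric_norm G c p v * s"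
      proof (cases "p \<in> L b")
        case True
        show ?thesis unfolding abs_mult
          by (intro mult_mono B(2)[OF b c] near[OF True] mult_nonneg_nonneg B(1)[OF b] nn) simp
      next
        case False
        have "dform (\<theta> b) c p v = 0" by (rule dform_off_support[OF compact_imp_closed[OF L(1)] \<theta>L[OF b] False c])
        then show ?thesis using B(1)[OF b] nn s(1) by simp
      qed
    qed
    also have "\<dots> = ((\<Sum>b\<in>F. B b) * s) * metric_norm G c p v"
      by (simp add: sum_distrib_right sum_distrib_left mult_ac)
    also have "\<dots> \<le> 1 * metric_norm G c p v" by (rule mult_right_mono[OF s(3) nn])
    finally have 4: "\<bar>\<Sum>b\<in>F. dform (\<theta> b) c p v * M b p\<bar> \<le> metric_norm G c p v" by simp
    show ?thesis using 1 3 4 by linarith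
  qed
  show ?thesis by (rule that[OF \<rho>1 val grad])
qed

end

section \<open>The volume estimate\<close>

context connected_riemannian_manifold
begin

text \<open>With s the length of the gradient, the expression is at least \<phi>(s) (s - l). This is
  nonnegative if s \<ge> l; otherwise \<phi>(s) l \<le> K s^\<delta> l \<le> K l^(1+\<delta>). The
  functional \<open>d\<close> stands for a multiple of the differential of the smoothed
  distance.\<close>

lemma flux_slope_bound:
  assumes c: "c \<in> A" "p \<in> fst c" and u: "Ck_on 1 UNIV u"
    and \<phi>: "\<And>t. t > 0 \<Longrightarrow> \<phi> t > 0" "\<And>t. t \<ge> 0 \<Longrightarrow> \<phi> t \<le> K * t powr \<delta>" and K: "K > 0" and \<delta>: "\<delta> > 0"
    and l: "l > 0" "\<And>v. \<bar>d v\<bar> \<le> l * metric_norm G c p v" "\<And>t v. d (t *\<^sub>R v) = t * d v"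
  shows "- (K * l powr (1 + \<delta>)) \<le> dform u c p (phi_gradient G \<phi> u c p) - d (phi_gradient G \<phi> u c p)"
proof -
  let ?v = "gradient G u c p"
  let ?s = "metric_norm G c p ?v"
  have lin: "linear (dform u c p)" by (rule linear_dform[OF u UNIV_I c])
  show ?thesis
  proof (cases "?v = 0")
    case True
    then have "phi_gradient G \<phi> u c p = 0 *\<^sub>R 0" by (simp add: phi_gradient_def)
    then show ?thesis using l(3)[of 0 0] linear_0[OF lin] K by simp
  next
    case False
    have s: "?s > 0" using metric_norm_eq_0[OF c, of ?v] metric_norm_nonneg[OF c, of ?v] False by linarith
    have X: "phi_gradient G \<phi> u c p = (\<phi> ?s / ?s) *\<^sub>R ?v" using False by (simp add: phi_gradient_def Let_def)
    have "dform u c p ?v = ?s\<^sup>2"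
      using metric_inner_gradient[OF c u UNIV_I, of ?v] metric_norm_power2[OF c, of ?v] by simp
    then have 1: "dform u c p (phi_gradient G \<phi> u c p) = \<phi> ?s * ?s"
      using s by (simp add: X linear_cmul[OF lin] power2_eq_square)
    have "d (phi_gradient G \<phi> u c p) \<le> (\<phi> ?s / ?s) * (l * ?s)"
      unfolding X l(3) using l(2)[of ?v] \<phi>(1)[OF s] s by (intro mult_left_mono) auto
    then have 2: "d (phi_gradient G \<phi> u c p) \<le> \<phi> ?s * l" using s by simp
    have "- (K * l powr (1 + \<delta>)) \<le> \<phi> ?s * (?s - l)"
    proof (cases "l \<le> ?s")
      case True
      then have "0 \<le> \<phi> ?s * (?s - l)" using \<phi>(1)[OF s] by simp
      then show ?thesis using K by (smt (verit) mult_nonneg_nonneg powr_ge_zero)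
    next
      case False
      have "\<phi> ?s * l \<le> (K * l powr \<delta>) * l"
      proof (rule mult_right_mono)
        have "\<phi> ?s \<le> K * ?s powr \<delta>" using \<phi>(2) s by simp
        also have "\<dots> \<le> K * l powr \<delta>"
          using False s \<delta> K by (intro mult_left_mono powr_mono2) auto
        finally show "\<phi> ?s \<le> K * l powr \<delta>" .
      qed (use l in simp)
      also have "\<dots> = K * l powr (1 + \<delta>)" using l(1) by (simp add: powr_add)
      finally have "\<phi> ?s * l \<le> K * l powr (1 + \<delta>)" .
      moreover have "0 \<le> \<phi> ?s * ?s" using \<phi>(1)[OF s] s by simp
      ultimately show ?thesis by (simp add: right_diff_distrib)
    qed
    then show ?thesis using 1 2 by (simp add: right_diff_distrib)
  qed
qed

section \<open>Testing with powers of a truncated function\<close>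

context
  fixes \<phi> Q f :: "real \<Rightarrow> real" and b u :: "'a \<Rightarrow> real" and p0 :: 'a and K \<delta> \<gamma>0 ustar :: real
  assumes complete: "complete_manifold A G"
    and phi_cont: "continuous_on {0..} \<phi>" and phi_0: "\<phi> 0 = 0"
    and phi_pos: "\<And>t. t > 0 \<Longrightarrow> \<phi> t > 0"
    and K_pos: "K > 0" and delta_pos: "\<delta> > 0"
    and phi_bound: "\<And>t. t \<ge> 0 \<Longrightarrow> \<phi> t \<le> K * t powr \<delta>"
    and Q_pos: "\<And>t. t \<ge> 0 \<Longrightarrow> Q t > 0" and Q_mono: "mono_on {0..} Q"
    and b_cont: "continuous_on UNIV b" and b_bound: "\<And>x. b x \<ge> 1 / Q (rdist x p0)"
    and f_cont: "continuous_on UNIV f" and u: "Ck_on 1 UNIV u" and u_le: "\<And>x. u x \<le> ustar"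
    and ineq: "div_ge_on A G {x. u x > \<gamma>0} (phi_gradient G \<phi> u) (\<lambda>x. b x * f (u x))"
begin

text \<open>Both sides bound the integral of the N-th power of the positive part of w: below by its
  size on \<open>U\<close>, above by the tested inequality after absorbing half of that integral.
  The value of \<theta> is the ratio of the resulting coefficients, doubled for the
  absorption.\<close>

lemma truncated_power_integral_bound:
  fixes N :: nat
  assumes \<eta>: "\<eta> > 0" "\<gamma>0 < ustar - \<eta>" and c0: "c0 > 0" "\<And>t. ustar - \<eta> \<le> t \<Longrightarrow> t \<le> ustar \<Longrightarrow> c0 \<le> f t"
    and R: "R > 0" and N: "N \<ge> 2"
    and U: "open U" "\<And>x. x \<in> U \<Longrightarrow> ustar - \<eta> / 4 < u x" "\<And>x. x \<in> U \<Longrightarrow> rdist x p0 < R0" "4 * (R0 + 1) \<le> R"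
  defines "\<theta> \<equiv> 2 * Q R * (real N * (K * (5 * (\<eta> / R)) powr (1 + \<delta>))) / c0"
  shows "(\<eta> / 2) ^ N * measure vol U \<le> \<theta> ^ N * measure vol (riem_ball A G p0 R)"
proof -
  let ?r = "\<lambda>x. rdist x p0"
  define \<gamma> where "\<gamma> = ustar - \<eta>"
  define e where "e = \<eta> / R"
  have e: "e > 0" "e * R = \<eta>" using \<eta> R by (simp_all add: e_def)
  \<comment> \<open>The extra 1 gives an open set around the closed ball of radius \<open>R\<close>
    on which \<rho> is controlled.\<close>
  define D where "D = {x. ?r x < R + 1}"
  have D: "open D" unfolding D_def by (intro open_Collect_less continuous_on_rdist continuous_on_const)
  have DK: "D \<subseteq> closed_rball p0 (R + 1)" by (auto simp: D_def closed_rball_def)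
  obtain \<rho> where \<rho>: "Ck_on 1 UNIV \<rho>"
    "\<And>p. p \<in> closed_rball p0 (R + 1) \<Longrightarrow> ?r p \<le> \<rho> p \<and> \<rho> p \<le> ?r p + 1"
    "\<And>p c v. p \<in> D \<Longrightarrow> c \<in> A \<Longrightarrow> p \<in> fst c \<Longrightarrow> \<bar>dform \<rho> c p v\<bar> \<le> 5 * metric_norm G c p v"
    using smooth_distance[OF compact_closed_rball[OF complete] D DK, where ?p0.0=p0] by blast
  define w where "w x = u x - \<gamma> + (- e) * \<rho> x" for x
  have w1: "Ck_on 1 UNIV w" unfolding w_def
    by (intro Ck_on_add Ck_on_diff Ck_on_mult Ck_on_const open_UNIV u \<rho>(1))
  \<comment> \<open>Outside \<open>D\<close> nothing is known about \<rho>, so the power is cut off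
    there; the cut does no harm because w can be positive in \<open>D\<close> only where r <
    R.\<close>
  define F where "F j x = (if x \<in> D then (max 0 (w x)) ^ j else 0)" for j x
  have \<rho>D: "?r x \<le> \<rho> x" "\<rho> x \<le> ?r x + 1" if "x \<in> D" for x using \<rho>(2) DK that by blast+
  have wpos: "?r x < R \<and> \<gamma> < u x \<and> w x \<le> \<eta>" if x: "x \<in> D" "0 < w x" for x
  proof -
    have "e * \<rho> x < u x - \<gamma>" using x by (simp add: w_def)
    also have "\<dots> \<le> e * R" using u_le[of x] e by (simp add: \<gamma>_def)
    finally have "\<rho> x < R" using e(1) by simp
    moreover have "0 \<le> \<rho> x" using \<rho>D(1)[OF x(1)] rdist_nonneg[of x p0] by linarith
    then have "0 \<le> e * \<rho> x" using e(1) by simp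
    ultimately show ?thesis
      using \<rho>D(1)[OF x(1)] \<open>e * \<rho> x < u x - \<gamma>\<close> u_le[of x] by (simp add: w_def \<gamma>_def)
  qed
  define L where "L = closed_rball p0 R \<inter> {x. \<gamma> \<le> u x}"
  have cu: "continuous_on UNIV u" by (rule Ck_on_continuous[OF u open_UNIV])
  have L: "compact L" unfolding L_def
    by (intro compact_Int_closed compact_closed_rball complete closed_Collect_le cu continuous_on_const)
  have LD: "L \<subseteq> D" by (auto simp: L_def D_def closed_rball_def)
  have F0: "F j x = 0" if "x \<notin> L" "j \<ge> 1" for j x
  proof (cases "x \<in> D \<and> 0 < w x")
    case True
    then have "x \<in> L" using wpos[of x] by (simp add: L_def closed_rball_def)
    then show ?thesis using that by simp
  next
    case False
    then show ?thesis using that(2) by (auto simp: F_def power_0_left)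
  qed
  have F0': "F j x = 0" if "x \<notin> L" "j = N \<or> j = N - 1" for j x using F0 that N by auto
  have cF: "continuous_on UNIV (F j)" if "j \<ge> 1" for j
  proof (rule continuous_on_extend_zero[OF _ D compact_imp_closed[OF L] LD])
    have "continuous_on D (\<lambda>x. (max 0 (w x)) ^ j)"
      by (intro continuous_intros continuous_on_subset[OF Ck_on_continuous[OF w1 open_UNIV]]) auto
    then show "continuous_on D (F j)" by (rule continuous_on_eq) (simp add: F_def)
  qed (use F0 that in blast)
  have Fi: "integrable vol (F j)" if "j \<ge> 1" for j
    by (rule integrable_compact_support[OF cF[OF that] L]) (use F0 that in blast)
  have Fn: "F j x \<ge> 0" for j x by (simp add: F_def)
  let ?\<psi> = "F N"
  have F1: "Ck_on 1 UNIV ?\<psi>"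
  proof (rule Ck_on_local)
    fix p
    have "Ck_on 1 D (\<lambda>x. (max 0 (w x)) ^ N)"
      by (rule Ck_on_compose[OF D Ck_on_subset[OF w1 subset_UNIV] pos_part_power_C1[OF N]]) simp
    then have 1: "Ck_on 1 D ?\<psi>" by (rule Ck_on_cong[OF D, rotated]) (simp add: F_def)
    have "Ck_on 1 (- L) ?\<psi>"
      by (rule Ck_on_cong[OF open_Compl[OF compact_imp_closed[OF L]] _ Ck_on_const[of _ _ 0]]) (use F0' in auto)
    then show "\<exists>V. open V \<and> p \<in> V \<and> Ck_on 1 V ?\<psi>"
      using 1 D LD open_Compl[OF compact_imp_closed[OF L]] by (cases "p \<in> D") blast+
  qed
  \<comment> \<open>On \<open>L\<close> one has u \<ge> u* - \<eta> > \<gamma>0, so the support lies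
    where the inequality is assumed.\<close>
  have LW: "L \<subseteq> {x. u x > \<gamma>0}" using \<eta>(2) by (auto simp: L_def \<gamma>_def)
  have oW: "open {x. u x > \<gamma>0}" by (intro open_Collect_less cu continuous_on_const)
  have ch: "continuous_on UNIV (\<lambda>x. b x * f (u x))"
    by (intro continuous_on_mult b_cont continuous_on_compose2[OF f_cont cu]) simp
  have "weak_ge \<phi> u (\<lambda>x. b x * f (u x)) ?\<psi>"
    by (rule weak_ge_C1[OF u phi_cont phi_0 ineq ch oW L LW F1 F0' Fn]) auto
  then have weak: "(LINT x|vol. b x * f (u x) * ?\<psi> x) \<le> - (LINT x|vol. pairing_gradient A G (phi_gradient G \<phi> u) ?\<psi> x)"
    using weak_ge_def[OF u phi_cont phi_0] by simp
  let ?P = "pairing_gradient A G (phi_gradient G \<phi> u) ?\<psi>"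
  let ?k = "real N * (K * (5 * e) powr (1 + \<delta>))"
  have k: "?k \<ge> 0" using K_pos by simp
  have pair: "- ?P x \<le> ?k * F (N - 1) x" for x
  proof (cases "x \<in> D")
    case True
    obtain c where c: "c \<in> A" "x \<in> fst c" using ex_chart by blast
    have "dform ?\<psi> c x = dform (\<lambda>y. (max 0 (w y)) ^ N) c x"
      by (rule dform_cong[OF D True c]) (simp add: F_def)
    then have d1: "dform ?\<psi> c x v = (real N * (max 0 (w x)) ^ (N - 1)) * dform w c x v" for v
      using dform_compose[OF w1 UNIV_I c pos_part_power_deriv[OF N]] by simp
    have u\<gamma>: "Ck_on 1 UNIV (\<lambda>y. u y + - \<gamma>)" by (intro Ck_on_add Ck_on_const open_UNIV u)
    have me: "Ck_on 1 UNIV (\<lambda>y. (- e) * \<rho> y)" by (intro Ck_on_mult Ck_on_const open_UNIV \<rho>(1))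
    have d2: "dform w c x v = dform u c x v - e * dform \<rho> c x v" for v
    proof -
      have "w = (\<lambda>y. (u y + - \<gamma>) + (- e) * \<rho> y)" by (simp add: w_def fun_eq_iff)
      then have "dform w c x v = dform (\<lambda>y. u y + - \<gamma>) c x v + dform (\<lambda>y. (- e) * \<rho> y) c x v"
        using dform_add[OF u\<gamma> me UNIV_I c] by simp
      also have "dform (\<lambda>y. u y + - \<gamma>) c x v = dform u c x v"
        using dform_add[OF u Ck_on_const UNIV_I c, of "- \<gamma>" v] by (simp add: dform_const)
      also have "dform (\<lambda>y. (- e) * \<rho> y) c x v = - e * dform \<rho> c x v"
        using dform_mult[OF Ck_on_const \<rho>(1) UNIV_I c, of "- e" v] by (simp add: dform_const)
      finally show ?thesis by simp
    qed
    have lin: "linear (dform \<rho> c x)" by (rule linear_dform[OF \<rho>(1) UNIV_I c])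
    \<comment> \<open>The penalty \<open>e * \<rho>\<close> has slope at most \<open>5 * e\<close>,
      the value of \<open>l\<close> in the flux estimate.\<close>
    have "- (K * (5 * e) powr (1 + \<delta>)) \<le> dform u c x (phi_gradient G \<phi> u c x) - e * dform \<rho> c x (phi_gradient G \<phi> u c x)"
    proof (rule flux_slope_bound[where d="\<lambda>v. e * dform \<rho> c x v", OF c u phi_pos phi_bound K_pos delta_pos])
      show "\<bar>e * dform \<rho> c x v\<bar> \<le> 5 * e * metric_norm G c x v" for v
        using \<rho>(3)[OF True c, of v] e(1) by (simp add: abs_mult)
      show "e * dform \<rho> c x (t *\<^sub>R v) = t * (e * dform \<rho> c x v)" for t v
        by (simp add: linear_cmul[OF lin])
    qed (use e in auto)
    then have "- (K * (5 * e) powr (1 + \<delta>)) \<le> dform w c x (phi_gradient G \<phi> u c x)" by (simp add: d2)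
    from mult_left_mono[OF this, of "real N * (max 0 (w x)) ^ (N - 1)"]
    have "- (?k * F (N - 1) x) \<le> ?P x"
      unfolding pairing_eq[OF u phi_cont phi_0 c F1] d1 using True by (simp add: F_def mult_ac)
    then show ?thesis by simp
  next
    case False
    then have "x \<notin> L" using LD by blast
    then have "?P x = 0"
      by (intro pairing_off_support[OF u phi_cont phi_0 F1 compact_imp_closed[OF L]] F0') auto
    then show ?thesis using k Fn by (simp add: mult_nonneg_nonneg)
  qed
  have N1: "N - 1 \<ge> 1" "N \<ge> 1" using N by auto
  have Pi: "integrable vol ?P" by (rule integrable_pairing[OF u phi_cont phi_0 F1 L F0']) auto
  have QR: "Q R > 0" using Q_pos R by simp
  have low: "c0 / Q R * ?\<psi> x \<le> b x * f (u x) * ?\<psi> x" for x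
  proof (cases "x \<in> D \<and> 0 < w x")
    case True
    then have x: "?r x < R" "\<gamma> < u x" using wpos by auto
    have "c0 \<le> f (u x)" using c0(2)[of "u x"] x(2) u_le by (simp add: \<gamma>_def)
    moreover have "1 / Q R \<le> b x"
    proof -
      have "Q (?r x) \<le> Q R" using mono_onD[OF Q_mono, of "?r x" R] x(1) rdist_nonneg R by simp
      then have "1 / Q R \<le> 1 / Q (?r x)" using Q_pos[of "?r x"] rdist_nonneg by (simp add: frac_le)
      then show ?thesis using b_bound[of x] by linarith
    qed
    ultimately have "1 / Q R * c0 \<le> b x * f (u x)" using QR c0(1) by (intro mult_mono') auto
    then show ?thesis using Fn[of N x] by (intro mult_right_mono) simp_all
  next
    case False
    then have "?\<psi> x = 0" using N by (auto simp: F_def power_0_left)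
    then show ?thesis by simp
  qed
  have hi: "integrable vol (\<lambda>x. b x * f (u x) * ?\<psi> x)"
    by (rule integrable_compact_support[OF continuous_on_mult[OF ch cF[OF N1(2)]] L]) (use F0' in simp)
  have "c0 / Q R * (LINT x|vol. ?\<psi> x) = (LINT x|vol. c0 / Q R * ?\<psi> x)" by simp
  also have "\<dots> \<le> (LINT x|vol. b x * f (u x) * ?\<psi> x)"
    by (rule integral_mono[OF integrable_mult_right[OF Fi[OF N1(2)]] hi low])
  also have "\<dots> \<le> (LINT x|vol. - ?P x)" using weak by simp
  also have "\<dots> \<le> (LINT x|vol. ?k * F (N - 1) x)"
    by (rule integral_mono[OF Bochner_Integration.integrable_minus[OF Pi] integrable_mult_right[OF Fi[OF N1(1)]] pair])
  finally have I1: "c0 / Q R * (LINT x|vol. ?\<psi> x) \<le> (LINT x|vol. ?k * F (N - 1) x)" .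
  let ?B = "riem_ball A G p0 R"
  have Bo: "open ?B" unfolding riem_ball_def by (intro open_Collect_less continuous_on_rdist continuous_on_const)
  have "emeasure vol ?B \<le> emeasure vol (closed_rball p0 R)"
    by (rule emeasure_mono) (auto simp: riem_ball_def closed_rball_def closed_closed_rball[unfolded closed_rball_def] borel_closed)
  also have "\<dots> < \<infinity>" by (rule emeasure_vol_compact[OF compact_closed_rball[OF complete]])
  finally have Bf: "emeasure vol ?B < \<infinity>" .
  have Bi: "integrable vol (indicat_real ?B)" using Bf Bo by (intro integrable_real_indicator) auto
  have \<theta>k: "?k = c0 / (2 * Q R) * \<theta>" using c0(1) QR by (simp add: \<theta>_def e_def field_simps)
  have \<theta>: "\<theta> \<ge> 0" unfolding \<theta>_def using K_pos QR c0(1) by simp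
  \<comment> \<open>Where \<theta> \<le> w the left side is at most w^N, otherwise at most
    \<theta>^N; the constant term is integrated only over the ball.\<close>
  have split: "?k * F (N - 1) x \<le> c0 / (2 * Q R) * (?\<psi> x + \<theta> ^ N * indicat_real ?B x)" for x
  proof (cases "x \<in> D \<and> 0 < w x")
    case True
    then have xB: "x \<in> ?B" using wpos by (simp add: riem_ball_def)
    have NN: "N = Suc (N - 1)" using N by simp
    have w: "0 < w x" "x \<in> D" using True by auto
    have "\<theta> * w x ^ (N - 1) \<le> w x ^ N + \<theta> ^ N"
    proof (cases "\<theta> \<le> w x")
      case True
      then have "\<theta> * w x ^ (N - 1) \<le> w x * w x ^ (N - 1)" using w by (intro mult_right_mono) auto
      also have "\<dots> = w x ^ N" using NN by (metis power_Suc)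
      finally show ?thesis using \<theta> by (simp add: add_increasing2)
    next
      case False
      then have "\<theta> * w x ^ (N - 1) \<le> \<theta> * \<theta> ^ (N - 1)" using w \<theta> by (intro mult_left_mono power_mono) auto
      also have "\<dots> = \<theta> ^ N" using NN by (metis power_Suc)
      finally show ?thesis using w by (simp add: add_increasing)
    qed
    then have "c0 / (2 * Q R) * (\<theta> * w x ^ (N - 1)) \<le> c0 / (2 * Q R) * (w x ^ N + \<theta> ^ N)"
      using c0(1) QR by (intro mult_left_mono) auto
    then show ?thesis unfolding \<theta>k using w xB by (simp add: F_def mult.assoc)
  next
    case False
    then have "F (N - 1) x = 0" using N by (auto simp: F_def power_0_left)
    then show ?thesis using \<theta> c0(1) QR Fn[of N x] by simp
  qed
  have "(LINT x|vol. ?k * F (N - 1) x) \<le> (LINT x|vol. c0 / (2 * Q R) * (?\<psi> x + \<theta> ^ N * indicat_real ?B x))"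
    by (rule integral_mono[OF integrable_mult_right[OF Fi[OF N1(1)]] _ split])
      (intro integrable_mult_right Bochner_Integration.integrable_add Fi[OF N1(2)] Bi)
  also have "\<dots> = c0 / (2 * Q R) * ((LINT x|vol. ?\<psi> x) + \<theta> ^ N * measure vol ?B)"
    using Fi[OF N1(2)] Bi Bo by simp
  finally have "c0 / Q R * (LINT x|vol. ?\<psi> x) \<le> c0 / (2 * Q R) * ((LINT x|vol. ?\<psi> x) + \<theta> ^ N * measure vol ?B)"
    using I1 by linarith
  then have I2: "(LINT x|vol. ?\<psi> x) \<le> \<theta> ^ N * measure vol ?B"
    using c0(1) QR by (simp add: field_simps)
  have R01: "R0 + 1 \<le> R / 4" using U(4) by simp
  \<comment> \<open>On \<open>U\<close> the function u lies less than \<eta>/4 below its supremum,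
    and \<rho> \<le> R0 + 1 \<le> R/4 makes the penalty at most \<eta>/4; this leaves at least
    \<eta>/2.\<close>
  have UB: "x \<in> ?B \<and> x \<in> D \<and> \<eta> / 2 \<le> w x" if x: "x \<in> U" for x
  proof -
    have r: "?r x < R0" "R0 < R" using U(3)[OF x] R01 R by auto
    have xD: "x \<in> D" using r by (simp add: D_def)
    have "\<rho> x \<le> R / 4" using \<rho>D(2)[OF xD] r R01 by linarith
    then have "e * \<rho> x \<le> e * (R / 4)" using e(1) by (intro mult_left_mono) auto
    also have "\<dots> = \<eta> / 4" using e(2) by simp
    finally have "\<eta> / 2 \<le> w x" using U(2)[OF x] by (simp add: w_def \<gamma>_def)
    then show ?thesis using r xD by (simp add: riem_ball_def)
  qed
  have Ui: "integrable vol (indicat_real U)"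
  proof -
    have "emeasure vol U \<le> emeasure vol ?B" by (rule emeasure_mono) (use UB Bo in auto)
    then show ?thesis using Bf U(1) by (intro integrable_real_indicator) (auto intro: le_less_trans)
  qed
  have "(\<eta> / 2) ^ N * measure vol U = (LINT x|vol. (\<eta> / 2) ^ N * indicat_real U x)" using U(1) by simp
  also have "\<dots> \<le> (LINT x|vol. ?\<psi> x)"
  proof (rule integral_mono[OF integrable_mult_right[OF Ui] Fi[OF N1(2)]])
    fix x
    show "(\<eta> / 2) ^ N * indicat_real U x \<le> ?\<psi> x"
    proof (cases "x \<in> U")
      case True
      have "(\<eta> / 2) ^ N \<le> (max 0 (w x)) ^ N" using UB[OF True] \<eta>(1) by (intro power_mono) auto
      then show ?thesis using True UB[OF True] by (simp add: F_def)
    qed (simp add: Fn)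
  qed
  finally show ?thesis using I2 by linarith
qed

text \<open>The quantity \<open>t\<close> is the value of N at which \<theta> equals \<eta>/(2e).
  Below it the quotient of \<eta>/2 and \<theta> is at least e, so the N-th power gives the volume a
  factor exp(N).\<close>

lemma log_volume_lower_bound:
  assumes \<eta>: "\<eta> > 0" "\<gamma>0 < ustar - \<eta>" and c0: "c0 > 0" "\<And>t. ustar - \<eta> \<le> t \<Longrightarrow> t \<le> ustar \<Longrightarrow> c0 \<le> f t"
    and R: "R > 0" and U: "open U" "U \<noteq> {}" "\<And>x. x \<in> U \<Longrightarrow> ustar - \<eta> / 4 < u x"
      "\<And>x. x \<in> U \<Longrightarrow> rdist x p0 < R0" "4 * (R0 + 1) \<le> R"
  defines "t \<equiv> c0 * \<eta> / (4 * exp 1 * Q R * (K * (5 * (\<eta> / R)) powr (1 + \<delta>)))"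
  assumes t2: "t \<ge> 2"
  shows "t / 2 + ln (measure vol U) \<le> ln (measure vol (riem_ball A G p0 R))"
proof -
  \<comment> \<open>Rounding down loses at most half, because t \<ge> 2; it also provides the
    exponent at least 2 that a C^1 test function requires.\<close>
  define N where "N = nat \<lfloor>t\<rfloor>"
  have N: "N \<ge> 2" "real N \<le> t" "t / 2 \<le> real N"
    using t2 by (auto simp: N_def le_nat_iff le_floor_iff) linarith+
  have QR: "Q R > 0" using Q_pos R by simp
  let ?k = "K * (5 * (\<eta> / R)) powr (1 + \<delta>)"
  have k: "?k > 0" using K_pos \<eta> R by simp
  define \<theta> where "\<theta> = 2 * Q R * (real N * ?k) / c0"
  note main = truncated_power_integral_bound[OF \<eta> c0 R N(1) U(1,3,4,5), folded \<theta>_def]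
  have \<theta>0: "\<theta> > 0" using QR k c0(1) N(1) by (simp add: \<theta>_def)
  have "\<theta> \<le> 2 * Q R * (t * ?k) / c0"
    unfolding \<theta>_def using N(2) QR k c0(1) by (intro divide_right_mono mult_left_mono mult_right_mono) auto
  also have "\<dots> = \<eta> / 2 / exp 1" unfolding t_def using QR K_pos \<eta>(1) R c0(1) by (simp add: field_simps)
  finally have \<theta>: "exp 1 * \<theta> \<le> \<eta> / 2" by (simp add: field_simps)
  obtain x where "x \<in> U" using U(2) by blast
  have UB: "U \<subseteq> riem_ball A G p0 R" using U(4,5) R by (force simp: riem_ball_def)
  have "emeasure vol (riem_ball A G p0 R) \<le> emeasure vol (closed_rball p0 R)"
    by (rule emeasure_mono) (auto simp: riem_ball_def closed_rball_def closed_closed_rball[unfolded closed_rball_def] borel_closed)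
  also have "\<dots> < \<infinity>" by (rule emeasure_vol_compact[OF compact_closed_rball[OF complete]])
  finally have Bf: "emeasure vol (riem_ball A G p0 R) < \<infinity>" .
  have Bo: "open (riem_ball A G p0 R)" unfolding riem_ball_def
    by (intro open_Collect_less continuous_on_rdist continuous_on_const)
  have "emeasure vol U \<le> emeasure vol (riem_ball A G p0 R)" by (rule emeasure_mono) (use UB Bo in auto)
  then have Uf: "emeasure vol U < \<infinity>" using Bf by (rule le_less_trans)
  have pos: "measure vol U > 0"
    using emeasure_vol_open_pos[OF U(1) \<open>x \<in> U\<close>] Uf by (simp add: measure_def enn2real_positive_iff)
  have "(exp 1 * \<theta>) ^ N * measure vol U \<le> (\<eta> / 2) ^ N * measure vol U"
    using \<theta> \<theta>0 by (intro mult_right_mono power_mono) auto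
  also have "\<dots> \<le> \<theta> ^ N * measure vol (riem_ball A G p0 R)" by (rule main)
  finally have "\<theta> ^ N * (exp (real N) * measure vol U) \<le> \<theta> ^ N * measure vol (riem_ball A G p0 R)"
    by (simp add: power_mult_distrib exp_of_nat_mult[symmetric] mult_ac)
  then have le: "exp (real N) * measure vol U \<le> measure vol (riem_ball A G p0 R)" using \<theta>0 by simp
  have "real N + ln (measure vol U) = ln (exp (real N) * measure vol U)" using pos by (simp add: ln_mult)
  also have "\<dots> \<le> ln (measure vol (riem_ball A G p0 R))"
    using le pos by (intro ln_mono) auto
  finally show ?thesis using N(3) by linarith
qed

text \<open>For fixed \<eta> the set \<open>U\<close> does not change with r, and Q(r) /
  r^(1+\<delta>) tends to 0, so the additive constant ln vol U costs at most 1 in the end.\<close>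

lemma liminf_volume_growth:
  assumes Q_small: "Q \<in> o[at_top](\<lambda>t. t powr (1 + \<delta>))"
    and \<eta>: "\<eta> > 0" "\<gamma>0 < ustar - \<eta>" and c0: "c0 > 0" "\<And>t. ustar - \<eta> \<le> t \<Longrightarrow> t \<le> ustar \<Longrightarrow> c0 \<le> f t"
    and sup: "\<And>z. z < ustar \<Longrightarrow> \<exists>x. z < u x"
  shows "ereal (c0 * \<eta> powr (- \<delta>) / (8 * exp 1 * K * 5 powr (1 + \<delta>)) - 1) \<le>
    Liminf at_top (\<lambda>r. ereal (Q r * ln (measure vol (riem_ball A G p0 r)) / r powr (1 + \<delta>)))"
proof (rule Liminf_bounded)
  obtain x0 where x0: "ustar - \<eta> / 4 < u x0" using sup[of "ustar - \<eta> / 4"] \<eta> by auto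
  define R0 where "R0 = rdist x0 p0 + 1"
  define U where "U = {x. ustar - \<eta> / 4 < u x} \<inter> {x. rdist x p0 < R0}"
  have cu: "continuous_on UNIV u" by (rule Ck_on_continuous[OF u open_UNIV])
  have U: "open U" "U \<noteq> {}" "\<And>x. x \<in> U \<Longrightarrow> ustar - \<eta> / 4 < u x" "\<And>x. x \<in> U \<Longrightarrow> rdist x p0 < R0"
  proof -
    show "open U" unfolding U_def
      by (intro open_Int open_Collect_less continuous_on_rdist continuous_on_const cu)
    have "x0 \<in> U" using x0 by (simp add: U_def R0_def)
    then show "U \<noteq> {}" by blast
  qed (auto simp: U_def)
  \<comment> \<open>With this constant t = 2 C r^(1+\<delta>) / Q(r), so the term t/2 contributes
    exactly \<open>C\<close> after multiplication by Q(r) / r^(1+\<delta>).\<close>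
  define C where "C = c0 * \<eta> powr (- \<delta>) / (8 * exp 1 * K * 5 powr (1 + \<delta>))"
  have C: "C > 0" using c0 \<eta> K_pos by (simp add: C_def)
  let ?V = "\<bar>ln (measure vol U)\<bar> + 1"
  \<comment> \<open>The bound by \<open>C\<close> ensures t \<ge> 2; the bound by
    \<open>1 / ?V\<close> makes the contribution of ln vol U at least -1.\<close>
  define s where "s = min C (1 / ?V)"
  have s: "s > 0" using C by (simp add: s_def)
  have "eventually (\<lambda>r. norm (Q r) \<le> s * norm (r powr (1 + \<delta>))) at_top"
    using landau_o.smallD[OF Q_small s] .
  moreover have "eventually (\<lambda>r. r > 0 \<and> 4 * (R0 + 1) \<le> r) at_top"
    using eventually_gt_at_top[of 0] eventually_ge_at_top[of "4 * (R0 + 1)"] by eventually_elim auto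
  ultimately show "eventually (\<lambda>r. ereal (C - 1) \<le> ereal (Q r * ln (measure vol (riem_ball A G p0 r)) / r powr (1 + \<delta>))) at_top"
  proof eventually_elim
    case (elim r)
    then have r: "r > 0" "4 * (R0 + 1) \<le> r" by auto
    have Qr: "Q r > 0" using Q_pos r by simp
    let ?p = "r powr (1 + \<delta>)"
    have p: "?p > 0" using r by simp
    have Qs: "Q r \<le> s * ?p" using elim Qr p by simp
    let ?t = "c0 * \<eta> / (4 * exp 1 * Q r * (K * (5 * (\<eta> / r)) powr (1 + \<delta>)))"
    have "(5 * (\<eta> / r)) powr (1 + \<delta>) = 5 powr (1 + \<delta>) * (\<eta> * \<eta> powr \<delta>) / ?p"
      using \<eta>(1) r by (simp add: powr_mult powr_divide powr_add)
    then have t: "?t = 2 * C * ?p / Q r"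
      using \<eta>(1) r Qr K_pos p by (simp add: C_def powr_minus field_simps)
    have "2 * Q r \<le> 2 * C * ?p"
    proof -
      have "s * ?p \<le> C * ?p" using p by (intro mult_right_mono) (auto simp: s_def)
      then show ?thesis using Qs by linarith
    qed
    then have t2: "?t \<ge> 2" unfolding t using Qr by (simp add: field_simps)
    have "?t / 2 + ln (measure vol U) \<le> ln (measure vol (riem_ball A G p0 r))"
      by (rule log_volume_lower_bound[OF \<eta> c0 r(1) U r(2) t2])
    then have "Q r / ?p * (?t / 2 + ln (measure vol U)) \<le> Q r / ?p * ln (measure vol (riem_ball A G p0 r))"
      using Qr p by (intro mult_left_mono) auto
    moreover have "Q r / ?p * (?t / 2 + ln (measure vol U)) = C + Q r / ?p * ln (measure vol U)"
      unfolding t using Qr p by (simp add: field_simps)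
    moreover have "- 1 \<le> Q r / ?p * ln (measure vol U)"
    proof -
      have "Q r / ?p \<le> 1 / ?V"
      proof -
        have "s * ?p \<le> 1 / ?V * ?p" using p by (intro mult_right_mono) (auto simp: s_def)
        then show ?thesis using Qs p by (simp add: divide_le_eq)
      qed
      then have "Q r / ?p * \<bar>ln (measure vol U)\<bar> \<le> 1 / ?V * \<bar>ln (measure vol U)\<bar>" by (rule mult_right_mono) simp
      also have "\<dots> \<le> 1" by (simp add: field_simps)
      finally have "\<bar>Q r / ?p * ln (measure vol U)\<bar> \<le> 1" using Qr p by (simp add: abs_mult)
      then show ?thesis by linarith
    qed
    ultimately show ?case by simp
  qed
qed

end

end

section \<open>Contradiction with the volume growth as \<eta> tends to 0\<close>

theorem theoremA:
  fixes A :: "('a::{t2_space, second_countable_topology}, 'n::finite) chart set"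
    and G :: "('a, 'n) chart \<Rightarrow> 'a \<Rightarrow> real^'n^'n"
    and p\<^sub>0 :: 'a
    and \<phi> Q f :: "real \<Rightarrow> real"
    and b u :: "'a \<Rightarrow> real"
    and K \<delta> \<gamma> :: real
  assumes manifold: "riemannian_manifold A G"
    and dimension: "CARD('n) \<ge> 2"
    and connected: "connected (UNIV :: 'a set)"
    and noncompact: "\<not> compact (UNIV :: 'a set)"
    and complete: "complete_manifold A G"
    and phi_C1: "\<phi> C1_differentiable_on {0<..}"
    and phi_cont: "continuous_on {0..} \<phi>"
    and phi_0: "\<phi> 0 = 0"
    and phi_pos: "\<And>t. t > 0 \<Longrightarrow> \<phi> t > 0"
    and K_pos: "K > 0"
    and delta_pos: "\<delta> > 0"
    and phi_bound: "\<And>t. t \<ge> 0 \<Longrightarrow> \<phi> t \<le> K * t powr \<delta>"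
    and Q_pos: "\<And>t. t \<ge> 0 \<Longrightarrow> Q t > 0"
    and Q_mono: "mono_on {0..} Q"
    and Q_small: "Q \<in> o[at_top](\<lambda>t. t powr (1 + \<delta>))"
    and b_cont: "continuous_on UNIV b"
    and b_bound: "\<And>x. b x \<ge> 1 / Q (riem_dist A G x p\<^sub>0)"
    and f_cont: "continuous_on UNIV f"
    and u_C1: "C1_function A u"
    and u_bdd: "bdd_above (range u)"
    and gamma: "\<gamma> < (SUP x. u x)"
    and ineq: "div_ge_on A G {x. u x > \<gamma>} (phi_gradient G \<phi> u) (\<lambda>x. b x * f (u x))"
    and volume_growth:
      "Liminf at_top (\<lambda>r. ereal (Q r * ln (measure (riem_volume A G) (riem_ball A G p\<^sub>0 r))
                                  / r powr (1 + \<delta>))) < \<infinity>"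
  shows "f (SUP x. u x) \<le> 0"
proof (rule ccontr)
  assume "\<not> f (SUP x. u x) \<le> 0"
  define us where "us = (SUP x. u x)"
  have fus: "f us > 0" using \<open>\<not> f (SUP x. u x) \<le> 0\<close> by (simp add: us_def)
  interpret connected_riemannian_manifold A G
    using manifold connected by (simp add: connected_riemannian_manifold_def connected_riemannian_manifold_axioms_def)
  have u: "Ck_on 1 UNIV u" using u_C1 by (simp add: C1_function_iff)
  have u_le: "u x \<le> us" for x unfolding us_def by (rule cSUP_upper[OF UNIV_I u_bdd])
  have sup: "\<exists>x. z < u x" if "z < us" for z
    using less_cSUP_iff[OF _ u_bdd, of z] that by (auto simp: us_def)
  have "isCont f us" using f_cont continuous_on_eq_continuous_at by blast
  \<comment> \<open>Half of the value at the supremum bounds f from below near it, with a constant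
    that stays fixed while \<eta> shrinks.\<close>
  then obtain d where d: "d > 0" "\<And>t. dist t us < d \<Longrightarrow> dist (f t) (f us) < f us / 2"
    using fus unfolding continuous_at_eps_delta by (metis half_gt_zero)
  let ?c = "f us / 2"
  let ?C = "?c / (8 * exp 1 * K * 5 powr (1 + \<delta>))"
  let ?L = "Liminf at_top (\<lambda>r. ereal (Q r * ln (measure (riem_volume A G) (riem_ball A G p\<^sub>0 r)) / r powr (1 + \<delta>)))"
  have lower: "ereal (?C * \<eta> powr (- \<delta>) - 1) \<le> ?L" if \<eta>: "\<eta> > 0" "\<eta> < d" "\<eta> < us - \<gamma>" for \<eta>
  proof -
    have "?c \<le> f t" if "us - \<eta> \<le> t" "t \<le> us" for t
    proof -
      have "dist t us < d" using that \<eta> by (simp add: dist_real_def)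
      from d(2)[OF this] show ?thesis unfolding dist_real_def abs_less_iff by linarith
    qed
    then show ?thesis
      using liminf_volume_growth[OF complete phi_cont phi_0 phi_pos K_pos delta_pos phi_bound Q_pos Q_mono
          b_cont b_bound f_cont u u_le ineq Q_small \<eta>(1) _ half_gt_zero[OF fus] _ sup] \<eta>(3)
      by simp
  qed
  have "eventually (\<lambda>\<eta>::real. \<eta> > 0 \<and> \<eta> < d \<and> \<eta> < us - \<gamma>) (at_right 0)"
  proof -
    have "us - \<gamma> > 0" using gamma by (simp add: us_def)
    then show ?thesis using d(1) eventually_at_right_less[of 0] eventually_at_rightI[of 0 "min d (us - \<gamma>)" "\<lambda>\<eta>. \<eta> < d \<and> \<eta> < us - \<gamma>"]
      by (auto elim: eventually_elim2)
  qed
  then have ev: "eventually (\<lambda>\<eta>. ereal (?C * \<eta> powr (- \<delta>) - 1) \<le> ?L) (at_right 0)"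
    by eventually_elim (use lower in blast)
  have "?C > 0" using fus K_pos by simp
  then have "filterlim (\<lambda>\<eta>::real. ?C * \<eta> powr (- \<delta>) - 1) at_top (at_right 0)"
    using delta_pos by real_asymp
  then have big: "eventually (\<lambda>\<eta>. z \<le> ?C * \<eta> powr (- \<delta>) - 1) (at_right 0)" for z
    by (simp add: filterlim_at_top)
  \<comment> \<open>The lower limit does not involve \<eta>, so one sufficiently small \<eta> for
    each z shows that it exceeds every real number.\<close>
  have "ereal z \<le> ?L" for z
  proof -
    have "eventually (\<lambda>\<eta>. ereal z \<le> ?L) (at_right (0::real))"
      using ev big[of z] by eventually_elim (meson ereal_less_eq(3) order_trans)
    then show ?thesis by (simp add: eventually_const_iff)
  qed
  then have "?L = \<infinity>" by (meson ereal_top)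
  then show False using volume_growth by simp
qed

end
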